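(* Let $\varepsilon>0$ and $x\in E$. Then there exists $h=h(\varepsilon)>0$ such that the strategy $\hat V_h\in\mathbb V_h$ defined in the context is $\varepsilon$-optimal for both continuous-time functionals $J^d$ and $J$, i.e. $$J^d(x,\hat V_h)\le\inf_{V\in\mathbb V}J^d(x,V)+\varepsilon\quad\text{and}\quad J(x,\hat V_h)\le\inf_{V\in\mathbb V}J(x,V)+\varepsilon.$$
   Context: Conventions: $\mathbb N=\{0,1,2,\dots\}$, $\inf\emptyset:=\infty$; $\mathcal C_b(E)$ is the space of bounded continuous real functions on $E$; $\arg\min$ denotes a (measurably selected) minimiser. Process. $X=(X_t)_{t\ge0}$ is a continuous-time standard Feller–Markov process on a filtered space $(\Omega,\mathcal F,(\mathcal F_t))$ (standard in the usual sense of Markov process theory) with values in a compact metric space $(E,\rho)$ with Borel $\sigma$-field $\mathcal E$; $\mathbb P_x,\mathbb E_x$ are the law and expectation for the process started at $x\in E$, and $P_t(x,A):=\mathbb P_x[X_t\in A]$. The set of admissible after-impulse states is $U=E$. Standing assumptions. (1) $\beta:[0,\infty)\to(0,1]$ is weakly decreasing and continuous, $\beta(0)=1$, $\beta(t+s)\ge\beta(t)\beta(s)$ for all $t,s\ge0$, and $\int_0^\infty\beta(s)ds=\infty$. (2) $g:E\to\mathbb R$ is continuous and bounded; $c:E\times U\to\mathbb R_+$ is continuous and bounded, and for some $c_0>0$ we have $0<c_0\le c(x,\xi)\le c(x,\eta)+c(\eta,\xi)$ for $x,\xi,\eta\in E$. (3) For every $f\in\mathcal C_b(E)$ and $t>0$,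 the map $x\mapsto\mathbb E_x[f(X_t)]$ is in $\mathcal C_b(E)$. (4) For every $t>0$ there is $\Lambda_t\in(0,1)$ with $\sup_{x,y\in E}\sup_{A\in\mathcal E}|P_t(x,A)-P_t(y,A)|\le\Lambda_t$. Impulse control. A strategy is a sequence $V=(\tau_i,\xi_i)_{i=1}^\infty$ with $(\tau_i)$ an increasing (weakly, values in $[0,\infty]$) sequence of stopping times and $\xi_i$ $\mathcal F_{\tau_i}$-measurable $U$-valued random variables; $\mathbb V$ is the family of all strategies, and $\mathbb V_h\subset\mathbb V$ consists of those with impulse times restricted to $\{0,h,2h,\dots\}$ (or $\infty$, i.e. no impulse). On a countable product of copies of $(\Omega,\mathcal F,(\mathcal F_t))$ with coordinate process $(X^1_t,X^2_t,\dots)$, to each $x\in E$ and $V\in\mathbb V$ one associates a probability $\mathbb P^V_x$ (expectation $\mathbb E^V_x$) under which $X^1$ follows the uncontrolled dynamics from $x$ and, for each $i\ge1$, on $\{\tau_i<\infty\}$, $X^{i+1}_{\tau_i}=\xi_i$ and from time $\tau_i$ on $X^{i+1}$ follows the uncontrolled dynamics started afresh from $\xi_i$ (conditionally on the past). The controlled process is $Y_t:=X^i_t$ for $t\in[\tau_{i-1},\tau_i)$, $\tau_0\equiv0$. Functionals. For $x\in E$, $V\in\mathbb V$, $$J^d(x,V):=\limsup_{T\to\infty}\frac{\mathbb E^V_x\bigl[\int_0^T\beta(s)g(Y_s)ds+\sum_{i=1}^\infty1_{\{\tau_i\le T\}}\beta(\tau_i)c(X^i_{\tau_i},X^{i+1}_{\tau_i})\bigr]}{\int_0^T\beta(s)ds},$$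 $$J(x,V):=\limsup_{T\to\infty}\frac{\mathbb E^V_x\bigl[\int_0^Tg(Y_s)ds+\sum_{i=1}^\infty1_{\{\tau_i\le T\}}c(X^i_{\tau_i},X^{i+1}_{\tau_i})\bigr]}{T}.$$ The strategy $\hat V_h$. For each $h>0$ let $(w_h,\lambda_h)\in\mathcal C_b(E)\times\mathbb R$ be a solution (one exists, with $\lambda_h$ unique and $w_h$ unique up to an additive constant) to $$w_h(x)=\min\bigl(g(x)-\lambda_h+\mathbb E_x[w_h(X_h)],\,M_hw_h(x)\bigr),\quad x\in E,\qquad M_hw_h(x):=\inf_{\xi\in U}\Bigl(\tfrac1hc(x,\xi)+w_h(\xi)\Bigr).$$ Then $\hat V_h=(\hat\sigma_i,\hat\xi_i)_{i=1}^\infty$ is given by $\hat\sigma_0\equiv0$ and, for $i\ge1$, $$\hat\sigma_i:=h\inf\{n\in\mathbb N:n\ge\hat\sigma_{i-1}/h,\ w_h(X^i_{nh})=M_hw_h(X^i_{nh})\},$$ $$\hat\xi_i:=\arg\min_{\xi\in U}\Bigl(\tfrac1hc(X^i_{\hat\sigma_i},\xi)+w_h(\xi)\Bigr)1_{\{\hat\sigma_i<\infty\}}+\xi_0\,1_{\{\hat\sigma_i=\infty\}},$$ with $\xi_0\in U$ some fixed point. *)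

theory Defs
  imports "HOL-Probability.Probability"
begin

section \<open>The uncontrolled process\<close>

definition trans_prob ::
  "('e \<Rightarrow> 'w measure) \<Rightarrow> (real \<Rightarrow> 'w \<Rightarrow> 'e) \<Rightarrow> real \<Rightarrow> 'e \<Rightarrow> 'e set \<Rightarrow> real"
  where "trans_prob P X t x A = measure (P x) {w \<in> space (P x). X t w \<in> A}"

text \<open>
  The compact state space is the whole type; compact metric spaces are Polish, so the sort is no
  restriction. Time is \<open>t \<ge> 0\<close>; values of \<open>X\<close> at negative times are irrelevant. The filtration is
  indexed by \<open>[0, \<infinity>]\<close>, the range of stopping times, with \<open>F \<infinity>\<close> in the role of the terminal field.
  The strong Markov property is stated through transition probabilities, hence without shift
  operators. Completeness of the filtration is not required: completed filtrations are
  admitted, but so is the right-continuous raw one on path space, on whose countable powers the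
  controlled measures below can be constructed.
\<close>

locale standard_markov_process = filtration "space N" F
  for N :: "'w measure" and F :: "ennreal \<Rightarrow> 'w measure" +
  fixes X :: "real \<Rightarrow> 'w \<Rightarrow> 'e::polish_space" and P :: "'e \<Rightarrow> 'w measure"
  assumes compact_state_space: "compact (UNIV :: 'e set)"
    and sets_F_subset: "sets (F t) \<subseteq> sets N"
    and right_continuous_filtration: "t < \<infinity> \<Longrightarrow> sets (F t) = (\<Inter>s\<in>{t<..}. sets (F s))"
    and sets_P: "sets (P x) = sets N"
    and prob_space_P: "prob_space (P x)"
    and adapted: "0 \<le> r \<Longrightarrow> X r \<in> F (ennreal r) \<rightarrow>\<^sub>M borel"
    and right_continuous_paths: "w \<in> space N \<Longrightarrow> 0 \<le> r \<Longrightarrow> ((\<lambda>u. X u w) \<longlongrightarrow> X r w) (at_right r)"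
    and left_limits: "w \<in> space N \<Longrightarrow> 0 < r \<Longrightarrow> \<exists>l. ((\<lambda>u. X u w) \<longlongrightarrow> l) (at_left r)"
    and normal: "AE w in P x. X 0 w = x"
    and trans_prob_measurable:
      "0 \<le> r \<Longrightarrow> B \<in> sets borel \<Longrightarrow> (\<lambda>x. trans_prob P X r x B) \<in> borel_measurable borel"
    and strong_Markov:
      "stopping_time F \<tau> \<Longrightarrow> A \<in> sets (pre_sigma \<tau>) \<Longrightarrow> 0 \<le> r \<Longrightarrow> B \<in> sets borel \<Longrightarrow>
        measure (P x) {w \<in> A. \<tau> w < \<infinity> \<and> X (enn2real (\<tau> w) + r) w \<in> B}
        = (\<integral>w. indicator {w \<in> A. \<tau> w < \<infinity>} w * trans_prob P X r (X (enn2real (\<tau> w)) w) B \<partial>P x)"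
    and quasi_left_continuous:
      "(\<And>n. stopping_time F (T n)) \<Longrightarrow> (\<And>n w. w \<in> space N \<Longrightarrow> T n w \<le> T (Suc n) w) \<Longrightarrow>
        AE w in P x. (SUP n. T n w) < \<infinity> \<longrightarrow>
          (\<lambda>n. X (enn2real (T n w)) w) \<longlonglongrightarrow> X (enn2real (SUP n. T n w)) w"


section \<open>Strategies on the countable product\<close>

text \<open>
  Everything is indexed from 0: coordinate \<open>i\<close> of a point \<open>\<omega>\<close> of the product carries the process
  written \<open>X\<^sup>i\<^sup>+\<^sup>1\<close> on paper, and \<open>V i\<close> is the pair of the impulse time that ends the use of coordinate
  \<open>i\<close> and of the new state, in which coordinate \<open>i + 1\<close> starts.
\<close>

type_synonym ('w, 'e) strategy = "nat \<Rightarrow> ((nat \<Rightarrow> 'w) \<Rightarrow> ennreal) \<times> ((nat \<Rightarrow> 'w) \<Rightarrow> 'e)"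

abbreviation imp_time :: "('w, 'e) strategy \<Rightarrow> nat \<Rightarrow> (nat \<Rightarrow> 'w) \<Rightarrow> ennreal"
  where "imp_time V i \<equiv> fst (V i)"

abbreviation imp_state :: "('w, 'e) strategy \<Rightarrow> nat \<Rightarrow> (nat \<Rightarrow> 'w) \<Rightarrow> 'e"
  where "imp_state V i \<equiv> snd (V i)"

definition start_time :: "('w, 'e) strategy \<Rightarrow> nat \<Rightarrow> (nat \<Rightarrow> 'w) \<Rightarrow> ennreal"
  where "start_time V i \<omega> = (case i of 0 \<Rightarrow> 0 | Suc j \<Rightarrow> imp_time V j \<omega>)"

definition start_state :: "'e \<Rightarrow> ('w, 'e) strategy \<Rightarrow> nat \<Rightarrow> (nat \<Rightarrow> 'w) \<Rightarrow> 'e"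
  where "start_state x V i \<omega> = (case i of 0 \<Rightarrow> x | Suc j \<Rightarrow> imp_state V j \<omega>)"

definition copies :: "'w measure \<Rightarrow> (nat \<Rightarrow> 'w) measure"
  where "copies N = Pi\<^sub>M UNIV (\<lambda>_. N)"

text \<open>
  Information at time \<open>t\<close> from the coordinates \<open>0, \<dots>, i\<close>; \<open>sigma (space N) {}\<close> is the trivial field.
\<close>

definition copies_filtration ::
  "'w measure \<Rightarrow> (ennreal \<Rightarrow> 'w measure) \<Rightarrow> nat \<Rightarrow> ennreal \<Rightarrow> (nat \<Rightarrow> 'w) measure"
  where "copies_filtration N F i t = Pi\<^sub>M UNIV (\<lambda>j. if j \<le> i then F t else sigma (space N) {})"

definition strategies ::
  "'w measure \<Rightarrow> (ennreal \<Rightarrow> 'w measure) \<Rightarrow> ('w, 'e::topological_space) strategy set"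
  where "strategies N F = {V. \<forall>i.
    stopping_time (copies_filtration N F i) (imp_time V i) \<and>
    (\<forall>\<omega>\<in>space (copies N). imp_time V i \<omega> \<le> imp_time V (Suc i) \<omega>) \<and>
    imp_state V i \<in>
      filtration.pre_sigma (space (copies N)) (copies_filtration N F i) (imp_time V i) \<rightarrow>\<^sub>M borel}"

definition grid_strategies ::
  "'w measure \<Rightarrow> (ennreal \<Rightarrow> 'w measure) \<Rightarrow> real \<Rightarrow> ('w, 'e::topological_space) strategy set"
  where "grid_strategies N F h = {V \<in> strategies N F. \<forall>i. \<forall>\<omega>\<in>space (copies N).
    imp_time V i \<omega> = \<infinity> \<or> (\<exists>n::nat. imp_time V i \<omega> = ennreal (real n * h))}"


section \<open>Controlled measures\<close>

text \<open>
  What is known when coordinate \<open>i\<close> has run up to time \<open>t\<close>: all of the earlier coordinates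
  (coordinate \<open>i\<close> is drawn conditionally on them), and coordinate \<open>i\<close> itself up to time \<open>t\<close>.
\<close>

definition past_filtration ::
  "'w measure \<Rightarrow> (ennreal \<Rightarrow> 'w measure) \<Rightarrow> nat \<Rightarrow> ennreal \<Rightarrow> (nat \<Rightarrow> 'w) measure"
  where "past_filtration N F i t =
    Pi\<^sub>M UNIV (\<lambda>j. if j < i then F \<infinity> else if j = i then F t else sigma (space N) {})"

text \<open>
  \<open>Q\<close> is a measure associated with the initial state \<open>x\<close> and the strategy \<open>V\<close>: from its starting time
  on, each coordinate is, given the past, a Markov process with the uncontrolled
  transition probabilities, started in the prescribed state. Its behaviour before the starting time
  is left open.
\<close>

definition controlled_measure ::
  "'w measure \<Rightarrow> (ennreal \<Rightarrow> 'w measure) \<Rightarrow> (real \<Rightarrow> 'w \<Rightarrow> 'e::topological_space) \<Rightarrow>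
    ('e \<Rightarrow> 'w measure) \<Rightarrow> 'e \<Rightarrow> ('w, 'e) strategy \<Rightarrow> (nat \<Rightarrow> 'w) measure \<Rightarrow> bool"
  where "controlled_measure N F X P x V Q \<longleftrightarrow>
    prob_space Q \<and> sets Q = sets (copies N) \<and>
    (\<forall>i. (AE \<omega> in Q. start_time V i \<omega> < \<infinity> \<longrightarrow>
            X (enn2real (start_time V i \<omega>)) (\<omega> i) = start_state x V i \<omega>) \<and>
         (\<forall>t\<ge>0. \<forall>r\<ge>0. \<forall>B\<in>sets borel.
            \<forall>A\<in>sets (filtration.pre_sigma (space (copies N)) (past_filtration N F i)
                      (\<lambda>\<omega>. start_time V i \<omega> + ennreal t)).
            measure Q {\<omega> \<in> A. start_time V i \<omega> < \<infinity> \<and>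
                              X (enn2real (start_time V i \<omega>) + t + r) (\<omega> i) \<in> B}
            = (\<integral>\<omega>. indicator {\<omega> \<in> A. start_time V i \<omega> < \<infinity>} \<omega> *
                  trans_prob P X r (X (enn2real (start_time V i \<omega>) + t) (\<omega> i)) B \<partial>Q)))"


section \<open>Controlled process and functionals\<close>

text \<open>
  If the impulse times accumulate at or before \<open>t\<close>, no coordinate is in use at time \<open>t\<close> and the value
  is a dummy; if this has positive probability the expected impulse costs are infinite anyway.
\<close>

definition controlled_process ::
  "(real \<Rightarrow> 'w \<Rightarrow> 'e) \<Rightarrow> ('w, 'e) strategy \<Rightarrow> (nat \<Rightarrow> 'w) \<Rightarrow> real \<Rightarrow> 'e"
  where "controlled_process X V \<omega> t =
    (if \<exists>i. start_time V i \<omega> \<le> ennreal t \<and> ennreal t < imp_time V i \<omega>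
     then X t (\<omega> (THE i. start_time V i \<omega> \<le> ennreal t \<and> ennreal t < imp_time V i \<omega>))
     else X t (\<omega> 0))"

definition cost_upto ::
  "(real \<Rightarrow> 'w \<Rightarrow> 'e) \<Rightarrow> ('e \<Rightarrow> real) \<Rightarrow> ('e \<Rightarrow> 'e \<Rightarrow> real) \<Rightarrow> (real \<Rightarrow> real) \<Rightarrow>
    ('w, 'e) strategy \<Rightarrow> real \<Rightarrow> (nat \<Rightarrow> 'w) \<Rightarrow> ereal"
  where "cost_upto X g c \<beta> V T \<omega> =
    ereal (LINT s:{0..T}|lborel. \<beta> s * g (controlled_process X V \<omega> s)) +
    (\<Sum>i. if imp_time V i \<omega> \<le> ennreal T
         then ereal (\<beta> (enn2real (imp_time V i \<omega>)) *
                c (X (enn2real (imp_time V i \<omega>)) (\<omega> i)) (X (enn2real (imp_time V i \<omega>)) (\<omega> (Suc i))))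
         else 0)"

text \<open>The costs are bounded below but may be infinite, so the expectation is an extended real.\<close>

definition ext_expectation :: "'a measure \<Rightarrow> ('a \<Rightarrow> ereal) \<Rightarrow> ereal"
  where "ext_expectation Q f =
    enn2ereal (\<integral>\<^sup>+ \<omega>. e2ennreal (f \<omega>) \<partial>Q) - enn2ereal (\<integral>\<^sup>+ \<omega>. e2ennreal (- f \<omega>) \<partial>Q)"

definition discounted_functional ::
  "(real \<Rightarrow> 'w \<Rightarrow> 'e) \<Rightarrow> ('e \<Rightarrow> real) \<Rightarrow> ('e \<Rightarrow> 'e \<Rightarrow> real) \<Rightarrow> (real \<Rightarrow> real) \<Rightarrow>
    (nat \<Rightarrow> 'w) measure \<Rightarrow> ('w, 'e) strategy \<Rightarrow> ereal"
  where "discounted_functional X g c \<beta> Q V =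
    Limsup at_top (\<lambda>T. ext_expectation Q (cost_upto X g c \<beta> V T) / ereal (LINT s:{0..T}|lborel. \<beta> s))"

definition average_functional ::
  "(real \<Rightarrow> 'w \<Rightarrow> 'e) \<Rightarrow> ('e \<Rightarrow> real) \<Rightarrow> ('e \<Rightarrow> 'e \<Rightarrow> real) \<Rightarrow>
    (nat \<Rightarrow> 'w) measure \<Rightarrow> ('w, 'e) strategy \<Rightarrow> ereal"
  where "average_functional X g c Q V =
    Limsup at_top (\<lambda>T. ext_expectation Q (cost_upto X g c (\<lambda>_. 1) V T) / ereal T)"


section \<open>The discrete-time equation and its strategy\<close>

definition impulse_operator ::
  "('e \<Rightarrow> 'e \<Rightarrow> real) \<Rightarrow> real \<Rightarrow> ('e \<Rightarrow> real) \<Rightarrow> 'e \<Rightarrow> real"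
  where "impulse_operator c h w x = (INF \<xi>. c x \<xi> / h + w \<xi>)"

definition bellman_solution ::
  "(real \<Rightarrow> 'w \<Rightarrow> 'e::topological_space) \<Rightarrow> ('e \<Rightarrow> 'w measure) \<Rightarrow> ('e \<Rightarrow> real) \<Rightarrow> ('e \<Rightarrow> 'e \<Rightarrow> real) \<Rightarrow>
    real \<Rightarrow> ('e \<Rightarrow> real) \<Rightarrow> real \<Rightarrow> bool"
  where "bellman_solution X P g c h w l \<longleftrightarrow> w \<in> bcontfun \<and>
    (\<forall>x. w x = min (g x - l + (\<integral>\<omega>. w (X h \<omega>) \<partial>P x)) (impulse_operator c h w x))"

definition first_grid_hit ::
  "(real \<Rightarrow> 'w \<Rightarrow> 'e) \<Rightarrow> ('e \<Rightarrow> 'e \<Rightarrow> real) \<Rightarrow> real \<Rightarrow> ('e \<Rightarrow> real) \<Rightarrow> ennreal \<Rightarrow> 'w \<Rightarrow> ennreal"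
  where "first_grid_hit X c h w s \<omega> =
    (INF n\<in>{n::nat. s \<le> ennreal (real n * h) \<and>
                    w (X (real n * h) \<omega>) = impulse_operator c h w (X (real n * h) \<omega>)}.
       ennreal (real n * h))"

primrec hat_time ::
  "(real \<Rightarrow> 'w \<Rightarrow> 'e) \<Rightarrow> ('e \<Rightarrow> 'e \<Rightarrow> real) \<Rightarrow> real \<Rightarrow> ('e \<Rightarrow> real) \<Rightarrow> nat \<Rightarrow> (nat \<Rightarrow> 'w) \<Rightarrow> ennreal"
  where
    "hat_time X c h w 0 \<omega> = first_grid_hit X c h w 0 (\<omega> 0)"
  | "hat_time X c h w (Suc i) \<omega> = first_grid_hit X c h w (hat_time X c h w i \<omega>) (\<omega> (Suc i))"

text \<open>\<open>sel\<close> selects a minimiser and \<open>\<xi>\<^sub>0\<close> is the arbitrary state used when there is no impulse.\<close>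

definition measurable_minimiser ::
  "('e::topological_space \<Rightarrow> 'e \<Rightarrow> real) \<Rightarrow> real \<Rightarrow> ('e \<Rightarrow> real) \<Rightarrow> ('e \<Rightarrow> 'e) \<Rightarrow> bool"
  where "measurable_minimiser c h w sel \<longleftrightarrow> sel \<in> borel \<rightarrow>\<^sub>M borel \<and>
    (\<forall>x. is_arg_min (\<lambda>\<xi>. c x \<xi> / h + w \<xi>) (\<lambda>_. True) (sel x))"

definition hat_strategy ::
  "(real \<Rightarrow> 'w \<Rightarrow> 'e) \<Rightarrow> ('e \<Rightarrow> 'e \<Rightarrow> real) \<Rightarrow> real \<Rightarrow> ('e \<Rightarrow> real) \<Rightarrow> ('e \<Rightarrow> 'e) \<Rightarrow> 'e \<Rightarrow>
    ('w, 'e) strategy"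
  where "hat_strategy X c h w sel \<xi>\<^sub>0 i =
    (hat_time X c h w i,
     \<lambda>\<omega>. if hat_time X c h w i \<omega> < \<infinity> then sel (X (enn2real (hat_time X c h w i \<omega>)) (\<omega> i)) else \<xi>\<^sub>0)"

end

(*
  Put u = h w_h and let P_t be the transition semigroup. The equation for w_h says that
  u <= h (g - lambda_h) + P_h u and u(x) <= c(x, xi) + u(xi), with equality in the first inequality
  between the impulses of the strategy and in the second one at its impulses. Summing along the grid,
  the strategy costs at most lambda_h per unit of time, up to the error of replacing P_r g by g for
  r <= h and up to a bounded term. Conversely, the average v of P_0 u, P_e u, ..., P_{h-e} u with
  e = h/M satisfies v <= e (g - lambda_h) + P_e v exactly, and v(x) <= c(x, xi) + eta + v(xi), where
  eta is small for small h since x and xi may be moved to their positions a short time later. Hence,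
  as M tends to infinity, every strategy in continuous time costs at least lambda_h per unit of time,
  up to small errors; the term eta per impulse is absorbed by the impulse cost, which is at least c_0.
  Both errors are uniform because a Feller semigroup on a compact space is strongly continuous.

  Discounting enters only through a decreasing weight with values in [0,1] and bounded support, beta
  or 1 on [0,T], for which summation by parts adds a bounded term. The two functionals are therefore
  treated at once, by dividing by the total mass of the weight.
*)

theory Submission
  imports Defs
begin

text \<open>No bound and no modulus of continuity of \<open>w h\<close> that is uniform in h is
  available to the argument. So h is fixed from g and c alone. The bound of u, which depends on h,
  enters only through additive terms that vanish after division by the growing mass of the weight.
  The one uniform bound needed is \<open>l h\<close> \<le> sup g, because absorbing eta per impulse
  multiplies the whole cost by 1 + eta / c_0.

  The impulse times of a general strategy lie on no common grid. Each coordinate therefore gets its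
  own skeleton, begun at its own starting time, where the Markov property is available; an impulse
  is postponed to the next skeleton point, and right continuity of the paths removes the delay as e
  tends to 0. The discretisation error is G e per coordinate, so e tends to 0 for a fixed number of
  coordinates, and only then does this number grow.

  Strong continuity is not a hypothesis: right-continuous paths give only pointwise convergence of
  P_t f as t decreases to 0. It becomes uniform by Dini's argument for supermedian functions, which
  include the resolvents, and by Stone-Weierstrass for their differences.\<close>

section \<open>Functions on a compact space, and joint measurability of paths\<close>

lemma bcontfun_compact_iff:
  fixes f :: "'a::topological_space \<Rightarrow> real"
  assumes "compact (UNIV :: 'a set)"
  shows "f \<in> bcontfun \<longleftrightarrow> continuous_on UNIV f"
proof
  assume f: "continuous_on UNIV f"
  then have "compact (range f)"
    using assms by (rule compact_continuous_image)
  then show "f \<in> bcontfun"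
    using f compact_imp_bounded by (auto simp: bcontfun_def)
qed (auto simp: bcontfun_def)

lemma bcontfun_bound:
  fixes f :: "'a::topological_space \<Rightarrow> real"
  assumes "f \<in> bcontfun"
  obtains B where "0 \<le> B" "\<And>x. \<bar>f x\<bar> \<le> B"
proof -
  from assms obtain B where "\<And>y. y \<in> range f \<Longrightarrow> norm y \<le> B"
    unfolding bcontfun_def bounded_iff by auto
  then have "\<And>x. \<bar>f x\<bar> \<le> max 0 B"
    by (metis max.coboundedI2 rangeI real_norm_def)
  then show ?thesis
    using that[of "max 0 B"] by simp
qed

lemma bcontfun_borel:
  fixes f :: "'a::topological_space \<Rightarrow> real"
  shows "f \<in> bcontfun \<Longrightarrow> f \<in> borel_measurable borel"
  by (auto simp: bcontfun_def intro: borel_measurable_continuous_onI)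

text \<open>A right-continuous path is the limit of its values at the next strictly later point of
  the grid with mesh 1 / (n + 1), and only countably many times occur in each approximation. The
  \<open>max 0\<close> extends the map to the whole real line, since nothing is known about X at
  negative times.\<close>

lemma measurable_right_continuous:
  fixes X :: "real \<Rightarrow> 'w \<Rightarrow> 'a::metric_space"
  assumes measurable_X: "\<And>t. 0 \<le> t \<Longrightarrow> X t \<in> N \<rightarrow>\<^sub>M borel"
    and right_continuous_paths: "\<And>w t. w \<in> space N \<Longrightarrow> 0 \<le> t \<Longrightarrow> ((\<lambda>u. X u w) \<longlongrightarrow> X t w) (at_right t)"
  shows "(\<lambda>(s, w). X (max 0 s) w) \<in> borel \<Otimes>\<^sub>M N \<rightarrow>\<^sub>M borel"
proof -
  define Y where "Y n = (\<lambda>(s, w). X (real_of_int (\<lfloor>max 0 s * real (Suc n)\<rfloor> + 1) / real (Suc n)) w)" for n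
  have nn: "0 \<le> real_of_int (\<lfloor>max 0 s * real (Suc n)\<rfloor> + 1) / real (Suc n)" for s :: real and n
    by (intro divide_nonneg_nonneg) (auto simp: add_nonneg_nonneg)
  show ?thesis
  proof (rule borel_measurable_LIMSEQ_metric)
    fix n
    \<comment> \<open>The countable index k runs through all integers; \<open>max 0 k\<close> keeps
      the time nonnegative and disappears once the floor, which is nonnegative, is inserted.\<close>
    have "(\<lambda>z. (\<lambda>k z. X (real_of_int (max 0 k + 1) / real (Suc n)) (snd z)) \<lfloor>max 0 (fst z) * real (Suc n)\<rfloor> z)
            \<in> borel \<Otimes>\<^sub>M N \<rightarrow>\<^sub>M borel"
    proof (rule measurable_compose_countable[where f = "\<lambda>k z. X (real_of_int (max 0 k + 1) / real (Suc n)) (snd z)"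
          and g = "\<lambda>z. \<lfloor>max 0 (fst z) * real (Suc n)\<rfloor>"])
      fix k :: int
      show "(\<lambda>z. X (real_of_int (max 0 k + 1) / real (Suc n)) (snd z)) \<in> borel \<Otimes>\<^sub>M N \<rightarrow>\<^sub>M borel"
        by (rule measurable_compose[OF measurable_snd measurable_X]) simp
    qed measurable
    then show "Y n \<in> borel \<Otimes>\<^sub>M N \<rightarrow>\<^sub>M borel"
      unfolding Y_def by (simp add: case_prod_beta' max_def cong: if_cong)
  next
    fix z :: "real \<times> 'w" assume z: "z \<in> space (borel \<Otimes>\<^sub>M N)"
    obtain s w where zz: "z = (s, w)" by force
    then have w: "w \<in> space N" using z by (auto simp: space_pair_measure)
    let ?s = "max 0 s"
    let ?t = "\<lambda>n. real_of_int (\<lfloor>?s * real (Suc n)\<rfloor> + 1) / real (Suc n)"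
    have gt: "?s < ?t n" for n
    proof -
      have "?s * real (Suc n) < real_of_int (\<lfloor>?s * real (Suc n)\<rfloor> + 1)" by linarith
      then show ?thesis by (rule mult_imp_less_div_pos[rotated]) simp
    qed
    have le: "?t n \<le> ?s + inverse (real (Suc n))" for n
    proof -
      have "real_of_int (\<lfloor>?s * real (Suc n)\<rfloor> + 1) \<le> ?s * real (Suc n) + 1" by linarith
      then have "?t n \<le> (?s * real (Suc n) + 1) / real (Suc n)"
        by (rule divide_right_mono) simp
      then show ?thesis by (simp add: add_divide_distrib inverse_eq_divide del: of_nat_Suc)
    qed
    have "?t \<longlonglongrightarrow> ?s"
    proof (rule tendsto_sandwich)
      show "(\<lambda>n. ?s) \<longlonglongrightarrow> ?s" by simp
      show "(\<lambda>n. ?s + inverse (real (Suc n))) \<longlonglongrightarrow> ?s"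
        using tendsto_add[OF tendsto_const LIMSEQ_inverse_real_of_nat, of ?s] by simp
    qed (use gt le less_imp_le in \<open>auto intro!: always_eventually\<close>)
    then have "filterlim ?t (at_right ?s) sequentially"
      using gt by (intro filterlim_at_withinI) auto
    from filterlim_compose[OF right_continuous_paths[OF w, of ?s] this]
    show "(\<lambda>n. Y n z) \<longlonglongrightarrow> (case z of (s, w) \<Rightarrow> X (max 0 s) w)"
      by (simp add: Y_def zz)
  qed
qed

section \<open>The transition semigroup\<close>

locale feller_process = standard_markov_process N F X P
  for N :: "'w measure" and F :: "ennreal \<Rightarrow> 'w measure"
    and X :: "real \<Rightarrow> 'w \<Rightarrow> 'e::polish_space" and P :: "'e \<Rightarrow> 'w measure" +
  assumes feller: "f \<in> bcontfun \<Longrightarrow> t > 0 \<Longrightarrow> (\<lambda>x. \<integral>\<omega>. (f (X t \<omega>) :: real) \<partial>P x) \<in> bcontfun"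
begin

definition trans_op :: "real \<Rightarrow> ('e \<Rightarrow> real) \<Rightarrow> 'e \<Rightarrow> real"
  where "trans_op t f x = (\<integral>\<omega>. f (X t \<omega>) \<partial>P x)"

lemma continuous_iff: "f \<in> bcontfun \<longleftrightarrow> continuous_on UNIV f" for f :: "'e \<Rightarrow> real"
  by (rule bcontfun_compact_iff[OF compact_state_space])

lemma measurable_X: "0 \<le> t \<Longrightarrow> X t \<in> N \<rightarrow>\<^sub>M borel"
  using adapted[of t] sets_F_subset[of "ennreal t"] space_F[of "ennreal t"]
  by (auto simp: measurable_def)

lemma measurable_X_P: "0 \<le> t \<Longrightarrow> X t \<in> P x \<rightarrow>\<^sub>M borel"
  using measurable_X[of t] measurable_cong_sets[OF sets_P[of x] refl] by blast

lemma space_P: "space (P x) = space N"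
  by (rule sets_eq_imp_space_eq[OF sets_P])

lemma measurable_X_joint: "(\<lambda>(s, w). X (max 0 s) w) \<in> borel \<Otimes>\<^sub>M N \<rightarrow>\<^sub>M borel"
  by (intro measurable_right_continuous measurable_X right_continuous_paths)

lemma measurable_X_random:
  assumes "\<sigma> \<in> M \<rightarrow>\<^sub>M borel" "f \<in> M \<rightarrow>\<^sub>M N" "\<And>z. z \<in> space M \<Longrightarrow> 0 \<le> \<sigma> z"
  shows "(\<lambda>z. X (\<sigma> z) (f z)) \<in> M \<rightarrow>\<^sub>M borel"
proof -
  have "(\<lambda>z. (\<lambda>(s, w). X (max 0 s) w) (\<sigma> z, f z)) \<in> M \<rightarrow>\<^sub>M borel"
    by (rule measurable_compose[OF measurable_Pair[OF assms(1,2)] measurable_X_joint])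
  then show ?thesis
    by (rule measurable_cong[THEN iffD1, rotated]) (use assms(3) in \<open>simp add: max_def\<close>)
qed

lemma integrable_X:
  assumes "f \<in> bcontfun" "0 \<le> t"
  shows "integrable (P x) (\<lambda>\<omega>. f (X t \<omega>) :: real)"
proof -
  interpret prob_space "P x" by (rule prob_space_P)
  obtain B where "\<And>x. \<bar>f x\<bar> \<le> B" using bcontfun_bound[OF assms(1)] by blast
  then show ?thesis
    by (intro integrable_const_bound[of _ B] measurable_compose[OF measurable_X_P[OF assms(2)]]
        bcontfun_borel[OF assms(1)]) auto
qed

lemma trans_op_0: "f \<in> bcontfun \<Longrightarrow> trans_op 0 f = f"
proof
  fix x assume f: "f \<in> bcontfun"
  interpret prob_space "P x" by (rule prob_space_P)
  have "trans_op 0 f x = (\<integral>\<omega>. f x \<partial>P x)"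
    unfolding trans_op_def
    by (rule integral_cong_AE)
       (use normal[of x] measurable_compose[OF measurable_X_P[of 0] bcontfun_borel[OF f]] in auto)
  then show "trans_op 0 f x = f x"
    by (simp add: prob_space)
qed

lemma trans_op_bcontfun: "f \<in> bcontfun \<Longrightarrow> 0 \<le> t \<Longrightarrow> trans_op t f \<in> bcontfun"
  using feller[of f t] trans_op_0[of f] by (cases "t = 0") (auto simp: trans_op_def[abs_def])

lemma trans_op_const: "trans_op t (\<lambda>_. a) x = a"
proof -
  interpret prob_space "P x" by (rule prob_space_P)
  show ?thesis by (simp add: trans_op_def prob_space)
qed

lemma trans_op_mono:
  "f \<in> bcontfun \<Longrightarrow> g \<in> bcontfun \<Longrightarrow> 0 \<le> t \<Longrightarrow> (\<And>x. f x \<le> g x) \<Longrightarrow> trans_op t f x \<le> trans_op t g x"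
  unfolding trans_op_def by (intro integral_mono integrable_X) auto

lemma trans_op_add:
  "f \<in> bcontfun \<Longrightarrow> g \<in> bcontfun \<Longrightarrow> 0 \<le> t \<Longrightarrow>
    trans_op t (\<lambda>x. f x + g x) x = trans_op t f x + trans_op t g x"
  unfolding trans_op_def by (intro Bochner_Integration.integral_add integrable_X)

lemma trans_op_cmult: "trans_op t (\<lambda>x. a * f x) x = a * trans_op t f x"
  unfolding trans_op_def by simp

lemma trans_op_diff:
  "f \<in> bcontfun \<Longrightarrow> g \<in> bcontfun \<Longrightarrow> 0 \<le> t \<Longrightarrow>
    trans_op t (\<lambda>x. f x - g x) x = trans_op t f x - trans_op t g x"
  unfolding trans_op_def by (intro Bochner_Integration.integral_diff integrable_X)

lemma const_in_bcontfun: "(\<lambda>_ :: 'e. a :: real) \<in> bcontfun"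
  by (simp add: continuous_iff)

lemma trans_op_bounds:
  "f \<in> bcontfun \<Longrightarrow> 0 \<le> t \<Longrightarrow> (\<And>x. a \<le> f x) \<Longrightarrow> a \<le> trans_op t f x"
  "f \<in> bcontfun \<Longrightarrow> 0 \<le> t \<Longrightarrow> (\<And>x. f x \<le> b) \<Longrightarrow> trans_op t f x \<le> b"
  using trans_op_mono[OF const_in_bcontfun _ , of f t a x] trans_op_mono[OF _ const_in_bcontfun, of f t b x]
  by (auto simp: trans_op_const)

lemma trans_op_abs_le:
  "f \<in> bcontfun \<Longrightarrow> 0 \<le> t \<Longrightarrow> (\<And>x. \<bar>f x\<bar> \<le> B) \<Longrightarrow> \<bar>trans_op t f x\<bar> \<le> B"
  using trans_op_bounds[of f t "-B" x] trans_op_bounds(2)[of f t B x]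
  by (simp add: abs_le_iff minus_le_iff)

section \<open>The Markov property for functions instead of events\<close>

definition kernel :: "real \<Rightarrow> 'e \<Rightarrow> 'e measure"
  where "kernel t x = distr (P x) borel (X t)"

lemma sets_kernel [simp]: "sets (kernel t x) = sets borel"
  by (simp add: kernel_def)

lemma prob_space_kernel: "0 \<le> t \<Longrightarrow> prob_space (kernel t x)"
  unfolding kernel_def using prob_space.prob_space_distr[OF prob_space_P measurable_X_P] .

lemma emeasure_kernel:
  assumes "0 \<le> t" "B \<in> sets borel"
  shows "emeasure (kernel t x) B = ennreal (trans_prob P X t x B)"
proof -
  interpret prob_space "P x" by (rule prob_space_P)
  have "emeasure (kernel t x) B = emeasure (P x) (X t -` B \<inter> space (P x))"
    using assms by (simp add: kernel_def emeasure_distr[OF measurable_X_P])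
  also have "X t -` B \<inter> space (P x) = {w \<in> space (P x). X t w \<in> B}" by auto
  finally show ?thesis
    by (simp add: trans_prob_def emeasure_eq_measure)
qed

lemma measurable_kernel: "0 \<le> t \<Longrightarrow> kernel t \<in> borel \<rightarrow>\<^sub>M subprob_algebra borel"
proof (rule measurable_subprob_algebra)
  fix A :: "'e set" assume t: "0 \<le> t" and "A \<in> sets borel"
  then show "(\<lambda>a. emeasure (kernel t a) A) \<in> borel_measurable borel"
    using trans_prob_measurable[of t A] by (simp add: emeasure_kernel)
qed (auto intro: prob_space_imp_subprob_space prob_space_kernel)

lemma trans_op_kernel: "f \<in> bcontfun \<Longrightarrow> 0 \<le> t \<Longrightarrow> trans_op t f x = (\<integral>y. f y \<partial>kernel t x)"
  unfolding trans_op_def kernel_def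
  by (simp add: integral_distr[OF measurable_X_P bcontfun_borel])

lemma nn_trans_op_kernel:
  assumes f: "f \<in> bcontfun" "\<And>x. 0 \<le> f x" and t: "0 \<le> t"
  shows "(\<integral>\<^sup>+y. ennreal (f y) \<partial>kernel t x) = ennreal (trans_op t f x)"
proof -
  have "integrable (kernel t x) f"
    unfolding kernel_def using integrable_X[OF f(1) t]
    by (simp add: integrable_distr_eq[OF measurable_X_P[OF t] bcontfun_borel[OF f(1)]])
  then show ?thesis
    using f by (subst nn_integral_eq_integral) (auto simp: trans_op_kernel[OF f(1) t])
qed

lemma measurable_nn_kernel:
  "0 \<le> t \<Longrightarrow> f \<in> borel_measurable borel \<Longrightarrow> (\<lambda>x. \<integral>\<^sup>+y. f y \<partial>kernel t x) \<in> borel_measurable borel"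
  by (rule nn_integral_measurable_subprob_algebra2[where N=borel])
     (auto intro: measurable_kernel measurable_compose[OF measurable_snd])

text \<open>\<open>G\<close> is the past at the earlier of two times, \<open>Z\<close> a weight known then.\<close>

lemma markov_nn_integral:
  assumes M: "prob_space M" and G: "sets G \<subseteq> sets M" "space G = space M"
    and \<xi>: "\<xi> \<in> M \<rightarrow>\<^sub>M borel" and \<xi>': "\<xi>' \<in> M \<rightarrow>\<^sub>M borel" and r: "0 \<le> r"
    and ev: "\<And>A B. A \<in> sets G \<Longrightarrow> B \<in> sets borel \<Longrightarrow>
      measure M {\<omega> \<in> A. \<omega> \<in> D \<and> \<xi>' \<omega> \<in> B}
      = (\<integral>\<omega>. indicator {\<omega> \<in> A. \<omega> \<in> D} \<omega> * trans_prob P X r (\<xi> \<omega>) B \<partial>M)"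
    and D: "D \<in> sets M"
    and Z: "Z \<in> borel_measurable G" and f: "f \<in> borel_measurable borel"
  shows "(\<integral>\<^sup>+\<omega>. Z \<omega> * (indicator D \<omega> * f (\<xi>' \<omega>)) \<partial>M)
    = (\<integral>\<^sup>+\<omega>. Z \<omega> * (indicator D \<omega> * (\<integral>\<^sup>+y. f y \<partial>kernel r (\<xi> \<omega>))) \<partial>M)"
proof -
  interpret prob_space M by fact
  note [measurable] = \<xi> \<xi>' D
  have GM: "g \<in> borel_measurable M" if "g \<in> borel_measurable G" for g :: "_ \<Rightarrow> ennreal"
    using that G by (auto simp: measurable_def)
  have [measurable]: "(\<lambda>\<omega>. \<integral>\<^sup>+y. f y \<partial>kernel r (\<xi> \<omega>)) \<in> borel_measurable M"
    if "f \<in> borel_measurable borel" for f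
    by (rule measurable_compose[OF \<xi> measurable_nn_kernel[OF r that]])
  have tpm[measurable]: "(\<lambda>\<omega>. trans_prob P X r (\<xi> \<omega>) B) \<in> borel_measurable M" if "B \<in> sets borel" for B
    by (rule measurable_compose[OF \<xi> trans_prob_measurable[OF r that]])
  have tp1: "trans_prob P X r x B \<le> 1" "0 \<le> trans_prob P X r x B" for x B
    using prob_space.prob_le_1[OF prob_space_P] by (auto simp: trans_prob_def)
  \<comment> \<open>Two inductions over measurable functions: here on f, with Z the indicator of an
    event of G; afterwards on Z, with f fixed.\<close>
  have 1: "(\<integral>\<^sup>+\<omega>. indicator A \<omega> * (indicator D \<omega> * f (\<xi>' \<omega>)) \<partial>M)
    = (\<integral>\<^sup>+\<omega>. indicator A \<omega> * (indicator D \<omega> * (\<integral>\<^sup>+y. f y \<partial>kernel r (\<xi> \<omega>))) \<partial>M)"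
    if A: "A \<in> sets G" and "f \<in> borel_measurable borel" for A f
    using that(2)
  proof (induction f rule: borel_measurable_induct)
    case (cong f g)
    then have "f = g" by (auto simp: fun_eq_iff)
    then show ?case using cong by simp
  next
    case (set B)
    have AM[measurable]: "A \<in> sets M" using A G by auto
    have "(\<integral>\<^sup>+\<omega>. indicator A \<omega> * (indicator D \<omega> * indicator B (\<xi>' \<omega>)) \<partial>M)
        = (\<integral>\<^sup>+\<omega>. indicator {\<omega> \<in> A. \<omega> \<in> D \<and> \<xi>' \<omega> \<in> B} \<omega> \<partial>M)"
      by (intro nn_integral_cong) (auto simp: indicator_def)
    also have "\<dots> = emeasure M {\<omega> \<in> A. \<omega> \<in> D \<and> \<xi>' \<omega> \<in> B}"
    proof (rule nn_integral_indicator)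
      have "{\<omega> \<in> A. \<omega> \<in> D \<and> \<xi>' \<omega> \<in> B} = A \<inter> D \<inter> (\<xi>' -` B \<inter> space M)"
        using sets.sets_into_space[OF AM] by auto
      also have "\<dots> \<in> sets M" using set by measurable
      finally show "{\<omega> \<in> A. \<omega> \<in> D \<and> \<xi>' \<omega> \<in> B} \<in> sets M" .
    qed
    also have "\<dots> = ennreal (\<integral>\<omega>. indicator {\<omega> \<in> A. \<omega> \<in> D} \<omega> * trans_prob P X r (\<xi> \<omega>) B \<partial>M)"
      using ev[OF A, of B] set by (simp add: emeasure_eq_measure)
    also have "\<dots> = (\<integral>\<^sup>+\<omega>. ennreal (indicator {\<omega> \<in> A. \<omega> \<in> D} \<omega> * trans_prob P X r (\<xi> \<omega>) B) \<partial>M)"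
    proof (rule nn_integral_eq_integral[symmetric])
      have "{\<omega> \<in> A. \<omega> \<in> D} \<in> sets M"
        using AM D by (simp add: Int_def[symmetric])
      then show "integrable M (\<lambda>\<omega>. indicator {\<omega> \<in> A. \<omega> \<in> D} \<omega> * trans_prob P X r (\<xi> \<omega>) B)"
        using set tp1 by (intro integrable_const_bound[of _ 1]) (auto simp: indicator_def)
    qed (use tp1 in \<open>auto simp: indicator_def\<close>)
    also have "\<dots> = (\<integral>\<^sup>+\<omega>. indicator A \<omega> * (indicator D \<omega> * (\<integral>\<^sup>+y. indicator B y \<partial>kernel r (\<xi> \<omega>))) \<partial>M)"
    proof (intro nn_integral_cong)
      fix \<omega>
      have "(\<integral>\<^sup>+y. indicator B y \<partial>kernel r (\<xi> \<omega>)) = ennreal (trans_prob P X r (\<xi> \<omega>) B)"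
        using set r by (simp add: emeasure_kernel)
      then show "ennreal (indicator {\<omega> \<in> A. \<omega> \<in> D} \<omega> * trans_prob P X r (\<xi> \<omega>) B)
          = indicator A \<omega> * (indicator D \<omega> * (\<integral>\<^sup>+y. indicator B y \<partial>kernel r (\<xi> \<omega>)))"
        by (simp split: split_indicator)
    qed
    finally show ?case .
  next
    case (mult u c)
    have [measurable]: "A \<in> sets M" "u \<in> borel_measurable borel" using A G mult by auto
    have "(\<integral>\<^sup>+\<omega>. indicator A \<omega> * (indicator D \<omega> * (c * u (\<xi>' \<omega>))) \<partial>M)
      = (\<integral>\<^sup>+\<omega>. c * (indicator A \<omega> * (indicator D \<omega> * u (\<xi>' \<omega>))) \<partial>M)"
      by (intro nn_integral_cong) (simp add: ac_simps)
    also have "\<dots> = c * (\<integral>\<^sup>+\<omega>. indicator A \<omega> * (indicator D \<omega> * (\<integral>\<^sup>+y. u y \<partial>kernel r (\<xi> \<omega>))) \<partial>M)"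
      by (subst nn_integral_cmult) (auto simp: mult)
    also have "\<dots> = (\<integral>\<^sup>+\<omega>. c * (indicator A \<omega> * (indicator D \<omega> * (\<integral>\<^sup>+y. u y \<partial>kernel r (\<xi> \<omega>)))) \<partial>M)"
      by (subst nn_integral_cmult) auto
    also have "\<dots> = (\<integral>\<^sup>+\<omega>. indicator A \<omega> * (indicator D \<omega> * (\<integral>\<^sup>+y. c * u y \<partial>kernel r (\<xi> \<omega>))) \<partial>M)"
      using mult by (intro nn_integral_cong) (subst nn_integral_cmult; simp add: ac_simps measurable_cong_sets[OF sets_kernel refl])
    finally show ?case .
  next
    case (add u v)
    have [measurable]: "A \<in> sets M" "u \<in> borel_measurable borel" "v \<in> borel_measurable borel"
      using A G add by auto
    have "(\<integral>\<^sup>+\<omega>. indicator A \<omega> * (indicator D \<omega> * (v (\<xi>' \<omega>) + u (\<xi>' \<omega>))) \<partial>M)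
      = (\<integral>\<^sup>+\<omega>. indicator A \<omega> * (indicator D \<omega> * v (\<xi>' \<omega>)) + indicator A \<omega> * (indicator D \<omega> * u (\<xi>' \<omega>)) \<partial>M)"
      by (intro nn_integral_cong) (simp add: distrib_left)
    also have "\<dots> = (\<integral>\<^sup>+\<omega>. indicator A \<omega> * (indicator D \<omega> * (\<integral>\<^sup>+y. v y \<partial>kernel r (\<xi> \<omega>)))
        + indicator A \<omega> * (indicator D \<omega> * (\<integral>\<^sup>+y. u y \<partial>kernel r (\<xi> \<omega>))) \<partial>M)"
      by (subst (1 2) nn_integral_add) (auto simp: add)
    also have "\<dots> = (\<integral>\<^sup>+\<omega>. indicator A \<omega> * (indicator D \<omega> * (\<integral>\<^sup>+y. v y + u y \<partial>kernel r (\<xi> \<omega>))) \<partial>M)"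
      using add by (intro nn_integral_cong) (subst nn_integral_add; simp add: distrib_left measurable_cong_sets[OF sets_kernel refl])
    finally show ?case .
  next
    case (seq U)
    have [measurable]: "A \<in> sets M" "\<And>i. U i \<in> borel_measurable borel"
      using A G seq by auto
    have U: "(\<lambda>i. U i y) \<longlonglongrightarrow> (SUP i. U i) y" for y
      using seq(3) by (auto simp: incseq_def le_fun_def image_comp intro!: LIMSEQ_SUP monoI)
    have mono: "incseq (\<lambda>i. indicator A \<omega> * (indicator D \<omega> * U i z))" for \<omega> z
      using seq(3) by (auto simp: incseq_def le_fun_def indicator_def)
    have "(\<integral>\<^sup>+\<omega>. indicator A \<omega> * (indicator D \<omega> * (SUP i. U i) (\<xi>' \<omega>)) \<partial>M)
        = (\<integral>\<^sup>+\<omega>. (SUP i. indicator A \<omega> * (indicator D \<omega> * U i (\<xi>' \<omega>))) \<partial>M)"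
      by (intro nn_integral_cong) (auto simp: indicator_def image_comp)
    also have "\<dots> = (SUP i. \<integral>\<^sup>+\<omega>. indicator A \<omega> * (indicator D \<omega> * U i (\<xi>' \<omega>)) \<partial>M)"
      using seq(3) by (intro nn_integral_monotone_convergence_SUP)
        (auto simp: incseq_def le_fun_def indicator_def)
    also have "\<dots> = (SUP i. \<integral>\<^sup>+\<omega>. indicator A \<omega> * (indicator D \<omega> * (\<integral>\<^sup>+y. U i y \<partial>kernel r (\<xi> \<omega>))) \<partial>M)"
      using seq by simp
    also have "\<dots> = (\<integral>\<^sup>+\<omega>. (SUP i. indicator A \<omega> * (indicator D \<omega> * (\<integral>\<^sup>+y. U i y \<partial>kernel r (\<xi> \<omega>)))) \<partial>M)"
      using seq(3) by (intro nn_integral_monotone_convergence_SUP[symmetric])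
        (auto simp: incseq_def le_fun_def indicator_def intro!: nn_integral_mono)
    also have "\<dots> = (\<integral>\<^sup>+\<omega>. indicator A \<omega> * (indicator D \<omega> * (\<integral>\<^sup>+y. (SUP i. U i) y \<partial>kernel r (\<xi> \<omega>))) \<partial>M)"
    proof (intro nn_integral_cong)
      fix \<omega>
      have "(\<integral>\<^sup>+y. (SUP i. U i) y \<partial>kernel r (\<xi> \<omega>)) = (SUP i. \<integral>\<^sup>+y. U i y \<partial>kernel r (\<xi> \<omega>))"
        unfolding SUP_apply using seq
        by (intro nn_integral_monotone_convergence_SUP) (auto simp: measurable_cong_sets[OF sets_kernel refl])
      then show "(SUP i. indicator A \<omega> * (indicator D \<omega> * (\<integral>\<^sup>+y. U i y \<partial>kernel r (\<xi> \<omega>))))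
          = indicator A \<omega> * (indicator D \<omega> * (\<integral>\<^sup>+y. (SUP i. U i) y \<partial>kernel r (\<xi> \<omega>)))"
        by (auto simp: indicator_def)
    qed
    finally show ?case .
  qed
  have [measurable]: "f \<in> borel_measurable borel" by fact
  show ?thesis
    using Z
  proof (induction Z rule: borel_measurable_induct)
    case (cong f g)
    have "(\<integral>\<^sup>+\<omega>. f \<omega> * u \<omega> \<partial>M) = (\<integral>\<^sup>+\<omega>. g \<omega> * u \<omega> \<partial>M)" for u
      using cong(3) G(2) by (intro nn_integral_cong) auto
    then show ?case using cong(4) by presburger
  next
    case (set A)
    then show ?case using 1[OF _ f] by blast
  next
    case (mult u c)
    have [measurable]: "u \<in> borel_measurable M" by (rule GM) fact
    show ?case
      using mult(4) by (simp add: mult.assoc nn_integral_cmult)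
  next
    case (add u v)
    have [measurable]: "u \<in> borel_measurable M" "v \<in> borel_measurable M" by (rule GM, fact)+
    show ?case
      by (simp add: distrib_right nn_integral_add add)
  next
    case (seq U)
    have [measurable]: "U i \<in> borel_measurable M" for i by (rule GM) (fact seq)
    have *: "(\<integral>\<^sup>+\<omega>. (SUP i. U i) \<omega> * g \<omega> \<partial>M) = (SUP i. \<integral>\<^sup>+\<omega>. U i \<omega> * g \<omega> \<partial>M)"
      if [measurable]: "g \<in> borel_measurable M" for g
      using seq(3) unfolding SUP_apply SUP_mult_right_ennreal
      by (intro nn_integral_monotone_convergence_SUP) (auto simp: incseq_def le_fun_def intro: mult_right_mono)
    show ?case
      using seq by (subst (1 2) *) auto
  qed
qed

end

text \<open>The sequence may take the value a itself, which a limit along \<open>at_right a\<close>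
  does not cover; continuity within {a..} does.\<close>

lemma tendsto_at_right_seq:
  fixes f :: "real \<Rightarrow> 'a::metric_space"
  assumes "(f \<longlongrightarrow> f a) (at_right a)" "s \<longlonglongrightarrow> a" "\<And>n. a \<le> s n"
  shows "(\<lambda>n. f (s n)) \<longlonglongrightarrow> f a"
proof -
  have "at a within {a..} = at_right a"
  proof -
    have "{a..} - {a} = {a<..}" by auto
    then show ?thesis by (simp add: at_within_def)
  qed
  then have "continuous (at a within {a..}) f"
    using assms(1) by (simp add: continuous_within)
  then show ?thesis
    using assms(2,3) unfolding continuous_within_sequentially by (auto simp: comp_def)
qed

context feller_process
begin

text \<open>For signed f the nonnegative case is applied to f + B, where B bounds the absolute value
  of f; the terms with B cancel because \<open>trans_op\<close> preserves constants. The bound K on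
  Z makes all the integrals finite.\<close>

lemma markov_integral:
  fixes Z :: "'a \<Rightarrow> real"
  assumes M: "prob_space M" and G: "sets G \<subseteq> sets M" "space G = space M"
    and \<xi>: "\<xi> \<in> M \<rightarrow>\<^sub>M borel" and \<xi>': "\<xi>' \<in> M \<rightarrow>\<^sub>M borel" and r: "0 \<le> r"
    and ev: "\<And>A B. A \<in> sets G \<Longrightarrow> B \<in> sets borel \<Longrightarrow>
      measure M {\<omega> \<in> A. \<omega> \<in> D \<and> \<xi>' \<omega> \<in> B}
      = (\<integral>\<omega>. indicator {\<omega> \<in> A. \<omega> \<in> D} \<omega> * trans_prob P X r (\<xi> \<omega>) B \<partial>M)"
    and D: "D \<in> sets M"
    and Z: "Z \<in> borel_measurable G" "\<And>\<omega>. 0 \<le> Z \<omega>" "\<And>\<omega>. Z \<omega> \<le> K" and f: "f \<in> bcontfun"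
  shows "(\<integral>\<omega>. Z \<omega> * (indicator D \<omega> * f (\<xi>' \<omega>)) \<partial>M)
    = (\<integral>\<omega>. Z \<omega> * (indicator D \<omega> * trans_op r f (\<xi> \<omega>)) \<partial>M)"
proof -
  interpret prob_space M by fact
  have ZM: "Z \<in> borel_measurable M"
    using Z(1) G by (auto simp: measurable_def)
  note [measurable] = \<xi> \<xi>' D ZM
  have pos: "(\<integral>\<omega>. Z \<omega> * (indicator D \<omega> * f (\<xi>' \<omega>)) \<partial>M)
    = (\<integral>\<omega>. Z \<omega> * (indicator D \<omega> * trans_op r f (\<xi> \<omega>)) \<partial>M)"
    if f: "f \<in> bcontfun" and f0: "\<And>x. 0 \<le> f x" for f
  proof -
    have [measurable]: "f \<in> borel_measurable borel" "trans_op r f \<in> borel_measurable borel"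
      using f r by (auto intro!: bcontfun_borel trans_op_bcontfun)
    have tf0: "0 \<le> trans_op r f x" for x
      using trans_op_bounds(1)[OF f r f0] .
    have "(\<integral>\<^sup>+\<omega>. ennreal (Z \<omega> * (indicator D \<omega> * f (\<xi>' \<omega>))) \<partial>M)
        = (\<integral>\<^sup>+\<omega>. ennreal (Z \<omega>) * (indicator D \<omega> * ennreal (f (\<xi>' \<omega>))) \<partial>M)"
      using Z f0 by (intro nn_integral_cong) (auto simp: ennreal_mult split: split_indicator)
    also have "\<dots> = (\<integral>\<^sup>+\<omega>. ennreal (Z \<omega>) * (indicator D \<omega> * (\<integral>\<^sup>+y. ennreal (f y) \<partial>kernel r (\<xi> \<omega>))) \<partial>M)"
      using Z(1) by (intro markov_nn_integral[OF M G \<xi> \<xi>' r ev D]) auto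
    also have "\<dots> = (\<integral>\<^sup>+\<omega>. ennreal (Z \<omega> * (indicator D \<omega> * trans_op r f (\<xi> \<omega>))) \<partial>M)"
      using Z tf0 by (intro nn_integral_cong)
        (auto simp: ennreal_mult nn_trans_op_kernel[OF f f0 r] split: split_indicator)
    finally have nn: "(\<integral>\<^sup>+\<omega>. ennreal (Z \<omega> * (indicator D \<omega> * f (\<xi>' \<omega>))) \<partial>M)
        = (\<integral>\<^sup>+\<omega>. ennreal (Z \<omega> * (indicator D \<omega> * trans_op r f (\<xi> \<omega>))) \<partial>M)" .
    have eq: "(\<integral>\<omega>. Z \<omega> * (indicator D \<omega> * u \<omega>) \<partial>M) = enn2real (\<integral>\<^sup>+\<omega>. ennreal (Z \<omega> * (indicator D \<omega> * u \<omega>)) \<partial>M)"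
      if [measurable]: "u \<in> borel_measurable M" and "\<And>\<omega>. 0 \<le> u \<omega>" for u
      using Z(2) that(2) by (intro integral_eq_nn_integral AE_I2 mult_nonneg_nonneg) auto
    show ?thesis
      using nn eq[of "\<lambda>\<omega>. f (\<xi>' \<omega>)"] eq[of "\<lambda>\<omega>. trans_op r f (\<xi> \<omega>)"] f0 tf0 by simp
  qed
  obtain B where B: "0 \<le> B" "\<And>x. \<bar>f x\<bar> \<le> B" using bcontfun_bound[OF f] by blast
  have fB: "(\<lambda>x. f x + B) \<in> bcontfun" and Bc: "(\<lambda>_ :: 'e. B) \<in> bcontfun"
    using f by (auto simp: continuous_iff intro!: continuous_intros)
  have fB0: "0 \<le> f x + B" for x using B(2)[of x] by linarith
  have tf: "trans_op r f \<in> bcontfun" using f r by (rule trans_op_bcontfun)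
  have int: "integrable M (\<lambda>\<omega>. Z \<omega> * (indicator D \<omega> * u (\<zeta> \<omega>)))"
    if u: "u \<in> bcontfun" and [measurable]: "\<zeta> \<in> M \<rightarrow>\<^sub>M borel" for u :: "'e \<Rightarrow> real" and \<zeta>
  proof -
    obtain B where B: "0 \<le> B" "\<And>x. \<bar>u x\<bar> \<le> B" using bcontfun_bound[OF u] by blast
    have [measurable]: "u \<in> borel_measurable borel" using u by (rule bcontfun_borel)
    have "\<bar>Z \<omega> * (indicator D \<omega> * u (\<zeta> \<omega>))\<bar> \<le> K * B" for \<omega>
      using Z(2,3)[of \<omega>] order_trans[OF Z(2,3)[of \<omega>]] B
      by (auto simp: abs_mult indicator_def intro!: mult_mono)
    then show ?thesis
      by (intro integrable_const_bound[of _ "K * B"]) auto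
  qed
  have "(\<integral>\<omega>. Z \<omega> * (indicator D \<omega> * f (\<xi>' \<omega>)) \<partial>M)
      = (\<integral>\<omega>. Z \<omega> * (indicator D \<omega> * (f (\<xi>' \<omega>) + B)) - Z \<omega> * (indicator D \<omega> * B) \<partial>M)"
    by (intro Bochner_Integration.integral_cong refl) (simp add: algebra_simps)
  also have "\<dots> = (\<integral>\<omega>. Z \<omega> * (indicator D \<omega> * (f (\<xi>' \<omega>) + B)) \<partial>M) - (\<integral>\<omega>. Z \<omega> * (indicator D \<omega> * B) \<partial>M)"
    by (rule Bochner_Integration.integral_diff[OF int[OF fB \<xi>'] int[OF Bc \<xi>']])
  also have "(\<integral>\<omega>. Z \<omega> * (indicator D \<omega> * (f (\<xi>' \<omega>) + B)) \<partial>M)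
      = (\<integral>\<omega>. Z \<omega> * (indicator D \<omega> * (trans_op r (\<lambda>x. f x + B) (\<xi> \<omega>))) \<partial>M)"
    using fB0 by (intro pos[OF fB])
  also have "trans_op r (\<lambda>x. f x + B) = (\<lambda>x. trans_op r f x + B)"
    using trans_op_add[OF f Bc r] by (auto simp: trans_op_const)
  also have "(\<integral>\<omega>. Z \<omega> * (indicator D \<omega> * (trans_op r f (\<xi> \<omega>) + B)) \<partial>M) - (\<integral>\<omega>. Z \<omega> * (indicator D \<omega> * B) \<partial>M)
    = (\<integral>\<omega>. Z \<omega> * (indicator D \<omega> * (trans_op r f (\<xi> \<omega>) + B)) - Z \<omega> * (indicator D \<omega> * B) \<partial>M)"
  proof (rule Bochner_Integration.integral_diff[symmetric])
    show "integrable M (\<lambda>\<omega>. Z \<omega> * (indicator D \<omega> * (trans_op r f (\<xi> \<omega>) + B)))"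
      using Bochner_Integration.integrable_add[OF int[OF tf \<xi>] int[OF Bc \<xi>]] by (simp add: distrib_left)
  qed (rule int[OF Bc \<xi>])
  also have "\<dots> = (\<integral>\<omega>. Z \<omega> * (indicator D \<omega> * trans_op r f (\<xi> \<omega>)) \<partial>M)"
    by (intro Bochner_Integration.integral_cong refl) (simp add: algebra_simps)
  finally show ?thesis .
qed

text \<open>Chapman-Kolmogorov, read off from the strong Markov property at a constant stopping
  time.\<close>

lemma trans_op_semigroup:
  assumes f: "f \<in> bcontfun" and t: "0 \<le> t" and r: "0 \<le> r"
  shows "trans_op (t + r) f x = trans_op t (trans_op r f) x"
proof -
  have "(\<integral>\<omega>. 1 * (indicator (space N) \<omega> * f (X (t + r) \<omega>)) \<partial>P x)
      = (\<integral>\<omega>. 1 * (indicator (space N) \<omega> * trans_op r f (X t \<omega>)) \<partial>P x)"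
  proof (rule markov_integral[where G = "F (ennreal t)"])
    fix A and B :: "'e set" assume A: "A \<in> sets (F (ennreal t))" and B: "B \<in> sets borel"
    \<comment> \<open>An event known at time t belongs to the past of the constant stopping time
      t.\<close>
    have "A \<in> sets (pre_sigma (\<lambda>_. ennreal t))"
    proof (rule sets_pre_sigmaI)
      fix s show "{\<omega> \<in> A. ennreal t \<le> s} \<in> sets (F s)"
        using A sets_F_mono[of "ennreal t" s] by (cases "ennreal t \<le> s") auto
    qed (rule stopping_time_const)
    from strong_Markov[OF stopping_time_const this r B, of x]
    show "measure (P x) {\<omega> \<in> A. \<omega> \<in> space N \<and> X (t + r) \<omega> \<in> B} =
        (\<integral>\<omega>. indicator {\<omega> \<in> A. \<omega> \<in> space N} \<omega> * trans_prob P X r (X t \<omega>) B \<partial>P x)"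
      using t sets.sets_into_space[OF A] space_F[of "ennreal t"]
      by (auto simp: subset_iff cong: conj_cong)
  qed (use t r f sets_F_subset in \<open>auto simp: sets_P space_P space_F prob_space_P intro!: measurable_X_P\<close>)
  moreover have "(\<integral>\<omega>. 1 * (indicator (space N) \<omega> * u \<omega>) \<partial>P x) = (\<integral>\<omega>. u \<omega> \<partial>P x)" for u :: "'w \<Rightarrow> real"
    by (intro Bochner_Integration.integral_cong) (auto simp: space_P)
  ultimately show ?thesis
    by (simp add: trans_op_def)
qed

lemma X_right_seq:
  "w \<in> space N \<Longrightarrow> 0 \<le> r \<Longrightarrow> s \<longlonglongrightarrow> r \<Longrightarrow> (\<And>n. r \<le> s n) \<Longrightarrow> (\<lambda>n. X (s n) w) \<longlonglongrightarrow> X r w"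
  by (rule tendsto_at_right_seq[where f = "\<lambda>u. X u w", OF right_continuous_paths])

text \<open>Dominated convergence along right-continuous paths. The convergence is pointwise in x;
  its uniformity is the subject of the next section.\<close>

lemma trans_op_right_seq:
  assumes f: "f \<in> bcontfun" and r: "0 \<le> r" and s: "s \<longlonglongrightarrow> r" "\<And>n. r \<le> s n"
  shows "(\<lambda>n. trans_op (s n) f x) \<longlonglongrightarrow> trans_op r f x"
proof -
  interpret prob_space "P x" by (rule prob_space_P)
  obtain B where B: "0 \<le> B" "\<And>x. \<bar>f x\<bar> \<le> B" using bcontfun_bound[OF f] by blast
  have fc: "continuous_on UNIV f" using f by (simp add: continuous_iff)
  show ?thesis
    unfolding trans_op_def
  proof (rule integral_dominated_convergence[where w = "\<lambda>_. B"])
    have s0: "0 \<le> s n" for n using r s(2)[of n] by linarith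
    show "(\<lambda>\<omega>. f (X r \<omega>)) \<in> borel_measurable (P x)"
      by (intro borel_measurable_integrable integrable_X f r)
    show "(\<lambda>\<omega>. f (X (s n) \<omega>)) \<in> borel_measurable (P x)" for n
      by (intro borel_measurable_integrable integrable_X f s0)
    show "AE \<omega> in P x. (\<lambda>n. f (X (s n) \<omega>)) \<longlonglongrightarrow> f (X r \<omega>)"
      using X_right_seq[OF _ r s] fc
      by (intro AE_I2) (auto simp: space_P intro!: continuous_on_tendsto_compose[OF fc])
  qed (use B in auto)
qed

lemma trans_op_right_continuous:
  assumes "f \<in> bcontfun" "0 \<le> r"
  shows "((\<lambda>t. trans_op t f x) \<longlongrightarrow> trans_op r f x) (at_right r)"
  unfolding tendsto_at_iff_sequentially
  using trans_op_right_seq[OF assms] by (auto simp: comp_def less_imp_le)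

text \<open>The result on right-continuous paths applies with the state x as the sample point and
  \<open>trans_op t f\<close> as the process at time t.\<close>

lemma measurable_trans_op_joint:
  assumes "f \<in> bcontfun"
  shows "(\<lambda>(t, x). trans_op (max 0 t) f x) \<in> borel_measurable (borel \<Otimes>\<^sub>M borel)"
  by (intro measurable_right_continuous bcontfun_borel trans_op_bcontfun trans_op_right_continuous assms)

section \<open>Strong continuity\<close>

definition strongly_continuous :: "('e \<Rightarrow> real) \<Rightarrow> bool"
  where "strongly_continuous f \<longleftrightarrow>
    (\<forall>e>0. \<exists>d>0. \<forall>t x. 0 \<le> t \<longrightarrow> t \<le> d \<longrightarrow> \<bar>trans_op t f x - f x\<bar> \<le> e)"

definition supermedian :: "real \<Rightarrow> ('e \<Rightarrow> real) \<Rightarrow> bool"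
  where "supermedian \<alpha> f \<longleftrightarrow> f \<in> bcontfun \<and> (\<forall>x. 0 \<le> f x) \<and>
    (\<forall>t\<ge>0. \<forall>x. exp (- \<alpha> * t) * trans_op t f x \<le> f x)"

text \<open>Lets two supermedian functions with different rates be treated with the larger one.
  Nonnegativity of f enters here, through that of \<open>trans_op t f\<close>.\<close>

lemma supermedian_mono:
  assumes "supermedian \<alpha> f" "\<alpha> \<le> \<alpha>'" shows "supermedian \<alpha>' f"
  unfolding supermedian_def
proof (intro conjI allI impI)
  fix t :: real and x assume t: "0 \<le> t"
  have "exp (- \<alpha>' * t) * trans_op t f x \<le> exp (- \<alpha> * t) * trans_op t f x"
    using assms t trans_op_bounds(1)[of f t 0 x]
    by (intro mult_right_mono) (auto simp: supermedian_def intro: mult_right_mono)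
  then show "exp (- \<alpha>' * t) * trans_op t f x \<le> f x"
    using assms(1) t unfolding supermedian_def by (meson order_trans)
qed (use assms in \<open>auto simp: supermedian_def\<close>)

text \<open>For a supermedian function the approximation is monotone in time, so Dini's argument applies.\<close>

lemma supermedian_strongly_continuous:
  assumes f: "supermedian \<alpha> f" and \<alpha>: "0 \<le> \<alpha>"
  shows "strongly_continuous f"
  unfolding strongly_continuous_def
proof (intro allI impI)
  fix e :: real assume e: "0 < e"
  have fb: "f \<in> bcontfun" and f0: "\<And>x. 0 \<le> f x" using f by (auto simp: supermedian_def)
  obtain B where B: "0 \<le> B" "\<And>x. \<bar>f x\<bar> \<le> B" using bcontfun_bound[OF fb] by blast
  define u where "u t x = exp (- \<alpha> * t) * trans_op t f x" for t x
  \<comment> \<open>The supermedian inequality over the time t - s, pushed forward by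
    \<open>trans_op s\<close>.\<close>
  have anti: "u t x \<le> u s x" if "0 \<le> s" "s \<le> t" for s t x
  proof -
    have "trans_op t f x = trans_op s (trans_op (t - s) f) x"
      using trans_op_semigroup[OF fb that(1), of "t - s" x] that by simp
    then have "u t x = exp (- \<alpha> * s) * trans_op s (\<lambda>x. exp (- \<alpha> * (t - s)) * trans_op (t - s) f x) x"
      unfolding u_def trans_op_cmult by (simp add: mult.assoc[symmetric] exp_add[symmetric] right_diff_distrib)
    also have "\<dots> \<le> exp (- \<alpha> * s) * trans_op s f x"
    proof (intro mult_left_mono trans_op_mono)
      have "trans_op (t - s) f \<in> bcontfun" using fb that by (intro trans_op_bcontfun) auto
      then show "(\<lambda>x. exp (- \<alpha> * (t - s)) * trans_op (t - s) f x) \<in> bcontfun"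
        by (auto simp: continuous_iff intro!: continuous_intros)
    qed (use f that in \<open>auto simp: supermedian_def\<close>)
    finally show ?thesis by (simp add: u_def)
  qed
  \<comment> \<open>By pointwise convergence at time 0 these open sets cover the space, so finitely
    many of them do; monotonicity in time carries the estimate from each of these finitely many
    times to all shorter ones.\<close>
  define U where "U n = {x. f x - e / 2 < u (inverse (real (Suc n))) x}" for n
  have "UNIV \<subseteq> (\<Union>n. U n)"
  proof
    fix x
    have "(\<lambda>n. exp (- \<alpha> * inverse (real (Suc n))) * trans_op (inverse (real (Suc n))) f x)
        \<longlonglongrightarrow> exp (- \<alpha> * 0) * trans_op 0 f x"
      by (intro tendsto_intros trans_op_right_seq[OF fb] LIMSEQ_inverse_real_of_nat) auto
    then have "(\<lambda>n. u (inverse (real (Suc n))) x) \<longlonglongrightarrow> f x"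
      using trans_op_0[OF fb] by (simp add: u_def)
    from order_tendstoD(1)[OF this, of "f x - e / 2"] e
    obtain n where "f x - e / 2 < u (inverse (real (Suc n))) x"
      by (auto simp: eventually_sequentially)
    then show "x \<in> (\<Union>n. U n)" by (auto simp: U_def)
  qed
  moreover have "open (U n)" for n
  proof -
    have "trans_op (inverse (real (Suc n))) f \<in> bcontfun" using fb by (intro trans_op_bcontfun) auto
    then show ?thesis
      using fb unfolding U_def u_def continuous_iff by (intro open_Collect_less continuous_intros)
  qed
  ultimately obtain I where I: "finite I" "UNIV \<subseteq> (\<Union>n\<in>I. U n)"
    using compactE_image[OF compact_state_space, of UNIV U] by auto
  define m where "m = Max (insert 0 I)"
  \<comment> \<open>The first term serves the lower estimate: it is the shortest time that the
    finite cover uses. The second makes exp (\<alpha> * d) at most 1 + e / (2 * (B + 1)), which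
    serves the upper estimate since f is at most B; for \<alpha> = 0 that factor is 1
    anyway.\<close>
  define d where "d = min (inverse (real (Suc m))) (if \<alpha> = 0 then 1 else ln (1 + e / (2 * (B + 1))) / \<alpha>)"
  have e1: "0 < e / (2 * (B + 1))" using e B by (intro divide_pos_pos) auto
  have d: "0 < d" unfolding d_def using e1 \<alpha> by (auto intro!: divide_pos_pos ln_gt_zero)
  show "\<exists>d>0. \<forall>t x. 0 \<le> t \<longrightarrow> t \<le> d \<longrightarrow> \<bar>trans_op t f x - f x\<bar> \<le> e"
  proof (intro exI[of _ d] conjI allI impI d)
    fix t x assume t: "0 \<le> t" "t \<le> d"
    obtain n where n: "n \<in> I" "x \<in> U n" using I by auto
    have "n \<le> m" using n I by (auto simp: m_def)
    then have "inverse (real (Suc m)) \<le> inverse (real (Suc n))"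
      by (intro le_imp_inverse_le) auto
    moreover have "t \<le> inverse (real (Suc m))"
      using t(2) unfolding d_def by linarith
    ultimately have "t \<le> inverse (real (Suc n))" by linarith
    then have lo: "f x - e / 2 \<le> u t x"
      using anti[OF t(1), of "inverse (real (Suc n))" x] n(2) by (auto simp: U_def)
    have t0: "0 \<le> trans_op t f x" using trans_op_bounds(1)[OF fb t(1) f0] .
    have "u t x \<le> 1 * trans_op t f x"
      unfolding u_def using t \<alpha> t0 by (intro mult_right_mono) auto
    then have 1: "f x - e \<le> trans_op t f x" using lo e by simp
    have "exp (\<alpha> * t) \<le> 1 + e / (2 * (B + 1))"
    proof (cases "\<alpha> = 0")
      case False
      then have "\<alpha> * t \<le> ln (1 + e / (2 * (B + 1)))"
        using t(2) \<alpha> by (auto simp: d_def field_simps)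
      then show ?thesis using e1 by (metis add_pos_pos exp_le_cancel_iff exp_ln zero_less_one)
    qed (use e1 in auto)
    have "trans_op t f x = exp (\<alpha> * t) * u t x"
      by (simp add: u_def mult.assoc[symmetric] exp_add[symmetric])
    also have "\<dots> \<le> exp (\<alpha> * t) * f x"
      using anti[of 0 t x] t trans_op_0[OF fb] by (intro mult_left_mono) (auto simp: u_def)
    also have "\<dots> \<le> (1 + e / (2 * (B + 1))) * f x"
      by (intro mult_right_mono f0) fact
    also have "\<dots> = f x + e / (2 * (B + 1)) * f x" by (simp add: algebra_simps)
    also have "\<dots> \<le> f x + e / (2 * (B + 1)) * (2 * (B + 1))"
      using B(1) B(2)[of x] e1 by (intro add_left_mono mult_left_mono) auto
    also have "\<dots> = f x + e" using B by simp
    finally show "\<bar>trans_op t f x - f x\<bar> \<le> e" using 1 by (simp add: abs_le_iff)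
  qed
qed

lemma supermedian_add:
  assumes "supermedian \<alpha> f" "supermedian \<alpha> g" shows "supermedian \<alpha> (\<lambda>x. f x + g x)"
  unfolding supermedian_def
proof (intro conjI allI impI)
  fix t :: real and x assume t: "0 \<le> t"
  have "exp (- \<alpha> * t) * trans_op t f x + exp (- \<alpha> * t) * trans_op t g x \<le> f x + g x"
    using assms t unfolding supermedian_def by (intro add_mono) auto
  then show "exp (- \<alpha> * t) * trans_op t (\<lambda>x. f x + g x) x \<le> f x + g x"
    using assms t by (subst trans_op_add) (auto simp: supermedian_def distrib_left)
qed (use assms in \<open>auto simp: supermedian_def continuous_iff intro!: continuous_intros\<close>)

lemma supermedian_cmult:
  assumes "supermedian \<alpha> f" "0 \<le> a" shows "supermedian \<alpha> (\<lambda>x. a * f x)"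
  unfolding supermedian_def
proof (intro conjI allI impI)
  fix t :: real and x assume t: "0 \<le> t"
  have "a * (exp (- \<alpha> * t) * trans_op t f x) \<le> a * f x"
    using assms t unfolding supermedian_def by (intro mult_left_mono) auto
  then show "exp (- \<alpha> * t) * trans_op t (\<lambda>x. a * f x) x \<le> a * f x"
    by (simp add: trans_op_cmult ac_simps)
qed (use assms in \<open>auto simp: supermedian_def continuous_iff intro!: continuous_intros\<close>)

lemma supermedian_const: "0 \<le> \<alpha> \<Longrightarrow> 0 \<le> a \<Longrightarrow> supermedian \<alpha> (\<lambda>_. a)"
  by (auto simp: supermedian_def continuous_iff trans_op_const intro!: mult_left_le_one_le)

text \<open>Jensen's inequality for the square: integrate the nonnegative function (f - m)^2, where
  m is the number \<open>trans_op t f x\<close>.\<close>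

lemma trans_op_square_ge:
  assumes f: "f \<in> bcontfun" and t: "0 \<le> t"
  shows "(trans_op t f x)\<^sup>2 \<le> trans_op t (\<lambda>x. (f x)\<^sup>2) x"
proof -
  define m where "m = trans_op t f x"
  have b: "(\<lambda>x. (f x)\<^sup>2) \<in> bcontfun" "(\<lambda>x. 2 * m * f x) \<in> bcontfun"
    "(\<lambda>x. (f x)\<^sup>2 - 2 * m * f x) \<in> bcontfun"
    using f by (auto simp: continuous_iff intro!: continuous_intros)
  have "- m\<^sup>2 \<le> (f y)\<^sup>2 - 2 * m * f y" for y
    using zero_le_power2[of "f y - m"] by (simp add: power2_diff algebra_simps)
  from trans_op_bounds(1)[OF b(3) t this, of x]
  show ?thesis
    unfolding trans_op_diff[OF b(1,2) t] trans_op_cmult by (simp add: m_def[symmetric] power2_eq_square)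
qed

text \<open>
  Jensen's inequality for \<open>y \<mapsto> 2 K y - y\<^sup>2\<close>, which is concave and increasing on \<open>[0, K]\<close>. Hence squares, and
  then products, of supermedian functions are differences of such functions.
\<close>

lemma supermedian_concave:
  assumes f: "supermedian \<alpha> f" and \<alpha>: "0 \<le> \<alpha>" and K: "\<And>x. f x \<le> K"
  shows "supermedian \<alpha> (\<lambda>x. 2 * K * f x - (f x)\<^sup>2)"
  unfolding supermedian_def
proof (intro conjI allI impI)
  have fb: "f \<in> bcontfun" and f0: "\<And>x. 0 \<le> f x" using f by (auto simp: supermedian_def)
  have b: "(\<lambda>x. (f x)\<^sup>2) \<in> bcontfun" "(\<lambda>x. 2 * K * f x) \<in> bcontfun"
    using fb by (auto simp: continuous_iff intro!: continuous_intros)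
  show "(\<lambda>x. 2 * K * f x - (f x)\<^sup>2) \<in> bcontfun"
    using fb by (auto simp: continuous_iff intro!: continuous_intros)
  show "0 \<le> 2 * K * f x - (f x)\<^sup>2" for x
  proof -
    have "0 \<le> f x * (2 * K - f x)" using f0[of x] K[of x] by (intro mult_nonneg_nonneg) auto
    then show ?thesis by (simp add: algebra_simps power2_eq_square)
  qed
  fix t :: real and x assume t: "0 \<le> t"
  define m q where "m = trans_op t f x" and "q = exp (- \<alpha> * t)"
  have q: "0 \<le> q" "q \<le> 1" using \<alpha> t by (auto simp: q_def)
  have m: "0 \<le> m" "q * m \<le> f x"
    using trans_op_bounds(1)[OF fb t f0] f t by (auto simp: m_def q_def supermedian_def)
  have "q * trans_op t (\<lambda>x. 2 * K * f x - (f x)\<^sup>2) x \<le> q * (2 * K * m - m\<^sup>2)"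
    using trans_op_square_ge[OF fb t, of x] q
    by (intro mult_left_mono) (simp_all add: trans_op_diff[OF b(2,1) t] trans_op_cmult m_def)
  also have "\<dots> \<le> 2 * K * (q * m) - (q * m)\<^sup>2"
  proof -
    have "q * q * m\<^sup>2 \<le> q * 1 * m\<^sup>2" using q by (intro mult_right_mono mult_left_mono) auto
    then show ?thesis by (simp add: algebra_simps power2_eq_square)
  qed
  also have "\<dots> \<le> 2 * K * f x - (f x)\<^sup>2"
  proof -
    have "0 \<le> (f x - q * m) * (2 * K - f x - q * m)"
      using m K[of x] by (intro mult_nonneg_nonneg) auto
    then show ?thesis by (simp add: algebra_simps power2_eq_square)
  qed
  finally show "exp (- \<alpha> * t) * trans_op t (\<lambda>x. 2 * K * f x - (f x)\<^sup>2) x \<le> 2 * K * f x - (f x)\<^sup>2"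
    by (simp add: q_def)
qed

text \<open>The algebra to which Stone-Weierstrass is applied. Strong continuity is inherited by
  differences, and one common rate \<alpha> is no restriction because a rate may always be
  increased.\<close>

definition supermedian_span :: "('e \<Rightarrow> real) set"
  where "supermedian_span = {f. \<exists>\<alpha>\<ge>0. \<exists>a b. supermedian \<alpha> a \<and> supermedian \<alpha> b \<and> f = (\<lambda>x. a x - b x)}"

lemma supermedian_spanI:
  "supermedian \<alpha> a \<Longrightarrow> supermedian \<alpha> b \<Longrightarrow> 0 \<le> \<alpha> \<Longrightarrow> (\<And>x. f x = a x - b x) \<Longrightarrow> f \<in> supermedian_span"
  unfolding supermedian_span_def by blast

lemma supermedian_spanE:
  assumes "f \<in> supermedian_span"
  obtains \<alpha> a b where "0 \<le> \<alpha>" "supermedian \<alpha> a" "supermedian \<alpha> b" "f = (\<lambda>x. a x - b x)"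
  using assms unfolding supermedian_span_def by blast

lemma supermedian_span_const: "(\<lambda>_. a) \<in> supermedian_span"
  by (rule supermedian_spanI[of 0 "\<lambda>_. max a 0" "\<lambda>_. max (- a) 0"])
     (auto intro!: supermedian_const)

lemma supermedian_span_add:
  assumes "f \<in> supermedian_span" "g \<in> supermedian_span"
  shows "(\<lambda>x. f x + g x) \<in> supermedian_span"
proof -
  obtain \<alpha> a b where 1: "0 \<le> \<alpha>" "supermedian \<alpha> a" "supermedian \<alpha> b" "f = (\<lambda>x. a x - b x)"
    using assms(1) by (rule supermedian_spanE)
  obtain \<alpha>' a' b' where 2: "0 \<le> \<alpha>'" "supermedian \<alpha>' a'" "supermedian \<alpha>' b'" "g = (\<lambda>x. a' x - b' x)"
    using assms(2) by (rule supermedian_spanE)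
  show ?thesis
    by (rule supermedian_spanI[of "max \<alpha> \<alpha>'" "\<lambda>x. a x + a' x" "\<lambda>x. b x + b' x"])
       (use 1 2 in \<open>auto intro!: supermedian_add intro: supermedian_mono\<close>)
qed

lemma supermedian_span_cmult:
  assumes "f \<in> supermedian_span"
  shows "(\<lambda>x. r * f x) \<in> supermedian_span"
proof -
  obtain \<alpha> a b where 1: "0 \<le> \<alpha>" "supermedian \<alpha> a" "supermedian \<alpha> b" "f = (\<lambda>x. a x - b x)"
    using assms(1) by (rule supermedian_spanE)
  show ?thesis
  proof (cases "0 \<le> r")
    case True
    then show ?thesis
      using 1 by (intro supermedian_spanI[of \<alpha> "\<lambda>x. r * a x" "\<lambda>x. r * b x"])
        (auto intro!: supermedian_cmult simp: algebra_simps)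
  next
    case False
    then show ?thesis
      using 1 by (intro supermedian_spanI[of \<alpha> "\<lambda>x. (- r) * b x" "\<lambda>x. (- r) * a x"] supermedian_cmult)
        (auto simp: algebra_simps)
  qed
qed

text \<open>f^2 is the difference of 2 K f and of the concave image 2 K f - f^2, both supermedian
  with the rate of f.\<close>

lemma supermedian_square_span:
  assumes "supermedian \<alpha> f" "0 \<le> \<alpha>"
  shows "(\<lambda>x. (f x)\<^sup>2) \<in> supermedian_span"
proof -
  obtain K where K: "0 \<le> K" "\<And>x. \<bar>f x\<bar> \<le> K"
    using bcontfun_bound[of f] assms(1) by (auto simp: supermedian_def)
  show ?thesis
    by (rule supermedian_spanI[of \<alpha> "\<lambda>x. 2 * K * f x" "\<lambda>x. 2 * K * f x - (f x)\<^sup>2"])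
       (use assms K abs_le_D1 in \<open>auto intro!: supermedian_cmult supermedian_concave\<close>)
qed

text \<open>(a - b)^2 = 2 a^2 + 2 b^2 - (a + b)^2, where a + b is again supermedian, unlike a -
  b.\<close>

lemma supermedian_span_square:
  assumes "f \<in> supermedian_span" shows "(\<lambda>x. (f x)\<^sup>2) \<in> supermedian_span"
proof -
  obtain \<alpha> a b where 1: "0 \<le> \<alpha>" "supermedian \<alpha> a" "supermedian \<alpha> b" "f = (\<lambda>x. a x - b x)"
    using assms(1) by (rule supermedian_spanE)
  have "(\<lambda>x. (2 * (a x)\<^sup>2 + 2 * (b x)\<^sup>2) + (- 1) * (a x + b x)\<^sup>2) \<in> supermedian_span"
    by (intro supermedian_span_add supermedian_span_cmult
        supermedian_square_span[OF 1(2,1)] supermedian_square_span[OF 1(3,1)]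
        supermedian_square_span[OF supermedian_add[OF 1(2,3)] 1(1)])
  also have "(\<lambda>x. (2 * (a x)\<^sup>2 + 2 * (b x)\<^sup>2) + (- 1) * (a x + b x)\<^sup>2) = (\<lambda>x. (f x)\<^sup>2)"
    by (auto simp: 1(4) power2_eq_square algebra_simps)
  finally show ?thesis .
qed

lemma supermedian_span_mult:
  assumes "f \<in> supermedian_span" "g \<in> supermedian_span"
  shows "(\<lambda>x. f x * g x) \<in> supermedian_span"
proof -
  have "(\<lambda>x. (1 / 4) * (f x + g x)\<^sup>2 + (- (1 / 4)) * (f x + (- 1) * g x)\<^sup>2) \<in> supermedian_span"
    by (intro supermedian_span_add supermedian_span_cmult supermedian_span_square assms)
  also have "(\<lambda>x. (1 / 4) * (f x + g x)\<^sup>2 + (- (1 / 4)) * (f x + (- 1) * g x)\<^sup>2) = (\<lambda>x. f x * g x)"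
    by (auto simp: power2_eq_square algebra_simps)
  finally show ?thesis .
qed

section \<open>Resolvents and density of the supermedian span\<close>

definition exp_weight :: "real \<Rightarrow> real"
  where "exp_weight u = exp (- u) * indicator {0..} u"

lemma exp_weight: "integrable lborel exp_weight" "integral\<^sup>L lborel exp_weight = 1"
  using has_bochner_integral_I0i_power_exp_m'[of 0]
  by (simp_all add: exp_weight_def[abs_def] has_bochner_integral_iff)

lemma exp_weight_nonneg: "0 \<le> exp_weight u"
  by (simp add: exp_weight_def)

lemma measurable_exp_weight [measurable]: "exp_weight \<in> borel_measurable borel"
  using borel_measurable_integrable[OF exp_weight(1)] by simp

text \<open>This is n R_n f for the usual resolvent R_n f, the integral of exp(-n t) P_t f over t
  \<ge> 0, after the substitution t = u / n. In this form the weight does not depend on n, so that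
  the limit in n is a case of dominated convergence.\<close>

definition resolvent :: "real \<Rightarrow> ('e \<Rightarrow> real) \<Rightarrow> 'e \<Rightarrow> real"
  where "resolvent n f x = (\<integral>u. exp_weight u * trans_op (max 0 (u / n)) f x \<partial>lborel)"

lemma measurable_trans_op_time [measurable]:
  assumes "f \<in> bcontfun" and g[measurable]: "g \<in> borel_measurable M"
  shows "(\<lambda>u. trans_op (max 0 (g u)) f x) \<in> borel_measurable M"
proof -
  have "(\<lambda>u. (\<lambda>(t, x). trans_op (max 0 t) f x) (g u, x)) \<in> borel_measurable M"
    by (rule measurable_compose[OF _ measurable_trans_op_joint[OF assms(1)]]) measurable
  then show ?thesis by simp
qed

lemma integrable_exp_weight_bounded:
  assumes [measurable]: "g \<in> borel_measurable lborel" and "\<And>u. \<bar>g u\<bar> \<le> B"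
  shows "integrable lborel (\<lambda>u. exp_weight u * g u :: real)"
proof (rule Bochner_Integration.integrable_bound)
  show "integrable lborel (\<lambda>u. B * exp_weight u)" using exp_weight(1) by simp
  have "\<bar>exp_weight u * g u\<bar> \<le> exp_weight u * B" for u
    using assms(2)[of u] exp_weight_nonneg[of u] by (auto simp: abs_mult intro: mult_left_mono)
  moreover have "0 \<le> B" using assms(2)[of 0] by linarith
  ultimately show "AE u in lborel. norm (exp_weight u * g u) \<le> norm (B * exp_weight u)"
    using exp_weight_nonneg by (intro AE_I2) (simp add: ac_simps abs_mult)
qed simp

lemma resolvent_bcontfun:
  assumes f: "f \<in> bcontfun" shows "resolvent n f \<in> bcontfun"
  unfolding continuous_iff
proof (rule continuous_at_imp_continuous_on, rule ballI, unfold continuous_at_sequentially, intro allI impI)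
  fix x and y :: "nat \<Rightarrow> 'e" assume y: "y \<longlonglongrightarrow> x"
  obtain B where B: "0 \<le> B" "\<And>x. \<bar>f x\<bar> \<le> B" using bcontfun_bound[OF f] by blast
  have "(\<lambda>k. resolvent n f (y k)) \<longlonglongrightarrow> resolvent n f x"
    unfolding resolvent_def
  proof (rule integral_dominated_convergence[where w = "\<lambda>u. B * exp_weight u"])
    show "integrable lborel (\<lambda>u. B * exp_weight u)" using exp_weight(1) by simp
    show "AE u in lborel. (\<lambda>k. exp_weight u * trans_op (max 0 (u / n)) f (y k))
        \<longlonglongrightarrow> exp_weight u * trans_op (max 0 (u / n)) f x"
    proof (intro AE_I2 tendsto_mult tendsto_const)
      fix u show "(\<lambda>k. trans_op (max 0 (u / n)) f (y k)) \<longlonglongrightarrow> trans_op (max 0 (u / n)) f x"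
        using trans_op_bcontfun[OF f, of "max 0 (u / n)"] y
        by (auto simp: continuous_iff intro!: continuous_on_tendsto_compose[of UNIV "trans_op (max 0 (u / n)) f"])
    qed
    show "AE u in lborel. norm (exp_weight u * trans_op (max 0 (u / n)) f (y k)) \<le> B * exp_weight u" for k
      using trans_op_abs_le[OF f _ B(2)] exp_weight_nonneg
      by (intro AE_I2) (auto simp: abs_mult mult.commute[of B] intro!: mult_left_mono)
  qed (use f in measurable)
  then show "(resolvent n f \<circ> y) \<longlonglongrightarrow> resolvent n f x" by (simp add: comp_def)
qed

text \<open>Pointwise convergence is enough for its purpose, the separation of points.\<close>

lemma resolvent_tendsto:
  assumes f: "f \<in> bcontfun" shows "(\<lambda>n. resolvent (real (Suc n)) f x) \<longlonglongrightarrow> f x"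
proof -
  obtain B where B: "0 \<le> B" "\<And>x. \<bar>f x\<bar> \<le> B" using bcontfun_bound[OF f] by blast
  have "(\<lambda>n. resolvent (real (Suc n)) f x) \<longlonglongrightarrow> (\<integral>u. exp_weight u * f x \<partial>lborel)"
    unfolding resolvent_def
  proof (rule integral_dominated_convergence[where w = "\<lambda>u. B * exp_weight u"])
    show "integrable lborel (\<lambda>u. B * exp_weight u)" using exp_weight(1) by simp
    show "AE u in lborel. (\<lambda>k. exp_weight u * trans_op (max 0 (u / real (Suc k))) f x) \<longlonglongrightarrow> exp_weight u * f x"
    proof (intro AE_I2 tendsto_mult tendsto_const)
      fix u
      have "(\<lambda>k. u / real (Suc k)) \<longlonglongrightarrow> 0"
        using tendsto_mult[OF tendsto_const LIMSEQ_inverse_real_of_nat, of u] by (simp add: divide_inverse del: of_nat_Suc)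
      from tendsto_max[OF tendsto_const this, of 0]
      have "(\<lambda>k. max 0 (u / real (Suc k))) \<longlonglongrightarrow> 0" by simp
      then show "(\<lambda>k. trans_op (max 0 (u / real (Suc k))) f x) \<longlonglongrightarrow> f x"
        using trans_op_right_seq[OF f, of 0 _ x] by (simp add: trans_op_0[OF f])
    qed
    show "AE u in lborel. norm (exp_weight u * trans_op (max 0 (u / real (Suc k))) f x) \<le> B * exp_weight u" for k
      using trans_op_abs_le[OF f _ B(2)] exp_weight_nonneg
      by (intro AE_I2) (auto simp: abs_mult mult.commute[of B] intro!: mult_left_mono)
  qed (use f in measurable)
  then show ?thesis by (simp add: exp_weight)
qed

lemma trans_op_resolvent:
  assumes f: "f \<in> bcontfun" and n: "0 < n" and s: "0 \<le> s"
  shows "trans_op s (resolvent n f) x = (\<integral>u. exp_weight u * trans_op (s + max 0 (u / n)) f x \<partial>lborel)"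
proof -
  obtain B where B: "0 \<le> B" "\<And>x. \<bar>f x\<bar> \<le> B" using bcontfun_bound[OF f] by blast
  interpret Px: prob_space "P x" by (rule prob_space_P)
  interpret pair_sigma_finite lborel "P x" ..
  note [measurable] = measurable_X_P[OF s]
  let ?h = "\<lambda>u \<omega>. exp_weight u * trans_op (max 0 (u / n)) f (X s \<omega>)"
  have [measurable]: "(\<lambda>z. trans_op (max 0 (fst z / n)) f (X s (snd z))) \<in> borel_measurable (lborel \<Otimes>\<^sub>M P x)"
  proof -
    have "(\<lambda>z. (\<lambda>(t, x). trans_op (max 0 t) f x) (fst z / n, X s (snd z))) \<in> borel_measurable (lborel \<Otimes>\<^sub>M P x)"
      by (rule measurable_compose[OF _ measurable_trans_op_joint[OF f]]) measurable
    then show ?thesis by simp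
  qed
  have "integrable (lborel \<Otimes>\<^sub>M P x) (case_prod ?h)"
  proof (rule Fubini_integrable)
    show "case_prod ?h \<in> borel_measurable (lborel \<Otimes>\<^sub>M P x)"
      by (simp add: case_prod_beta')
    have bd: "\<bar>?h u \<omega>\<bar> \<le> B * exp_weight u" for u \<omega>
      using trans_op_abs_le[OF f _ B(2)] exp_weight_nonneg
      by (auto simp: abs_mult mult.commute[of B] intro!: mult_left_mono)
    have int: "integrable (P x) (?h u)" for u
      using trans_op_bcontfun[OF f, of "max 0 (u / n)"] s
      by (intro integrable_mult_right integrable_X) auto
    show "AE u in lborel. integrable (P x) (\<lambda>\<omega>. case (u, \<omega>) of (u, \<omega>) \<Rightarrow> ?h u \<omega>)"
      using int by simp
    show "integrable lborel (\<lambda>u. \<integral>\<omega>. norm (case (u, \<omega>) of (u, \<omega>) \<Rightarrow> ?h u \<omega>) \<partial>P x)"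
    proof (rule Bochner_Integration.integrable_bound)
      show "integrable lborel (\<lambda>u. B * exp_weight u)" using exp_weight(1) by simp
      have "(\<integral>\<omega>. norm (?h u \<omega>) \<partial>P x) \<le> (\<integral>\<omega>. B * exp_weight u \<partial>P x)" for u
        using int bd by (intro integral_mono) auto
      then have "(\<integral>\<omega>. norm (?h u \<omega>) \<partial>P x) \<le> B * exp_weight u" for u
        by (simp add: Px.prob_space)
      then show "AE u in lborel. norm (\<integral>\<omega>. norm (case (u, \<omega>) of (u, \<omega>) \<Rightarrow> ?h u \<omega>) \<partial>P x) \<le> norm (B * exp_weight u)"
        using B exp_weight_nonneg by (intro AE_I2) (auto simp: abs_mult)
    qed measurable
  qed
  from Fubini_integral[OF this]
  have "trans_op s (resolvent n f) x = (\<integral>u. (\<integral>\<omega>. ?h u \<omega> \<partial>P x) \<partial>lborel)"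
    by (simp add: trans_op_def[of s] resolvent_def)
  also have "\<dots> = (\<integral>u. exp_weight u * trans_op (s + max 0 (u / n)) f x \<partial>lborel)"
    by (intro Bochner_Integration.integral_cong) (auto simp: trans_op_semigroup[OF f s] trans_op_def[of s])
  finally show ?thesis .
qed

text \<open>Applying P_s and discounting by exp(-n s) leaves exactly the part of the resolvent
  integral that belongs to times after s; the part that is lost is nonnegative because f is.\<close>

lemma supermedian_resolvent:
  assumes f: "f \<in> bcontfun" "\<And>x. 0 \<le> f x" and n: "0 < n"
  shows "supermedian n (resolvent n f)"
  unfolding supermedian_def
proof (intro conjI allI impI resolvent_bcontfun f)
  fix x
  obtain B where B: "0 \<le> B" "\<And>x. \<bar>f x\<bar> \<le> B" using bcontfun_bound[OF f(1)] by blast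
  have t0: "0 \<le> trans_op (max 0 t) f x" for t x
    using trans_op_bounds(1)[OF f(1) _ f(2)] by simp
  show "0 \<le> resolvent n f x"
    unfolding resolvent_def using exp_weight_nonneg t0 by (intro integral_nonneg_AE AE_I2 mult_nonneg_nonneg)
  fix s :: real assume s: "0 \<le> s"
  let ?G = "\<lambda>u. exp_weight u * trans_op (max 0 (u / n)) f x"
  have G: "integrable lborel ?G"
    using trans_op_abs_le[OF f(1) _ B(2)] f by (intro integrable_exp_weight_bounded[of _ B]) auto
  then have G': "integrable lborel (\<lambda>u. ?G (n * s + 1 * u))"
    by (rule lborel_integrable_real_affine) simp
  \<comment> \<open>Under the substitution u to n s + u this is an equality for u \<ge> 0, and for u
    < 0 the left side is 0.\<close>
  have "exp (- n * s) * (exp_weight u * trans_op (s + max 0 (u / n)) f x) \<le> ?G (n * s + 1 * u)" for u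
  proof (cases "0 \<le> u")
    case True
    have "max 0 ((n * s + u) / n) = s + max 0 (u / n)"
      using n s True by (simp add: add_divide_distrib max_def)
    moreover have "0 \<le> n * s + u" using n s True by simp
    ultimately show ?thesis
      using True by (simp add: exp_weight_def mult.assoc[symmetric] exp_add[symmetric])
  qed (use t0 exp_weight_nonneg in \<open>simp add: exp_weight_def\<close>)
  moreover have "integrable lborel (\<lambda>u. exp_weight u * trans_op (s + max 0 (u / n)) f x)"
  proof (rule integrable_exp_weight_bounded)
    have "s + max 0 (u / n) = max 0 (s + max 0 (u / n))" for u using s by simp
    then show "(\<lambda>u. trans_op (s + max 0 (u / n)) f x) \<in> borel_measurable lborel"
      using measurable_trans_op_time[OF f(1), of "\<lambda>u. s + max 0 (u / n)" lborel x] by simp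
    show "\<bar>trans_op (s + max 0 (u / n)) f x\<bar> \<le> B" for u
      using s by (intro trans_op_abs_le[OF f(1) _ B(2)]) simp
  qed
  ultimately have "(\<integral>u. exp (- n * s) * (exp_weight u * trans_op (s + max 0 (u / n)) f x) \<partial>lborel)
      \<le> (\<integral>u. ?G (n * s + 1 * u) \<partial>lborel)"
    using G' by (intro integral_mono integrable_mult_right)
  also have "\<dots> = (\<integral>u. ?G u \<partial>lborel)"
    using lborel_integral_real_affine[of 1 ?G "n * s"] by simp
  finally show "exp (- n * s) * trans_op s (resolvent n f) x \<le> resolvent n f x"
    by (simp add: trans_op_resolvent[OF f(1) n s] resolvent_def)
qed

text \<open>Two points are separated by a resolvent of the distance to one of them: if all these
  resolvents agreed at both points, so would their limit, the distance itself.\<close>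

lemma function_ring_supermedian_span: "function_ring_on supermedian_span (UNIV :: 'e set)"
proof
  show "compact (UNIV :: 'e set)" by (rule compact_state_space)
  show "continuous_on UNIV f" if "f \<in> supermedian_span" for f
    using that by (elim supermedian_spanE) (auto simp: supermedian_def continuous_iff intro!: continuous_intros)
  fix x y :: 'e assume "x \<noteq> y"
  define f where "f z = dist z x" for z
  have f: "f \<in> bcontfun" "\<And>z. 0 \<le> f z"
    by (auto simp: f_def[abs_def] continuous_iff intro!: continuous_intros)
  have "\<exists>n. resolvent (real (Suc n)) f x \<noteq> resolvent (real (Suc n)) f y"
  proof (rule ccontr)
    assume "\<not> ?thesis"
    then have "f x = f y"
      using resolvent_tendsto[OF f(1), of x] resolvent_tendsto[OF f(1), of y]
      by (auto intro: LIMSEQ_unique)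
    then show False using \<open>x \<noteq> y\<close> by (simp add: f_def)
  qed
  moreover have "resolvent (real (Suc n)) f \<in> supermedian_span" for n
    using supermedian_resolvent[OF f, of "real (Suc n)"]
    by (intro supermedian_spanI[of "real (Suc n)" _ "\<lambda>_. 0"] supermedian_const) auto
  ultimately show "\<exists>f\<in>supermedian_span. f x \<noteq> f y" by blast
qed (rule supermedian_span_add supermedian_span_mult supermedian_span_const; assumption?)+

lemma trans_op_diff_close:
  assumes "f \<in> bcontfun" "g \<in> bcontfun" "0 \<le> t" "\<And>x. \<bar>f x - g x\<bar> \<le> e"
  shows "\<bar>trans_op t f x - trans_op t g x\<bar> \<le> e"
proof -
  have "(\<lambda>x. f x - g x) \<in> bcontfun" using assms(1,2) by (auto simp: continuous_iff intro!: continuous_intros)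
  from trans_op_abs_le[OF this assms(3,4), of x] show ?thesis
    using trans_op_diff[OF assms(1-3), of x] by simp
qed

text \<open>Uniform limits preserve strong continuity because \<open>trans_op t\<close> is a
  contraction in the supremum norm. The four quarters of e pay for f - g before and after
  \<open>trans_op t\<close> is applied and for the two supermedian parts of g.\<close>

theorem strongly_continuous:
  assumes f: "f \<in> bcontfun" shows "strongly_continuous f"
  unfolding strongly_continuous_def
proof (intro allI impI)
  interpret R: function_ring_on supermedian_span "UNIV :: 'e set" by (rule function_ring_supermedian_span)
  fix e :: real assume e: "0 < e"
  obtain g where g: "g \<in> supermedian_span" "\<And>x. \<bar>f x - g x\<bar> < e / 4"
    using R.Stone_Weierstrass_basic[of f "e / 4"] f e by (auto simp: continuous_iff)
  obtain \<alpha> a b where ab: "0 \<le> \<alpha>" "supermedian \<alpha> a" "supermedian \<alpha> b" "g = (\<lambda>x. a x - b x)"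
    using g(1) by (rule supermedian_spanE)
  have b: "a \<in> bcontfun" "b \<in> bcontfun" using ab by (auto simp: supermedian_def)
  have gb: "g \<in> bcontfun" using b unfolding ab(4) by (auto simp: continuous_iff intro!: continuous_intros)
  obtain d1 where d1: "d1 > 0" "\<And>t x. 0 \<le> t \<Longrightarrow> t \<le> d1 \<Longrightarrow> \<bar>trans_op t a x - a x\<bar> \<le> e / 4"
    using supermedian_strongly_continuous[OF ab(2,1)] e unfolding strongly_continuous_def by (metis divide_pos_pos zero_less_numeral)
  obtain d2 where d2: "d2 > 0" "\<And>t x. 0 \<le> t \<Longrightarrow> t \<le> d2 \<Longrightarrow> \<bar>trans_op t b x - b x\<bar> \<le> e / 4"
    using supermedian_strongly_continuous[OF ab(3,1)] e unfolding strongly_continuous_def by (metis divide_pos_pos zero_less_numeral)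
  show "\<exists>d>0. \<forall>t x. 0 \<le> t \<longrightarrow> t \<le> d \<longrightarrow> \<bar>trans_op t f x - f x\<bar> \<le> e"
  proof (intro exI[of _ "min d1 d2"] conjI allI impI)
    fix t x assume t: "0 \<le> t" "t \<le> min d1 d2"
    have "\<bar>trans_op t f x - trans_op t g x\<bar> \<le> e / 4"
      using g(2) less_imp_le by (intro trans_op_diff_close[OF f gb t(1)]) blast
    moreover have "trans_op t g x = trans_op t a x - trans_op t b x"
      unfolding ab(4) by (rule trans_op_diff[OF b t(1)])
    moreover have "g x = a x - b x" by (simp add: ab(4))
    ultimately show "\<bar>trans_op t f x - f x\<bar> \<le> e"
      using g(2)[of x] d1(2)[of t x] d2(2)[of t x] t by linarith
  qed (use d1 d2 in auto)
qed

text \<open>A compact family of functions is approximated by finitely many of its members.\<close>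

lemma strongly_continuous_uniform:
  fixes k :: "'e \<Rightarrow> 'e \<Rightarrow> real"
  assumes k: "continuous_on UNIV (\<lambda>(x, z). k x z)" and e: "0 < e"
  shows "\<exists>d>0. \<forall>t x z. 0 \<le> t \<longrightarrow> t \<le> d \<longrightarrow> \<bar>trans_op t (\<lambda>y. k y z) x - k x z\<bar> \<le> e"
proof -
  have kb: "(\<lambda>y. k y z) \<in> bcontfun" for z
  proof -
    have "continuous_on UNIV (\<lambda>y. (y, z))" by (intro continuous_intros)
    from continuous_on_compose2[OF k this] show ?thesis by (simp add: continuous_iff)
  qed
  have "compact (UNIV :: ('e \<times> 'e) set)"
    using compact_Times[OF compact_state_space compact_state_space] by simp
  from compact_uniformly_continuous[OF k this]
  obtain r where r: "0 < r" "\<And>p q. dist p q < r \<Longrightarrow> dist (case p of (x, z) \<Rightarrow> k x z) (case q of (x, z) \<Rightarrow> k x z) < e / 4"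
    using e unfolding uniformly_continuous_on_def
    by (auto simp: dist_commute elim!: allE[of _ "e / 4"])
  obtain I where I: "finite I" "(UNIV :: 'e set) \<subseteq> (\<Union>z\<in>I. ball z r)"
  proof (rule compactE_image[OF compact_state_space, of UNIV "\<lambda>z. ball z r"])
    show "(UNIV :: 'e set) \<subseteq> (\<Union>z. ball z r)" using r(1) by auto
  qed (rule open_ball, rule that, assumption+)
  have "\<exists>d>0. \<forall>t x. 0 \<le> t \<longrightarrow> t \<le> d \<longrightarrow> \<bar>trans_op t (\<lambda>y. k y z) x - k x z\<bar> \<le> e / 4" for z
    by (rule strongly_continuous[OF kb, unfolded strongly_continuous_def, rule_format]) (use e in simp)
  then obtain d where d: "\<And>z. d z > 0"
    "\<And>z t x. 0 \<le> t \<Longrightarrow> t \<le> d z \<Longrightarrow> \<bar>trans_op t (\<lambda>y. k y z) x - k x z\<bar> \<le> e / 4"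
    by metis
  define m where "m = Min (insert 1 (d ` I))"
  have m: "0 < m" "\<And>z. z \<in> I \<Longrightarrow> m \<le> d z" using d(1) I(1) by (auto simp: m_def)
  show ?thesis
  proof (intro exI[of _ m] conjI allI impI m)
    fix t x z assume t: "0 \<le> t" "t \<le> m"
    obtain z' where z': "z' \<in> I" "dist z' z < r" using subsetD[OF I(2) UNIV_I, of z] by auto
    have close: "\<bar>k y z - k y z'\<bar> \<le> e / 4" for y
      using r(2)[of "(y, z)" "(y, z')"] z'(2)
      by (simp add: dist_Pair_Pair dist_commute dist_real_def abs_minus_commute)
    have "\<bar>trans_op t (\<lambda>y. k y z) x - trans_op t (\<lambda>y. k y z') x\<bar> \<le> e / 4"
      by (rule trans_op_diff_close[OF kb kb t(1) close])
    then show "\<bar>trans_op t (\<lambda>y. k y z) x - k x z\<bar> \<le> e"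
      using close[of x] d(2)[of t z' x] m(2)[OF z'(1)] t e by linarith
  qed
qed

end

section \<open>Controlled measures\<close>

lemma sets_PiM_mono:
  assumes "\<And>j. sets (A j) \<subseteq> sets (B j)" "\<And>j. space (A j) = space (B j)"
  shows "sets (Pi\<^sub>M I A) \<subseteq> sets (Pi\<^sub>M I B)"
proof -
  have "(\<lambda>\<omega>. \<omega>) \<in> Pi\<^sub>M I B \<rightarrow>\<^sub>M Pi\<^sub>M I A"
  proof (rule measurable_PiM_single)
    show "(\<lambda>\<omega>. \<omega>) \<in> space (Pi\<^sub>M I B) \<rightarrow> (\<Pi>\<^sub>E i\<in>I. space (A i))"
      by (simp add: space_PiM assms(2))
    fix S i assume "i \<in> I" "S \<in> sets (A i)"
    then show "{\<omega> \<in> space (Pi\<^sub>M I B). \<omega> i \<in> S} \<in> sets (Pi\<^sub>M I B)"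
      using measurable_sets[OF measurable_component_singleton[of i I B], of S] assms(1)[of i]
      by (auto simp: vimage_def Int_def conj_commute)
  qed
  from measurable_sets[OF this]
  have *: "S \<in> sets (Pi\<^sub>M I A) \<Longrightarrow> S \<inter> space (Pi\<^sub>M I B) \<in> sets (Pi\<^sub>M I B)" for S by (simp add: vimage_def)
  have "space (Pi\<^sub>M I A) = space (Pi\<^sub>M I B)" by (simp add: space_PiM assms(2))
  with * sets.sets_into_space show ?thesis
    by (metis Int_absorb2 subsetI)
qed

lemma sets_trivial_subset: "space M = \<Omega> \<Longrightarrow> sets (sigma \<Omega> {}) \<subseteq> sets M"
  using sigma_sets_empty_eq[of \<Omega>] sets.top[of M] by (auto simp: sets_measure_of)

lemma pred_mono_sets:
  "Measurable.pred A p \<Longrightarrow> sets A \<subseteq> sets B \<Longrightarrow> space A = space B \<Longrightarrow> Measurable.pred B p"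
  by (auto simp: pred_def)

lemma stopping_time_mono_filtration:
  assumes "stopping_time F T" "\<And>t. sets (F t) \<subseteq> sets (G t)" "\<And>t. space (F t) = space (G t)"
  shows "stopping_time G T"
  using assms by (intro stopping_timeI pred_mono_sets[OF stopping_timeD[OF assms(1)]])

lemma (in feller_process) space_copies_filtration: "space (copies_filtration N F i t) = space (copies N)"
  by (simp add: copies_filtration_def copies_def space_PiM space_F space_measure_of_conv if_distrib[of space]
      cong: if_cong)

locale controlled_system = feller_process N F X P
  for N :: "'w measure" and F :: "ennreal \<Rightarrow> 'w measure"
    and X :: "real \<Rightarrow> 'w \<Rightarrow> 'e::polish_space" and P :: "'e \<Rightarrow> 'w measure" +
  fixes V :: "('w, 'e) strategy" and x0 :: 'e and Q :: "(nat \<Rightarrow> 'w) measure"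
  assumes strategy: "V \<in> strategies N F"
    and controlled: "controlled_measure N F X P x0 V Q"
begin

abbreviation "start \<equiv> start_time V"
abbreviation "imp \<equiv> imp_time V"

lemma prob_space_Q: "prob_space Q" and sets_Q: "sets Q = sets (copies N)"
  using controlled by (auto simp: controlled_measure_def)

sublocale prob_space Q by (rule prob_space_Q)

lemma space_Q: "space Q = space (copies N)"
  by (rule sets_eq_imp_space_eq[OF sets_Q])

lemma space_copies: "space (copies N) = UNIV \<rightarrow>\<^sub>E space N"
  by (simp add: copies_def space_PiM)

lemma measurable_coordinate [measurable]: "(\<lambda>\<omega>. \<omega> i) \<in> Q \<rightarrow>\<^sub>M N"
proof -
  have "(\<lambda>\<omega>. \<omega> i) \<in> copies N \<rightarrow>\<^sub>M N" unfolding copies_def by simp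
  then show ?thesis using measurable_cong_sets[OF sets_Q refl] by blast
qed

lemma coordinate_in_space: "\<omega> \<in> space Q \<Longrightarrow> \<omega> i \<in> space N"
  by (auto simp: space_Q space_copies)

lemma space_past: "space (past_filtration N F i t) = space (copies N)"
  by (simp add: past_filtration_def space_PiM space_copies space_F space_measure_of_conv if_distrib[of space]
      cong: if_cong)

lemma filtration_past: "filtration (space (copies N)) (past_filtration N F i)"
proof
  fix s t :: ennreal assume "s \<le> t"
  then show "sets (past_filtration N F i s) \<subseteq> sets (past_filtration N F i t)"
    unfolding past_filtration_def
    by (intro sets_PiM_mono) (auto simp: space_F sets_F_mono dest: sets_F_mono[THEN subsetD])
qed (rule space_past)

lemma sets_past_subset: "sets (past_filtration N F i t) \<subseteq> sets Q"
  unfolding past_filtration_def sets_Q copies_def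
  using sets_F_subset sets_trivial_subset[of N "space N"]
  by (intro sets_PiM_mono) (auto simp: space_F space_measure_of_conv dest: subsetD)

text \<open>Strategies are adapted to \<open>copies_filtration\<close>, where all coordinates in use
  are known up to the same time, whereas the Markov property of coordinate i is stated for
  \<open>past_filtration\<close>, where the earlier coordinates are known entirely. Hence the times
  s and t are arbitrary for an earlier coordinate and ordered for coordinate i itself.\<close>

lemma sets_copies_filtration_subset:
  assumes "j < i \<or> j = i \<and> s \<le> t"
  shows "sets (copies_filtration N F j s) \<subseteq> sets (past_filtration N F i t)"
  unfolding past_filtration_def copies_filtration_def
proof (intro sets_PiM_mono)
  have "sets (sigma (space N) {}) \<subseteq> sets (F u)" for u by (rule sets_trivial_subset) (rule space_F)
  then show "sets (if k \<le> j then F s else sigma (space N) {})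
      \<subseteq> sets (if k < i then F \<infinity> else if k = i then F t else sigma (space N) {})" for k
    using assms sets_F_mono[of s \<infinity>] sets_F_mono[of s t] by auto
qed (auto simp: space_F space_measure_of_conv)

lemma stopping_time_imp_copies: "stopping_time (copies_filtration N F i) (imp i)"
  using strategy by (simp add: strategies_def)

lemma stopping_time_imp: "stopping_time (past_filtration N F i) (imp i)"
proof (rule stopping_time_mono_filtration[OF stopping_time_imp_copies])
  show "sets (copies_filtration N F i t) \<subseteq> sets (past_filtration N F i t)" for t
    by (rule sets_copies_filtration_subset) simp
qed (simp add: space_past space_copies_filtration)

text \<open>The starting time of coordinate i is determined by the earlier coordinates, so it is
  known from the outset, at every time t of the past filtration. This makes \<open>start i\<close> +
  t a stopping time.\<close>

lemma pred_start_le: "Measurable.pred (past_filtration N F i t) (\<lambda>\<omega>. start i \<omega> \<le> s)"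
proof (cases i)
  case (Suc j)
  have "Measurable.pred (past_filtration N F i t) (\<lambda>\<omega>. imp j \<omega> \<le> s)"
  proof (rule pred_mono_sets[OF stopping_timeD[OF stopping_time_imp_copies]])
    show "sets (copies_filtration N F j s) \<subseteq> sets (past_filtration N F i t)"
      by (rule sets_copies_filtration_subset) (simp add: Suc)
  qed (simp add: space_past space_copies_filtration)
  then show ?thesis
    by (simp add: Suc start_time_def)
qed (simp add: start_time_def)

lemma measurable_start_past: "start i \<in> past_filtration N F i t \<rightarrow>\<^sub>M borel"
  using pred_start_le by (intro borel_measurableI_le) (auto simp: pred_def)

lemma stopping_time_start_add: "stopping_time (past_filtration N F i) (\<lambda>\<omega>. start i \<omega> + ennreal t)"
proof
  fix s
  note [measurable] = measurable_start_past[of i s]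
  show "Measurable.pred (past_filtration N F i s) (\<lambda>\<omega>. start i \<omega> + ennreal t \<le> s)"
    by measurable
qed

lemma measurable_imp [measurable]: "imp i \<in> borel_measurable Q"
  using sets_past_subset[of i] space_Q space_past
  by (intro measurable_stopping_time[OF stopping_time_imp]) auto

lemma measurable_start [measurable]: "start i \<in> borel_measurable Q"
  by (cases i) (auto simp: start_time_def[abs_def])

lemma start_Suc: "start (Suc i) = imp i"
  by (simp add: start_time_def[abs_def])

lemma start_0: "start 0 \<omega> = 0"
  by (simp add: start_time_def)

lemma start_le_imp: "\<omega> \<in> space Q \<Longrightarrow> start i \<omega> \<le> imp i \<omega>"
  using strategy by (cases i) (auto simp: start_time_def strategies_def space_Q)

lemma measurable_X_time [measurable]:
  "T \<in> M \<rightarrow>\<^sub>M borel \<Longrightarrow> f \<in> M \<rightarrow>\<^sub>M Q \<Longrightarrow> (\<lambda>z. X (max 0 (T z)) (f z i)) \<in> M \<rightarrow>\<^sub>M borel"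
  by (rule measurable_X_random) (auto intro: measurable_compose[OF _ measurable_coordinate])

text \<open>The Markov property at \<open>start i\<close> + t on the event that coordinate i is
  still in use then. This event is known at that time since \<open>imp i\<close> is a stopping time
  of the past filtration; the later time may well exceed the impulse time, as the coordinate goes on
  evolving without control.\<close>

lemma markov_start:
  assumes f: "f \<in> bcontfun" and t: "0 \<le> t" and r: "0 \<le> r"
    and h: "h \<in> borel_measurable borel" "\<And>s. 0 \<le> h s" "\<And>s. h s \<le> 1"
  shows "(\<integral>\<omega>. (if start i \<omega> + ennreal t < imp i \<omega> then h (enn2real (start i \<omega>)) else 0)
           * f (X (enn2real (start i \<omega>) + t + r) (\<omega> i)) \<partial>Q)
    = (\<integral>\<omega>. (if start i \<omega> + ennreal t < imp i \<omega> then h (enn2real (start i \<omega>)) else 0)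
           * trans_op r f (X (enn2real (start i \<omega>) + t) (\<omega> i)) \<partial>Q)"
proof -
  interpret past: filtration "space (copies N)" "past_filtration N F i" by (rule filtration_past)
  let ?T = "\<lambda>\<omega>. start i \<omega> + ennreal t"
  define G where "G = past.pre_sigma ?T"
  define Z where "Z \<omega> = (if start i \<omega> + ennreal t < imp i \<omega> then h (enn2real (start i \<omega>)) else 0)" for \<omega>
  define D where "D = {\<omega> \<in> space Q. start i \<omega> < \<infinity>}"
  note st = stopping_time_start_add[of i t]
  have spG: "space G = space Q" by (simp add: G_def past.space_pre_sigma space_Q)
  have GQ: "sets G \<subseteq> sets Q"
  proof
    fix A assume "A \<in> sets G"
    then have "{\<omega>\<in>A. ?T \<omega> \<le> \<infinity>} \<in> sets (past_filtration N F i \<infinity>)"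
      unfolding G_def by (rule past.sets_pre_sigmaD[OF st])
    then show "A \<in> sets Q" using sets_past_subset[of i \<infinity>] by auto
  qed
  have sG[measurable]: "start i \<in> G \<rightarrow>\<^sub>M borel"
  proof (rule borel_measurableI_le)
    fix s
    have "Measurable.pred (past.pre_sigma ?T) (\<lambda>\<omega>. start i \<omega> \<le> s)"
    proof (rule past.pred_pre_sigmaI[OF st])
      fix u show "Measurable.pred (past_filtration N F i u) (\<lambda>\<omega>. start i \<omega> \<le> s \<and> ?T \<omega> \<le> u)"
        using pred_start_le[of i s u] stopping_timeD[OF st, of u] by (rule pred_intros_logic)
    qed
    then show "{\<omega> \<in> space G. start i \<omega> \<le> s} \<in> sets G" by (simp add: pred_def G_def)
  qed
  have [measurable]: "Measurable.pred G (\<lambda>\<omega>. ?T \<omega> < imp i \<omega>)"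
    unfolding G_def by (rule past.stopping_time_less[OF st stopping_time_imp])
  note h(1)[measurable]
  have ZG: "Z \<in> borel_measurable G" unfolding Z_def[abs_def] by measurable
  have eqX: "(\<lambda>\<omega>. X (max 0 (enn2real (start i \<omega>) + u)) (\<omega> i)) = (\<lambda>\<omega>. X (enn2real (start i \<omega>) + u) (\<omega> i))"
    if "0 \<le> u" for u using that by (intro ext) (simp add: max_def)
  have mX: "(\<lambda>\<omega>. X (enn2real (start i \<omega>) + u) (\<omega> i)) \<in> Q \<rightarrow>\<^sub>M borel" if "0 \<le> u" for u
    unfolding eqX[OF that, symmetric] by measurable
  have D: "D \<in> sets Q" unfolding D_def by measurable
  have main: "(\<integral>\<omega>. Z \<omega> * (indicator D \<omega> * f (X (enn2real (start i \<omega>) + t + r) (\<omega> i))) \<partial>Q)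
    = (\<integral>\<omega>. Z \<omega> * (indicator D \<omega> * trans_op r f (X (enn2real (start i \<omega>) + t) (\<omega> i))) \<partial>Q)"
  proof (rule markov_integral[OF prob_space_Q GQ spG _ _ r _ D ZG _ _ f, where K = 1])
    fix A and B :: "'e set" assume A: "A \<in> sets G" and B: "B \<in> sets borel"
    have "A \<subseteq> space Q" using A GQ sets.sets_into_space by blast
    then have "{\<omega> \<in> A. start i \<omega> < \<infinity>} = {\<omega> \<in> A. \<omega> \<in> D}"
      "{\<omega> \<in> A. start i \<omega> < \<infinity> \<and> X (enn2real (start i \<omega>) + t + r) (\<omega> i) \<in> B}
        = {\<omega> \<in> A. \<omega> \<in> D \<and> X (enn2real (start i \<omega>) + t + r) (\<omega> i) \<in> B}"
      by (auto simp: D_def)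
    moreover have "measure Q {\<omega> \<in> A. start i \<omega> < \<infinity> \<and> X (enn2real (start i \<omega>) + t + r) (\<omega> i) \<in> B}
      = (\<integral>\<omega>. indicator {\<omega> \<in> A. start i \<omega> < \<infinity>} \<omega> * trans_prob P X r (X (enn2real (start i \<omega>) + t) (\<omega> i)) B \<partial>Q)"
      using controlled A B t r unfolding controlled_measure_def G_def by blast
    ultimately show "measure Q {\<omega> \<in> A. \<omega> \<in> D \<and> X (enn2real (start i \<omega>) + t + r) (\<omega> i) \<in> B}
      = (\<integral>\<omega>. indicator {\<omega> \<in> A. \<omega> \<in> D} \<omega> * trans_prob P X r (X (enn2real (start i \<omega>) + t) (\<omega> i)) B \<partial>Q)"
      by simp
  next
    show "(\<lambda>\<omega>. X (enn2real (start i \<omega>) + t) (\<omega> i)) \<in> Q \<rightarrow>\<^sub>M borel" by (rule mX[OF t])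
    show "(\<lambda>\<omega>. X (enn2real (start i \<omega>) + t + r) (\<omega> i)) \<in> Q \<rightarrow>\<^sub>M borel"
      using mX[of "t + r"] t r by (simp add: add.assoc)
    show "0 \<le> Z \<omega>" "Z \<omega> \<le> 1" for \<omega> using h by (auto simp: Z_def)
  qed
  \<comment> \<open>Where Z does not vanish, a sum containing \<open>start i\<close> is strictly
    below \<open>imp i\<close>, so \<open>start i\<close> is finite and the indicator of D is
    1.\<close>
  have ZD: "Z \<omega> * (indicator D \<omega> * u) = Z \<omega> * u" if "\<omega> \<in> space Q" for \<omega> u
    using that by (auto simp: Z_def D_def indicator_def top.not_eq_extremum[symmetric])
  have "(\<integral>\<omega>. Z \<omega> * f (X (enn2real (start i \<omega>) + t + r) (\<omega> i)) \<partial>Q)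
    = (\<integral>\<omega>. Z \<omega> * trans_op r f (X (enn2real (start i \<omega>) + t) (\<omega> i)) \<partial>Q)"
    using main by (simp add: ZD cong: Bochner_Integration.integral_cong)
  then show ?thesis by (simp add: Z_def)
qed

end

section \<open>Weights and skeletons\<close>

text \<open>The instances are the discount factor cut off at T and its version rounded to the grid.
  Bounded support makes all sums along a skeleton finite.\<close>

locale weight =
  fixes b :: "real \<Rightarrow> real"
  assumes b_antimono: "antimono b"
    and b_nonneg: "0 \<le> b s" and b_le_1: "b s \<le> 1"
    and b_support: "\<exists>T. \<forall>s>T. b s = 0"
begin

lemma b_mono: "s \<le> t \<Longrightarrow> b t \<le> b s"
  using b_antimono by (auto dest: antimonoD)

lemma measurable_b [measurable]: "b \<in> borel_measurable borel"
proof -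
  have "mono (\<lambda>s. - b s)" using b_mono by (auto intro: monoI)
  then have "(\<lambda>s. - (- b s)) \<in> borel_measurable borel"
    by (intro borel_measurable_uminus borel_measurable_mono)
  then show ?thesis by simp
qed

text \<open>The value 0 at infinity makes an impulse that never happens contribute nothing.\<close>

definition wt :: "ennreal \<Rightarrow> real"
  where "wt t = (if t < \<infinity> then b (enn2real t) else 0)"

lemma wt_nonneg: "0 \<le> wt t" and wt_le_1: "wt t \<le> 1"
  by (auto simp: wt_def b_nonneg b_le_1)

lemma wt_mono: "s \<le> t \<Longrightarrow> wt t \<le> wt s"
  by (auto simp: wt_def b_nonneg enn2real_mono less_top[symmetric] top_unique intro!: b_mono)

lemma wt_ennreal: "0 \<le> s \<Longrightarrow> wt (ennreal s) = b s"
  by (simp add: wt_def)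

lemma measurable_wt [measurable]: "wt \<in> borel_measurable borel"
  unfolding wt_def[abs_def] by measurable

definition skel :: "real \<Rightarrow> real \<Rightarrow> ennreal \<Rightarrow> nat \<Rightarrow> real"
  where "skel s e \<tau> k = (if ennreal (s + real k * e) < \<tau> then b (s + real k * e) else 0)"

lemma skel_nonneg: "0 \<le> skel s e \<tau> k" and skel_le_1: "skel s e \<tau> k \<le> 1"
  by (auto simp: skel_def b_nonneg b_le_1)

lemma skel_decreasing:
  assumes "0 \<le> e" shows "skel s e \<tau> (Suc k) \<le> skel s e \<tau> k"
proof -
  have *: "s + real k * e \<le> s + real (Suc k) * e" using assms by (simp add: algebra_simps)
  from ennreal_leI[OF this] show ?thesis
    using b_mono[OF *] by (auto simp: skel_def b_nonneg dest: le_less_trans simp del: of_nat_Suc)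
qed

lemma skel_0_le: "skel s e \<tau> 0 \<le> b s"
  by (simp add: skel_def b_nonneg)

text \<open>
  \<open>skel\<close> weighs the points of the skeleton \<open>s, s + e, s + 2 e, \<dots>\<close> that lie before \<open>\<tau>\<close>; its
  decrements weigh the skeleton stopped at the first point from \<open>\<tau>\<close> on.
\<close>

lemma skel_decrement_lower:
  assumes s: "0 \<le> s" and e: "0 < e" and \<tau>: "ennreal s \<le> \<tau>" and L: "b (s + real L * e) = 0"
    and \<psi>: "\<And>k. 0 \<le> \<psi> k"
  shows "wt \<tau> * \<psi> (nat \<lceil>(enn2real \<tau> - s) / e\<rceil>)
    \<le> (\<Sum>k<L. (skel s e \<tau> k - skel s e \<tau> (Suc k)) * \<psi> (Suc k)) + (b s - skel s e \<tau> 0) * \<psi> 0"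
proof -
  have nn: "0 \<le> (skel s e \<tau> k - skel s e \<tau> (Suc k)) * \<psi> (Suc k)" for k
    using skel_decreasing[of e s \<tau> k] e \<psi> by simp
  have nns: "0 \<le> (\<Sum>k<L. (skel s e \<tau> k - skel s e \<tau> (Suc k)) * \<psi> (Suc k))"
    using nn by (intro sum_nonneg) auto
  have nn0: "0 \<le> (b s - skel s e \<tau> 0) * \<psi> 0"
    using skel_0_le \<psi> by simp
  show ?thesis
  proof (cases "wt \<tau> = 0")
    case True
    then show ?thesis using nns nn0 by simp
  next
    case False
    then obtain t where t: "\<tau> = ennreal t" "0 \<le> t" "wt \<tau> = b t"
      by (cases \<tau>) (auto simp: wt_def split: if_splits)
    have st: "s \<le> t" using \<tau> t s by simp
    define \<kappa> where "\<kappa> = nat \<lceil>(t - s) / e\<rceil>"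
    show ?thesis
    proof (cases \<kappa>)
      \<comment> \<open>The impulse falls on the starting time: no skeleton point precedes \<tau>,
        so \<open>skel\<close> vanishes from the start and the extra term with \<psi> 0 carries the
        full weight.\<close>
      case 0
      then have "(t - s) / e \<le> 0" by (simp add: \<kappa>_def)
      then have "t = s" using st e by (simp add: divide_le_0_iff)
      then show ?thesis
        using nns t s by (simp add: skel_def)
    next
      case (Suc k)
      have cl: "0 < \<lceil>(t - s) / e\<rceil>" using Suc unfolding \<kappa>_def by linarith
      have rk: "real \<kappa> = real_of_int \<lceil>(t - s) / e\<rceil>" using cl by (simp add: \<kappa>_def)
      have "(t - s) / e \<le> real \<kappa>" unfolding rk by linarith
      then have up: "t \<le> s + real (Suc k) * e" using e by (simp add: Suc field_simps)
      have "real \<kappa> - 1 < (t - s) / e" unfolding rk by linarith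
      then have lo: "s + real k * e < t" using e by (simp add: Suc field_simps)
      have "k < L"
      proof (rule ccontr)
        assume "\<not> k < L"
        then have "s + real L * e \<le> t" using lo e by (smt (verit) mult_right_mono not_less of_nat_le_iff)
        then have "b t \<le> 0" using b_mono L by metis
        then show False using False t b_nonneg[of t] by simp
      qed
      have z: "skel s e \<tau> k = b (s + real k * e)"
      proof -
        have "0 \<le> real k * e" using e by simp
        then have "0 < t" using lo s by linarith
        then have "ennreal (s + real k * e) < ennreal t" using lo by (rule ennreal_lessI)
        then show ?thesis unfolding skel_def t(1) by (rule if_P)
      qed
      have z': "skel s e \<tau> (Suc k) = 0"
      proof -
        have "\<not> ennreal (s + real (Suc k) * e) < ennreal t" using ennreal_leI[OF up] by (simp only: not_less)
        then show ?thesis unfolding skel_def t(1) by (rule if_not_P)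
      qed
      \<comment> \<open>The single nonvanishing drop to 0 happens between the last skeleton point
        before \<tau> and the next one; it is the weight at the former, hence at least the weight at
        \<tau>.\<close>
      have "wt \<tau> * \<psi> (Suc k) \<le> (skel s e \<tau> k - skel s e \<tau> (Suc k)) * \<psi> (Suc k)"
        unfolding z z' t(3) using b_mono[of "s + real k * e" t] lo \<psi> by (intro mult_right_mono) auto
      also have "\<dots> \<le> (\<Sum>k<L. (skel s e \<tau> k - skel s e \<tau> (Suc k)) * \<psi> (Suc k))"
        using \<open>k < L\<close> nn by (intro member_le_sum) auto
      finally show ?thesis
        using nn0 t Suc by (simp add: \<kappa>_def)
    qed
  qed
qed

text \<open>The lower bound for C - \<phi> in place of \<phi>: with constant values the decrements
  and the extra term telescope to b s.\<close>

lemma skel_decrement_upper: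
  assumes s: "0 \<le> s" and e: "0 < e" and \<tau>: "ennreal s \<le> \<tau>" and L: "b (s + real L * e) = 0"
    and \<phi>: "\<And>k. 0 \<le> \<phi> k" "\<And>k. \<phi> k \<le> C"
  shows "(\<Sum>k<L. (skel s e \<tau> k - skel s e \<tau> (Suc k)) * \<phi> (Suc k)) + (b s - skel s e \<tau> 0) * \<phi> 0
    \<le> C * (b s - wt \<tau>) + wt \<tau> * \<phi> (nat \<lceil>(enn2real \<tau> - s) / e\<rceil>)"
proof -
  let ?Z = "skel s e \<tau>"
  have ZL: "?Z L = 0" using L by (simp add: skel_def)
  have "(\<Sum>k<L. (?Z k - ?Z (Suc k)) * (C - \<phi> (Suc k)))
      = C * (\<Sum>k<L. ?Z k - ?Z (Suc k)) - (\<Sum>k<L. (?Z k - ?Z (Suc k)) * \<phi> (Suc k))"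
    by (simp add: sum_distrib_left sum_subtractf[symmetric] algebra_simps)
  also have "(\<Sum>k<L. ?Z k - ?Z (Suc k)) = ?Z 0"
    by (simp add: sum_lessThan_telescope' ZL)
  finally show ?thesis
    using skel_decrement_lower[OF s e \<tau> L, of "\<lambda>k. C - \<phi> k"] \<phi>(2) by (simp add: algebra_simps)
qed

lemma integrable_bounded_support:
  fixes f :: "real \<Rightarrow> real"
  assumes "f \<in> borel_measurable borel" "\<And>u. \<bar>f u\<bar> \<le> B * indicator {a..c} u"
  shows "integrable lborel f"
proof (rule Bochner_Integration.integrable_bound)
  show "integrable lborel (\<lambda>u. B * indicator {a..c} u :: real)"
    by (intro integrable_mult_right integrable_real_indicator) (auto simp: emeasure_lborel_Icc_eq)
  show "AE u in lborel. norm (f u) \<le> norm (B * indicator {a..c} u :: real)"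
  proof (intro AE_I2)
    show "norm (f u) \<le> norm (B * indicator {a..c} u :: real)" for u
      using assms(2)[of u] by simp
  qed
qed (use assms(1) in simp)

lemma indicator_cells:
  assumes "0 \<le> (e::real)"
  shows "(\<Sum>k<L. indicator {s + real k * e..<s + real (Suc k) * e} u) = (indicator {s..<s + real L * e} u :: real)"
proof (induction L)
  case (Suc L)
  have "s + real L * e \<le> s + real (Suc L) * e" "s \<le> s + real L * e"
    using assms by (auto simp: algebra_simps)
  then show ?case
    using Suc by (auto simp: indicator_def simp del: of_nat_Suc)
qed simp

text \<open>On a cell the running weight stays between two consecutive values of
  \<open>skel\<close>. The error there is at most G e times their difference, and these differences
  telescope; so the total error is G e, no matter how many cells the support of the weight
  contains.\<close>

lemma skel_integral:
  fixes y :: "real \<Rightarrow> real" and \<tau> :: ennreal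
  assumes s: "0 \<le> s" and e: "0 < e" and L: "b (s + real L * e) = 0"
    and y[measurable]: "y \<in> borel_measurable borel" and G: "\<And>u. \<bar>y u\<bar> \<le> G"
  defines "bt \<equiv> \<lambda>u. if s \<le> u \<and> ennreal u < \<tau> then b u else 0"
  shows "(\<integral>u. bt u * y u \<partial>lborel)
      = (\<Sum>k<L. \<integral>r. indicator {0..<e} r * (bt (s + real k * e + r) * y (s + real k * e + r)) \<partial>lborel)"
    and "\<bar>(\<Sum>k<L. skel s e \<tau> k * (\<integral>r. indicator {0..<e} r * y (s + real k * e + r) \<partial>lborel))
      - (\<integral>u. bt u * y u \<partial>lborel)\<bar> \<le> G * e"
proof -
  have [measurable]: "bt \<in> borel_measurable borel" unfolding bt_def by measurable
  have bt: "0 \<le> bt u" "bt u \<le> 1" for u by (auto simp: bt_def b_nonneg b_le_1)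
  have G0: "0 \<le> G" using G[of 0] by linarith
  let ?c = "\<lambda>k. {s + real k * e..<s + real (Suc k) * e}"
  have bty: "\<bar>bt u * y u\<bar> \<le> G" for u
    using mult_mono[OF bt(2)[of u] G[of u]] bt(1)[of u] by (simp add: abs_mult)
  have int: "integrable lborel (\<lambda>u. indicator (?c k) u * (bt u * y u))" for k
    by (rule integrable_bounded_support[of _ G "s + real k * e" "s + real (Suc k) * e"])
       (use bty G0 in \<open>auto simp: indicator_def simp del: of_nat_Suc\<close>)
  have cells: "bt u * y u = (\<Sum>k<L. indicator (?c k) u * (bt u * y u))" for u
  proof -
    have "bt u * y u = indicator {s..<s + real L * e} u * (bt u * y u)"
      using b_mono[of "s + real L * e" u] L b_nonneg[of u] by (auto simp: indicator_def bt_def)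
    then show ?thesis
      using e by (simp only: sum_distrib_right[symmetric] indicator_cells)
  qed
  have "(\<integral>u. bt u * y u \<partial>lborel) = (\<Sum>k<L. \<integral>u. indicator (?c k) u * (bt u * y u) \<partial>lborel)"
    by (subst cells) (rule Bochner_Integration.integral_sum[OF int])
  also have "\<dots> = (\<Sum>k<L. \<integral>r. indicator {0..<e} r * (bt (s + real k * e + r) * y (s + real k * e + r)) \<partial>lborel)"
  proof (intro sum.cong refl)
    fix k
    have "indicator (?c k) (s + real k * e + r) = (indicator {0..<e} r :: real)" for r
      by (auto simp: indicator_def algebra_simps)
    then show "(\<integral>u. indicator (?c k) u * (bt u * y u) \<partial>lborel)
        = (\<integral>r. indicator {0..<e} r * (bt (s + real k * e + r) * y (s + real k * e + r)) \<partial>lborel)"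
      by (subst lborel_integral_real_affine[where c = 1 and t = "s + real k * e"]) (auto simp del: of_nat_Suc)
  qed
  finally show eq: "(\<integral>u. bt u * y u \<partial>lborel)
      = (\<Sum>k<L. \<integral>r. indicator {0..<e} r * (bt (s + real k * e + r) * y (s + real k * e + r)) \<partial>lborel)" .
  let ?Z = "skel s e \<tau>"
  have step: "\<bar>?Z k * (\<integral>r. indicator {0..<e} r * y (s + real k * e + r) \<partial>lborel)
      - (\<integral>r. indicator {0..<e} r * (bt (s + real k * e + r) * y (s + real k * e + r)) \<partial>lborel)\<bar>
    \<le> G * e * (?Z k - ?Z (Suc k))" for k
  proof -
    let ?u = "\<lambda>r. s + real k * e + r"
    have i1: "integrable lborel (\<lambda>r. ?Z k * (indicator {0..<e} r * y (?u r)))"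
      by (intro integrable_mult_right integrable_bounded_support[of _ G 0 e])
         (use G G0 in \<open>auto simp: indicator_def\<close>)
    have i2: "integrable lborel (\<lambda>r. indicator {0..<e} r * (bt (?u r) * y (?u r)))"
      by (intro integrable_bounded_support[of _ G 0 e]) (use bty G0 in \<open>auto simp: indicator_def\<close>)
    have i3: "integrable lborel (\<lambda>r. indicator {0..<e} r * (G * (?Z k - ?Z (Suc k))) :: real)"
      using e by (intro integrable_mult_left integrable_real_indicator) auto
    have "\<bar>?Z k * (\<integral>r. indicator {0..<e} r * y (?u r) \<partial>lborel)
      - (\<integral>r. indicator {0..<e} r * (bt (?u r) * y (?u r)) \<partial>lborel)\<bar>
      = \<bar>\<integral>r. ?Z k * (indicator {0..<e} r * y (?u r)) - indicator {0..<e} r * (bt (?u r) * y (?u r)) \<partial>lborel\<bar>"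
      using Bochner_Integration.integral_diff[OF i1 i2] by simp
    also have "\<dots> \<le> (\<integral>r. \<bar>?Z k * (indicator {0..<e} r * y (?u r)) - indicator {0..<e} r * (bt (?u r) * y (?u r))\<bar> \<partial>lborel)"
      by (rule integral_abs_bound)
    also have "\<dots> \<le> (\<integral>r. indicator {0..<e} r * (G * (?Z k - ?Z (Suc k))) \<partial>lborel)"
    proof (rule integral_mono[OF integrable_abs[OF Bochner_Integration.integrable_diff[OF i1 i2]] i3])
      fix r
      show "\<bar>?Z k * (indicator {0..<e} r * y (?u r)) - indicator {0..<e} r * (bt (?u r) * y (?u r))\<bar>
          \<le> indicator {0..<e} r * (G * (?Z k - ?Z (Suc k)))"
      proof (cases "r \<in> {0..<e}")
        case True
        have up: "bt (?u r) \<le> ?Z k"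
        proof (cases "ennreal (?u r) < \<tau>")
          case lt: True
          have "ennreal (s + real k * e) \<le> ennreal (?u r)" using True by (intro ennreal_leI) simp
          then have "ennreal (s + real k * e) < \<tau>" using lt by (rule le_less_trans)
          then show ?thesis
            using b_mono[of "s + real k * e" "?u r"] True by (auto simp: bt_def skel_def b_nonneg)
        qed (simp add: bt_def skel_nonneg)
        have lo: "?Z (Suc k) \<le> bt (?u r)"
        proof (cases "ennreal (s + real (Suc k) * e) < \<tau>")
          case lt: True
          have *: "?u r \<le> s + real (Suc k) * e" using True by (simp add: algebra_simps)
          from ennreal_leI[OF this] have "ennreal (?u r) < \<tau>" using lt by (rule le_less_trans)
          moreover have "s \<le> ?u r" using True e by simp
          ultimately show ?thesis
            using b_mono[OF *] lt by (auto simp: bt_def skel_def simp del: of_nat_Suc)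
        qed (simp add: bt skel_def del: of_nat_Suc)
        have "\<bar>?Z k * y (?u r) - bt (?u r) * y (?u r)\<bar> = (?Z k - bt (?u r)) * \<bar>y (?u r)\<bar>"
          using up by (simp add: left_diff_distrib[symmetric] abs_mult)
        also have "\<dots> \<le> (?Z k - ?Z (Suc k)) * G"
          using up lo G by (intro mult_mono) auto
        finally show ?thesis using True by (simp add: mult.commute)
      qed simp
    qed
    also have "\<dots> = G * e * (?Z k - ?Z (Suc k))"
      using e by simp
    finally show ?thesis .
  qed
  have "\<bar>(\<Sum>k<L. ?Z k * (\<integral>r. indicator {0..<e} r * y (s + real k * e + r) \<partial>lborel)) - (\<integral>u. bt u * y u \<partial>lborel)\<bar>
      \<le> (\<Sum>k<L. G * e * (?Z k - ?Z (Suc k)))"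
    unfolding eq sum_subtractf[symmetric] by (intro order_trans[OF sum_abs] sum_mono step)
  also have "\<dots> = G * e * (?Z 0 - ?Z L)"
    by (simp add: sum_distrib_left[symmetric] sum_lessThan_telescope')
  also have "\<dots> \<le> G * e * 1"
    using G0 e skel_le_1[of s e \<tau> 0] skel_nonneg[of s e \<tau> L] by (intro mult_left_mono) auto
  finally show "\<bar>(\<Sum>k<L. ?Z k * (\<integral>r. indicator {0..<e} r * y (s + real k * e + r) \<partial>lborel)) - (\<integral>u. bt u * y u \<partial>lborel)\<bar> \<le> G * e"
    by simp
qed

end

section \<open>Dynkin's formula\<close>

locale weighted_process = controlled_system N F X P V x0 Q + weight b
  for N :: "'w measure" and F :: "ennreal \<Rightarrow> 'w measure"
    and X :: "real \<Rightarrow> 'w \<Rightarrow> 'e::polish_space" and P :: "'e \<Rightarrow> 'w measure"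
    and V :: "('w, 'e) strategy" and x0 :: 'e and Q :: "(nat \<Rightarrow> 'w) measure"
    and b :: "real \<Rightarrow> real"
begin

text \<open>
  The \<open>max 0\<close> here and below only serves measurability, as \<open>X\<close> is unconstrained at negative times.
\<close>

definition pos :: "nat \<Rightarrow> real \<Rightarrow> nat \<Rightarrow> (nat \<Rightarrow> 'w) \<Rightarrow> 'e"
  where "pos i e k \<omega> = X (max 0 (enn2real (start i \<omega>) + real k * e)) (\<omega> i)"

definition Z :: "nat \<Rightarrow> real \<Rightarrow> nat \<Rightarrow> (nat \<Rightarrow> 'w) \<Rightarrow> real"
  where "Z i e k \<omega> = (if start i \<omega> + ennreal (real k * e) < imp i \<omega>
    then b (enn2real (start i \<omega>) + real k * e) else 0)"

text \<open>Position at the first skeleton point from the impulse on, where coordinate i is still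
  governed by the uncontrolled dynamics. For an infinite impulse time the index is a dummy, masked
  by the factor \<open>wt (imp i \<omega>)\<close>, which is then 0.\<close>

definition stopped_pos :: "nat \<Rightarrow> real \<Rightarrow> (nat \<Rightarrow> 'w) \<Rightarrow> 'e"
  where "stopped_pos i e \<omega> = pos i e (nat \<lceil>(enn2real (imp i \<omega>) - enn2real (start i \<omega>)) / e\<rceil>) \<omega>"

lemma measurable_pos [measurable]: "pos i e k \<in> Q \<rightarrow>\<^sub>M borel"
  unfolding pos_def[abs_def] by measurable

lemma measurable_stopped_pos [measurable]: "stopped_pos i e \<in> Q \<rightarrow>\<^sub>M borel"
  unfolding stopped_pos_def[abs_def]
  by (rule measurable_compose_countable[where f = "\<lambda>k \<omega>. pos i e k \<omega>"
        and g = "\<lambda>\<omega>. nat \<lceil>(enn2real (imp i \<omega>) - enn2real (start i \<omega>)) / e\<rceil>"]) measurable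

lemma measurable_Z [measurable]: "Z i e k \<in> borel_measurable Q"
  unfolding Z_def[abs_def] by measurable

lemma Z_nonneg: "0 \<le> Z i e k \<omega>" and Z_le_1: "Z i e k \<omega> \<le> 1"
  by (auto simp: Z_def b_nonneg b_le_1)

lemma Z_infinite: "start i \<omega> = \<infinity> \<Longrightarrow> Z i e k \<omega> = 0"
  by (simp add: Z_def)

lemma Z_skel:
  assumes "start i \<omega> < \<infinity>" "0 \<le> e"
  shows "Z i e k \<omega> = skel (enn2real (start i \<omega>)) e (imp i \<omega>) k"
proof -
  have "start i \<omega> + ennreal (real k * e) = ennreal (enn2real (start i \<omega>) + real k * e)"
    using assms by (subst ennreal_plus) (auto simp: less_top)
  then show ?thesis by (simp add: Z_def skel_def)
qed

lemma integrable_bounded: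
  fixes f :: "_ \<Rightarrow> real"
  assumes "f \<in> borel_measurable Q" "\<And>\<omega>. \<omega> \<in> space Q \<Longrightarrow> \<bar>f \<omega>\<bar> \<le> B"
  shows "integrable Q f"
  using assms by (intro integrable_const_bound[of _ B]) auto

lemma integrable_weighted:
  assumes "f \<in> bcontfun" and "\<zeta> \<in> Q \<rightarrow>\<^sub>M borel" and "z \<in> borel_measurable Q" "\<And>\<omega>. \<bar>z \<omega>\<bar> \<le> K"
  shows "integrable Q (\<lambda>\<omega>. z \<omega> * f (\<zeta> \<omega>) :: real)"
proof -
  obtain B where B: "0 \<le> B" "\<And>x. \<bar>f x\<bar> \<le> B" using bcontfun_bound[OF assms(1)] by blast
  note [measurable] = assms(2,3) bcontfun_borel[OF assms(1)]
  show ?thesis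
  proof (rule integrable_bounded[of _ "K * B"])
    show "\<bar>z \<omega> * f (\<zeta> \<omega>)\<bar> \<le> K * B" for \<omega>
      using assms(4)[of \<omega>] B by (auto simp: abs_mult intro!: mult_mono)
  qed measurable
qed

lemma integrable_Z: "f \<in> bcontfun \<Longrightarrow> \<zeta> \<in> Q \<rightarrow>\<^sub>M borel \<Longrightarrow> integrable Q (\<lambda>\<omega>. Z i e k \<omega> * f (\<zeta> \<omega>) :: real)"
  by (rule integrable_weighted[where K = 1]) (auto simp: Z_nonneg Z_le_1)

lemma integrable_wt:
  "f \<in> bcontfun \<Longrightarrow> \<zeta> \<in> Q \<rightarrow>\<^sub>M borel \<Longrightarrow> T \<in> borel_measurable Q \<Longrightarrow> integrable Q (\<lambda>\<omega>. wt (T \<omega>) * f (\<zeta> \<omega>) :: real)"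
  by (rule integrable_weighted[where K = 1]) (auto simp: wt_nonneg wt_le_1)

lemma integrable_wt1: "T \<in> borel_measurable Q \<Longrightarrow> integrable Q (\<lambda>\<omega>. wt (T \<omega>))"
  by (rule integrable_bounded[where B = 1]) (auto simp: wt_nonneg wt_le_1)

lemma expectation_Z:
  assumes f: "f \<in> bcontfun" and e: "0 \<le> e" and r: "0 \<le> r"
  shows "expectation (\<lambda>\<omega>. Z i e k \<omega> * f (X (max 0 (enn2real (start i \<omega>) + real k * e + r)) (\<omega> i)))
    = expectation (\<lambda>\<omega>. Z i e k \<omega> * trans_op r f (pos i e k \<omega>))"
proof -
  have "0 \<le> enn2real (start i \<omega>) + real k * e" for \<omega> using e by simp
  then have "X (max 0 (enn2real (start i \<omega>) + real k * e + r)) = X (enn2real (start i \<omega>) + real k * e + r)"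
    "X (max 0 (enn2real (start i \<omega>) + real k * e)) = X (enn2real (start i \<omega>) + real k * e)" for \<omega>
    using r by (auto simp: max_def)
  moreover have "(\<lambda>s. b (s + real k * e)) \<in> borel_measurable borel" by measurable
  ultimately show ?thesis
    using markov_start[OF f _ r, of "real k * e" "\<lambda>s. b (s + real k * e)" i] e b_nonneg b_le_1
    by (simp add: Z_def pos_def)
qed

lemma expectation_Z_step:
  assumes f: "f \<in> bcontfun" and e: "0 \<le> e"
  shows "expectation (\<lambda>\<omega>. Z i e k \<omega> * f (pos i e (Suc k) \<omega>))
    = expectation (\<lambda>\<omega>. Z i e k \<omega> * trans_op e f (pos i e k \<omega>))"
  using expectation_Z[OF f e e, of i k] by (simp add: pos_def algebra_simps)

text \<open>The boundary term of the summation by parts, that is, the process stopped at the first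
  skeleton point not before the impulse. The second summand is nonzero only if the impulse falls on
  the starting time.\<close>

definition jump :: "nat \<Rightarrow> real \<Rightarrow> nat \<Rightarrow> ('e \<Rightarrow> real) \<Rightarrow> (nat \<Rightarrow> 'w) \<Rightarrow> real"
  where "jump i e L \<phi> \<omega> = (\<Sum>k<L. (Z i e k \<omega> - Z i e (Suc k) \<omega>) * \<phi> (pos i e (Suc k) \<omega>))
    + (wt (start i \<omega>) - Z i e 0 \<omega>) * \<phi> (pos i e 0 \<omega>)"

lemma Z_eventually_zero:
  assumes "0 < e" obtains L where "\<And>i \<omega>. Z i e L \<omega> = 0" "\<And>s. 0 \<le> s \<Longrightarrow> b (s + real L * e) = 0"
proof -
  obtain T where T: "\<And>s. T < s \<Longrightarrow> b s = 0" using b_support by blast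
  obtain L where "T / e < real L" using reals_Archimedean2 by blast
  then have "T < real L * e" using assms by (simp add: field_simps)
  then have "0 \<le> s \<Longrightarrow> T < s + real L * e" for s by linarith
  then have "0 \<le> s \<Longrightarrow> b (s + real L * e) = 0" for s using T by blast
  then show ?thesis by (intro that[of L]) (auto simp: Z_def)
qed

text \<open>Summation by parts along the skeleton.\<close>

lemma dynkin:
  assumes \<phi>: "\<phi> \<in> bcontfun" and e: "0 < e" and L: "\<And>\<omega>. Z i e L \<omega> = 0"
  shows "expectation (\<lambda>\<omega>. wt (start i \<omega>) * \<phi> (pos i e 0 \<omega>))
    = (\<Sum>k<L. expectation (\<lambda>\<omega>. Z i e k \<omega> * (\<phi> (pos i e k \<omega>) - trans_op e \<phi> (pos i e k \<omega>))))
      + expectation (jump i e L \<phi>)"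
proof -
  note [measurable] = bcontfun_borel[OF \<phi>]
  have T\<phi>: "trans_op e \<phi> \<in> bcontfun" using \<phi> e by (intro trans_op_bcontfun) auto
  have path: "wt (start i \<omega>) * \<phi> (pos i e 0 \<omega>)
    = (\<Sum>k<L. Z i e k \<omega> * \<phi> (pos i e k \<omega>) - Z i e k \<omega> * \<phi> (pos i e (Suc k) \<omega>)) + jump i e L \<phi> \<omega>" for \<omega>
  proof -
    have "(\<Sum>k<L. Z i e k \<omega> * \<phi> (pos i e k \<omega>) - Z i e (Suc k) \<omega> * \<phi> (pos i e (Suc k) \<omega>))
      = Z i e 0 \<omega> * \<phi> (pos i e 0 \<omega>)"
      by (subst sum_lessThan_telescope') (simp add: L)
    moreover have "(\<Sum>k<L. Z i e k \<omega> * \<phi> (pos i e k \<omega>) - Z i e (Suc k) \<omega> * \<phi> (pos i e (Suc k) \<omega>))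
      = (\<Sum>k<L. Z i e k \<omega> * \<phi> (pos i e k \<omega>) - Z i e k \<omega> * \<phi> (pos i e (Suc k) \<omega>))
        + (\<Sum>k<L. (Z i e k \<omega> - Z i e (Suc k) \<omega>) * \<phi> (pos i e (Suc k) \<omega>))"
      by (simp add: sum.distrib[symmetric] algebra_simps)
    ultimately show ?thesis by (simp add: jump_def algebra_simps)
  qed
  have i1: "integrable Q (\<lambda>\<omega>. Z i e k \<omega> * \<phi> (pos i e k' \<omega>))" for k k'
    using \<phi> by (rule integrable_Z) measurable
  have i2: "integrable Q (\<lambda>\<omega>. Z i e k \<omega> * trans_op e \<phi> (pos i e k \<omega>))" for k
    using T\<phi> by (rule integrable_Z) measurable
  have i3: "integrable Q (jump i e L \<phi>)"
    unfolding jump_def[abs_def]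
  proof (intro Bochner_Integration.integrable_add Bochner_Integration.integrable_sum)
    show "integrable Q (\<lambda>\<omega>. (Z i e k \<omega> - Z i e (Suc k) \<omega>) * \<phi> (pos i e (Suc k) \<omega>))" for k
      unfolding left_diff_distrib by (intro Bochner_Integration.integrable_diff i1)
    have "integrable Q (\<lambda>\<omega>. wt (start i \<omega>) * \<phi> (pos i e 0 \<omega>))"
      using \<phi> by (rule integrable_wt) measurable
    then show "integrable Q (\<lambda>\<omega>. (wt (start i \<omega>) - Z i e 0 \<omega>) * \<phi> (pos i e 0 \<omega>))"
      unfolding left_diff_distrib by (intro Bochner_Integration.integrable_diff i1)
  qed
  have "expectation (\<lambda>\<omega>. wt (start i \<omega>) * \<phi> (pos i e 0 \<omega>))
    = (\<Sum>k<L. expectation (\<lambda>\<omega>. Z i e k \<omega> * \<phi> (pos i e k \<omega>)) - expectation (\<lambda>\<omega>. Z i e k \<omega> * \<phi> (pos i e (Suc k) \<omega>)))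
      + expectation (jump i e L \<phi>)"
    unfolding path using i1 i3 by (simp add: Bochner_Integration.integral_diff)
  also have "(\<Sum>k<L. expectation (\<lambda>\<omega>. Z i e k \<omega> * \<phi> (pos i e k \<omega>)) - expectation (\<lambda>\<omega>. Z i e k \<omega> * \<phi> (pos i e (Suc k) \<omega>)))
    = (\<Sum>k<L. expectation (\<lambda>\<omega>. Z i e k \<omega> * (\<phi> (pos i e k \<omega>) - trans_op e \<phi> (pos i e k \<omega>))))"
    unfolding expectation_Z_step[OF \<phi> less_imp_le[OF e]] right_diff_distrib
    using i1 i2 by (simp add: Bochner_Integration.integral_diff)
  finally show ?thesis .
qed

lemma jump_skel:
  assumes "start i \<omega> < \<infinity>" "0 \<le> e"
  shows "jump i e L \<phi> \<omega> = (\<Sum>k<L. (skel (enn2real (start i \<omega>)) e (imp i \<omega>) k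
        - skel (enn2real (start i \<omega>)) e (imp i \<omega>) (Suc k)) * \<phi> (pos i e (Suc k) \<omega>))
      + (b (enn2real (start i \<omega>)) - skel (enn2real (start i \<omega>)) e (imp i \<omega>) 0) * \<phi> (pos i e 0 \<omega>)"
  using assms by (simp add: jump_def Z_skel[OF assms] wt_def)

lemma jump_infinite: "start i \<omega> = \<infinity> \<Longrightarrow> jump i e L \<phi> \<omega> = 0"
  by (simp add: jump_def Z_infinite wt_def)

lemma ennreal_start: "start i \<omega> < \<infinity> \<Longrightarrow> ennreal (enn2real (start i \<omega>)) = start i \<omega>"
  by (simp add: less_top)

lemma jump_lower:
  assumes \<omega>: "\<omega> \<in> space Q" and e: "0 < e" and L: "\<And>s. 0 \<le> s \<Longrightarrow> b (s + real L * e) = 0"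
    and \<phi>: "\<And>x. 0 \<le> \<phi> x"
  shows "wt (imp i \<omega>) * \<phi> (stopped_pos i e \<omega>) \<le> jump i e L \<phi> \<omega>"
proof (cases "start i \<omega> < \<infinity>")
  case True
  then show ?thesis
    using skel_decrement_lower[of "enn2real (start i \<omega>)" e "imp i \<omega>" L "\<lambda>k. \<phi> (pos i e k \<omega>)"]
      start_le_imp[OF \<omega>, of i] ennreal_start[OF True] e L \<phi>
    by (simp add: jump_skel stopped_pos_def)
next
  case False
  then have "start i \<omega> = \<infinity>" by (metis infinity_ennreal_def top.not_eq_extremum)
  moreover from this have "imp i \<omega> = \<infinity>" using start_le_imp[OF \<omega>, of i] by (simp add: top_unique)
  ultimately show ?thesis by (simp add: jump_infinite wt_def)
qed

text \<open>The weight may also decrease while the coordinate is in use; the values of \<phi> met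
  there are bounded by C. The resulting term telescopes over the coordinates, because
  \<open>imp i\<close> is the next starting time.\<close>

lemma jump_upper:
  assumes \<omega>: "\<omega> \<in> space Q" and e: "0 < e" and L: "\<And>s. 0 \<le> s \<Longrightarrow> b (s + real L * e) = 0"
    and \<phi>: "\<And>x. 0 \<le> \<phi> x" "\<And>x. \<phi> x \<le> C"
  shows "jump i e L \<phi> \<omega> \<le> C * (wt (start i \<omega>) - wt (imp i \<omega>)) + wt (imp i \<omega>) * \<phi> (stopped_pos i e \<omega>)"
proof (cases "start i \<omega> < \<infinity>")
  case True
  then show ?thesis
    using skel_decrement_upper[of "enn2real (start i \<omega>)" e "imp i \<omega>" L "\<lambda>k. \<phi> (pos i e k \<omega>)" C]
      start_le_imp[OF \<omega>, of i] ennreal_start[OF True] e L \<phi>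
    by (simp add: jump_skel stopped_pos_def wt_def[of "start i \<omega>"])
next
  case False
  then have "start i \<omega> = \<infinity>" by (metis infinity_ennreal_def top.not_eq_extremum)
  moreover from this have "imp i \<omega> = \<infinity>" using start_le_imp[OF \<omega>, of i] by (simp add: top_unique)
  ultimately show ?thesis by (simp add: jump_infinite wt_def)
qed

lemma integrable_jump:
  assumes \<phi>: "\<phi> \<in> bcontfun" shows "integrable Q (jump i e L \<phi>)"
proof -
  have i1: "integrable Q (\<lambda>\<omega>. Z i e k \<omega> * \<phi> (pos i e k' \<omega>))" for k k'
    using \<phi> by (rule integrable_Z) measurable
  have i2: "integrable Q (\<lambda>\<omega>. wt (start i \<omega>) * \<phi> (pos i e 0 \<omega>))"
    using \<phi> by (rule integrable_wt) measurable
  show ?thesis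
    unfolding jump_def[abs_def] left_diff_distrib
    by (intro Bochner_Integration.integrable_add Bochner_Integration.integrable_sum
        Bochner_Integration.integrable_diff i1 i2)
qed

text \<open>The condition 0 \<le> s is explicit because \<open>ennreal\<close> sends negative
  numbers to 0, so that a coordinate starting at 0 would seem to be in use at negative
  times.\<close>

definition run :: "nat \<Rightarrow> ('e \<Rightarrow> real) \<Rightarrow> (nat \<Rightarrow> 'w) \<Rightarrow> real"
  where "run i g \<omega> = (\<integral>s. (if 0 \<le> s \<and> start i \<omega> \<le> ennreal s \<and> ennreal s < imp i \<omega> then b s else 0)
      * g (X (max 0 s) (\<omega> i)) \<partial>lborel)"

lemma run_real:
  assumes "start i \<omega> < \<infinity>"
  shows "run i g \<omega> = (\<integral>s. (if enn2real (start i \<omega>) \<le> s \<and> ennreal s < imp i \<omega> then b s else 0)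
      * g (X (max 0 s) (\<omega> i)) \<partial>lborel)"
proof -
  have "0 \<le> s \<and> start i \<omega> \<le> ennreal s \<longleftrightarrow> enn2real (start i \<omega>) \<le> s" for s
    using assms ennreal_start[OF assms] ennreal_le_iff[of s "enn2real (start i \<omega>)"]
      ennreal_le_iff2[of "enn2real (start i \<omega>)" s] enn2real_nonneg[of "start i \<omega>"]
    by (metis order_trans)
  then have *: "0 \<le> s \<and> start i \<omega> \<le> ennreal s \<and> ennreal s < imp i \<omega>
      \<longleftrightarrow> enn2real (start i \<omega>) \<le> s \<and> ennreal s < imp i \<omega>" for s by blast
  show ?thesis unfolding run_def * ..
qed

lemma run_infinite: "start i \<omega> = \<infinity> \<Longrightarrow> run i g \<omega> = 0"
  by (simp add: run_def top_unique)

text \<open>The weight is frozen at the left end and the whole cell counts even if the impulse falls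
  inside it. The weight is thus known at the left end, as the Markov property requires.\<close>

definition cell :: "nat \<Rightarrow> real \<Rightarrow> nat \<Rightarrow> ('e \<Rightarrow> real) \<Rightarrow> (nat \<Rightarrow> 'w) \<Rightarrow> real"
  where "cell i e k g \<omega> = Z i e k \<omega> *
    (\<integral>r. indicator {0..<e} r * g (X (max 0 (enn2real (start i \<omega>) + real k * e + r)) (\<omega> i)) \<partial>lborel)"

lemma integrable_pair_bounded:
  fixes f :: "(nat \<Rightarrow> 'w) \<times> real \<Rightarrow> real"
  assumes "f \<in> borel_measurable (Q \<Otimes>\<^sub>M lborel)" "\<And>\<omega> r. \<bar>f (\<omega>, r)\<bar> \<le> B * indicator {a..c} r"
  shows "integrable (Q \<Otimes>\<^sub>M lborel) f"
proof (rule Bochner_Integration.integrable_bound)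
  interpret pair_sigma_finite Q lborel ..
  have "emeasure (Q \<Otimes>\<^sub>M lborel) (space Q \<times> {a..c}) = emeasure lborel {a..c}"
    by (subst lborel.emeasure_pair_measure_Times) (auto simp: emeasure_space_1)
  then have "emeasure (Q \<Otimes>\<^sub>M lborel) (space Q \<times> {a..c}) < \<infinity>"
    by (simp add: emeasure_lborel_Icc_eq)
  then show "integrable (Q \<Otimes>\<^sub>M lborel) (\<lambda>z. B * indicator (space Q \<times> {a..c}) z :: real)"
    by (intro integrable_mult_right integrable_real_indicator) auto
  show "AE z in Q \<Otimes>\<^sub>M lborel. norm (f z) \<le> norm (B * indicator (space Q \<times> {a..c}) z :: real)"
  proof (intro AE_I2)
    fix z :: "(nat \<Rightarrow> 'w) \<times> real" assume "z \<in> space (Q \<Otimes>\<^sub>M lborel)"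
    then show "norm (f z) \<le> norm (B * indicator (space Q \<times> {a..c}) z :: real)"
      using assms(2)[of "fst z" "snd z"] by (cases z) (auto simp: space_pair_measure indicator_def split: if_splits)
  qed
qed (use assms(1) in simp)

text \<open>Fubini, and then the Markov property from the left end of the cell for each single
  r.\<close>

lemma expectation_cell:
  assumes g: "g \<in> bcontfun" and e: "0 < e"
  shows "expectation (cell i e k g)
      = (\<integral>r. indicator {0..<e} r * expectation (\<lambda>\<omega>. Z i e k \<omega> * trans_op (max 0 r) g (pos i e k \<omega>)) \<partial>lborel)"
    and "integrable Q (cell i e k g)"
    and "integrable lborel (\<lambda>r. indicator {0..<e} r * expectation (\<lambda>\<omega>. Z i e k \<omega> * trans_op (max 0 r) g (pos i e k \<omega>)))"
proof -
  interpret pair_sigma_finite Q lborel ..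
  obtain B where B: "0 \<le> B" "\<And>x. \<bar>g x\<bar> \<le> B" using bcontfun_bound[OF g] by blast
  note [measurable] = bcontfun_borel[OF g]
  let ?h = "\<lambda>\<omega> r. indicator {0..<e} r * (Z i e k \<omega> * g (X (max 0 (enn2real (start i \<omega>) + real k * e + r)) (\<omega> i)))"
  have int: "integrable (Q \<Otimes>\<^sub>M lborel) (case_prod ?h)"
  proof (rule integrable_pair_bounded[where B = B and a = 0 and c = e])
    show "case_prod ?h \<in> borel_measurable (Q \<Otimes>\<^sub>M lborel)" by measurable
    fix \<omega> r
    have "\<bar>Z i e k \<omega> * g (X (max 0 (enn2real (start i \<omega>) + real k * e + r)) (\<omega> i))\<bar> \<le> 1 * B"
      unfolding abs_mult using B Z_nonneg Z_le_1 by (intro mult_mono) auto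
    then show "\<bar>case_prod ?h (\<omega>, r)\<bar> \<le> B * indicator {0..e} r"
      using B by (auto simp: indicator_def)
  qed
  have cell: "cell i e k g = (\<lambda>\<omega>. \<integral>r. ?h \<omega> r \<partial>lborel)"
    by (simp add: cell_def[abs_def] mult.left_commute[of "indicator _ _"])
  have inner: "(\<integral>\<omega>. ?h \<omega> r \<partial>Q)
      = indicator {0..<e} r * expectation (\<lambda>\<omega>. Z i e k \<omega> * trans_op (max 0 r) g (pos i e k \<omega>))" for r
    using expectation_Z[OF g less_imp_le[OF e], of r i k] by (cases "0 \<le> r") (auto simp: max_def)
  show "integrable Q (cell i e k g)"
    unfolding cell using integrable_fst[OF int] .
  show "expectation (cell i e k g)
      = (\<integral>r. indicator {0..<e} r * expectation (\<lambda>\<omega>. Z i e k \<omega> * trans_op (max 0 r) g (pos i e k \<omega>)) \<partial>lborel)"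
    unfolding cell Fubini_integral[OF int, symmetric] inner ..
  show "integrable lborel (\<lambda>r. indicator {0..<e} r * expectation (\<lambda>\<omega>. Z i e k \<omega> * trans_op (max 0 r) g (pos i e k \<omega>)))"
    using integrable_snd[OF int] unfolding split_conv inner .
qed

lemma cell_lower:
  assumes g: "g \<in> bcontfun" and f: "f \<in> bcontfun" and e: "0 < e"
    and fg: "\<And>r x. 0 \<le> r \<Longrightarrow> r \<le> e \<Longrightarrow> f x \<le> trans_op r g x"
  shows "e * expectation (\<lambda>\<omega>. Z i e k \<omega> * f (pos i e k \<omega>)) \<le> expectation (cell i e k g)"
proof -
  let ?E = "expectation (\<lambda>\<omega>. Z i e k \<omega> * f (pos i e k \<omega>))"
  have "e * ?E = (\<integral>r. indicator {0..<e} r * ?E \<partial>lborel)"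
    using e by simp
  also have "\<dots> \<le> (\<integral>r. indicator {0..<e} r * expectation (\<lambda>\<omega>. Z i e k \<omega> * trans_op (max 0 r) g (pos i e k \<omega>)) \<partial>lborel)"
  proof (rule integral_mono[OF _ expectation_cell(3)[OF g e]])
    show "integrable lborel (\<lambda>r. indicator {0..<e} r * ?E)"
      using e by (intro integrable_mult_left integrable_real_indicator) auto
    fix r
    have "?E \<le> expectation (\<lambda>\<omega>. Z i e k \<omega> * trans_op (max 0 r) g (pos i e k \<omega>))" if "0 \<le> r" "r < e"
    proof (rule integral_mono)
      show "integrable Q (\<lambda>\<omega>. Z i e k \<omega> * f (pos i e k \<omega>))" using f by (rule integrable_Z) measurable
      show "integrable Q (\<lambda>\<omega>. Z i e k \<omega> * trans_op (max 0 r) g (pos i e k \<omega>))"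
        by (rule integrable_Z[OF trans_op_bcontfun[OF g]]) auto
      show "Z i e k \<omega> * f (pos i e k \<omega>) \<le> Z i e k \<omega> * trans_op (max 0 r) g (pos i e k \<omega>)" for \<omega>
        using that fg Z_nonneg by (intro mult_left_mono) (auto simp: max_def)
    qed
    then show "indicator {0..<e} r * ?E
        \<le> indicator {0..<e} r * expectation (\<lambda>\<omega>. Z i e k \<omega> * trans_op (max 0 r) g (pos i e k \<omega>))"
      by (auto simp: indicator_def)
  qed
  finally show ?thesis by (simp add: expectation_cell(1)[OF g e])
qed

lemma cell_upper:
  assumes g: "g \<in> bcontfun" and f: "f \<in> bcontfun" and e: "0 < e"
    and fg: "\<And>r x. 0 \<le> r \<Longrightarrow> r \<le> e \<Longrightarrow> trans_op r g x \<le> f x"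
  shows "expectation (cell i e k g) \<le> e * expectation (\<lambda>\<omega>. Z i e k \<omega> * f (pos i e k \<omega>))"
proof -
  have "(\<lambda>x. - g x) \<in> bcontfun" "(\<lambda>x. - f x) \<in> bcontfun"
    using f g by (auto simp: continuous_iff intro!: continuous_intros)
  moreover have "trans_op r (\<lambda>x. - g x) x = - trans_op r g x" for r x
    using trans_op_cmult[of r "-1" g x] by simp
  moreover have "cell i e k (\<lambda>x. - g x) = (\<lambda>\<omega>. - cell i e k g \<omega>)"
    by (simp add: cell_def[abs_def])
  ultimately show ?thesis
    using cell_lower[of "\<lambda>x. - g x" "\<lambda>x. - f x" e i k] fg e by simp
qed

lemma measurable_path:
  assumes [measurable]: "g \<in> borel_measurable borel" and "\<omega> \<in> space Q"
  shows "(\<lambda>s. g (X (max 0 s) (\<omega> i))) \<in> borel_measurable borel"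
proof -
  have [measurable]: "(\<lambda>_. \<omega>) \<in> borel \<rightarrow>\<^sub>M Q" using assms(2) by simp
  have "(\<lambda>s. X (max 0 s) ((\<lambda>_. \<omega>) s i)) \<in> borel \<rightarrow>\<^sub>M borel" by (rule measurable_X_time) measurable
  then show ?thesis by measurable
qed

lemma run_cells:
  assumes g: "g \<in> borel_measurable borel" "\<And>x. \<bar>g x\<bar> \<le> G" and \<omega>: "\<omega> \<in> space Q" and e: "0 < e"
    and L: "\<And>s. 0 \<le> s \<Longrightarrow> b (s + real L * e) = 0"
  shows "\<bar>(\<Sum>k<L. cell i e k g \<omega>) - run i g \<omega>\<bar> \<le> G * e"
proof (cases "start i \<omega> < \<infinity>")
  case True
  show ?thesis
    using skel_integral(2)[where y = "\<lambda>s. g (X (max 0 s) (\<omega> i))" and s = "enn2real (start i \<omega>)" and e = e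
        and L = L and G = G and \<tau> = "imp i \<omega>", OF _ e L measurable_path[OF g(1) \<omega>] g(2)] e
    by (simp add: cell_def Z_skel[OF True] run_real[OF True])
next
  case False
  then have "start i \<omega> = \<infinity>" by (metis infinity_ennreal_def top.not_eq_extremum)
  moreover have "0 \<le> G" using g(2) by (meson abs_ge_zero order_trans)
  ultimately show ?thesis using e by (simp add: cell_def Z_infinite run_infinite)
qed

end

section \<open>Averages over one period of the grid\<close>

context feller_process
begin

definition avg :: "nat \<Rightarrow> real \<Rightarrow> ('e \<Rightarrow> real) \<Rightarrow> 'e \<Rightarrow> real"
  where "avg M e u x = (\<Sum>j<M. trans_op (real j * e) u x) / real M"

lemma avg_bcontfun:
  assumes u: "u \<in> bcontfun" and e: "0 \<le> e" shows "avg M e u \<in> bcontfun"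
proof -
  have "trans_op (real j * e) u \<in> bcontfun" for j using u e by (intro trans_op_bcontfun) auto
  then show ?thesis
    unfolding continuous_iff avg_def[abs_def] divide_inverse by (intro continuous_intros)
qed

lemma avg_bounds:
  assumes u: "u \<in> bcontfun" and e: "0 \<le> e" and M: "0 < M" and b: "\<And>x. 0 \<le> u x" "\<And>x. u x \<le> C"
  shows "0 \<le> avg M e u x" "avg M e u x \<le> C"
proof -
  have t: "0 \<le> trans_op (real j * e) u x" "trans_op (real j * e) u x \<le> C" for j
    using trans_op_bounds(1)[OF u _ b(1)] trans_op_bounds(2)[OF u _ b(2)] e by auto
  show "0 \<le> avg M e u x" unfolding avg_def using t by (intro divide_nonneg_nonneg sum_nonneg) auto
  have "(\<Sum>j<M. trans_op (real j * e) u x) \<le> real M * C"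
    using sum_bounded_above[of "{..<M}" "\<lambda>j. trans_op (real j * e) u x" C] t by simp
  then show "avg M e u x \<le> C" unfolding avg_def using M by (simp add: field_simps)
qed

text \<open>
  Averaging over one period of the grid turns an inequality for the grid step into one for the step
  \<open>e\<close> without any error term.
\<close>

lemma avg_step:
  assumes u: "u \<in> bcontfun" and e: "0 \<le> e"
  shows "avg M e u x - trans_op e (avg M e u) x = (u x - trans_op (real M * e) u x) / real M"
proof -
  have b: "trans_op (real j * e) u \<in> bcontfun" for j using u e by (intro trans_op_bcontfun) auto
  have "trans_op e (avg M e u) x = (\<Sum>j<M. trans_op e (trans_op (real j * e) u) x) / real M"
    unfolding trans_op_def[of e] avg_def using b e by (simp add: integrable_X)
  also have "(\<Sum>j<M. trans_op e (trans_op (real j * e) u) x) = (\<Sum>j<M. trans_op (real (Suc j) * e) u x)"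
  proof (intro sum.cong refl)
    fix j
    have "trans_op (e + real j * e) u x = trans_op e (trans_op (real j * e) u) x"
      using e by (intro trans_op_semigroup u) auto
    then show "trans_op e (trans_op (real j * e) u) x = trans_op (real (Suc j) * e) u x"
      by (simp add: algebra_simps)
  qed
  finally have *: "trans_op e (avg M e u) x = (\<Sum>j<M. trans_op (real (Suc j) * e) u x) / real M" .
  have "avg M e u x - trans_op e (avg M e u) x
    = (\<Sum>j<M. trans_op (real j * e) u x - trans_op (real (Suc j) * e) u x) / real M"
    unfolding * by (simp add: avg_def sum_subtractf diff_divide_distrib del: of_nat_Suc)
  also have "\<dots> = (u x - trans_op (real M * e) u x) / real M"
    by (subst sum_lessThan_telescope') (simp add: trans_op_0[OF u])
  finally show ?thesis .
qed

lemma avg_impulse: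
  assumes u: "u \<in> bcontfun" and e: "0 \<le> e" and M: "0 < M"
    and k: "\<And>r. 0 \<le> r \<Longrightarrow> r \<le> real M * e \<Longrightarrow> trans_op r u x \<le> a + trans_op r u \<xi>"
  shows "avg M e u x \<le> a + avg M e u \<xi>"
proof -
  have "(\<Sum>j<M. trans_op (real j * e) u x) \<le> (\<Sum>j<M. a + trans_op (real j * e) u \<xi>)"
    using e by (intro sum_mono k) (auto intro: mult_right_mono)
  also have "\<dots> = real M * a + (\<Sum>j<M. trans_op (real j * e) u \<xi>)" by (simp add: sum.distrib)
  finally have "avg M e u x \<le> (real M * a + (\<Sum>j<M. trans_op (real j * e) u \<xi>)) / real M"
    unfolding avg_def by (rule divide_right_mono) simp
  then show ?thesis using M by (simp add: avg_def add_divide_distrib)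
qed

end

section \<open>Inequalities along one coordinate\<close>

context weighted_process
begin

definition start_pos :: "nat \<Rightarrow> (nat \<Rightarrow> 'w) \<Rightarrow> 'e"
  where "start_pos i \<omega> = X (max 0 (enn2real (start i \<omega>))) (\<omega> i)"

definition imp_pos :: "nat \<Rightarrow> (nat \<Rightarrow> 'w) \<Rightarrow> 'e"
  where "imp_pos i \<omega> = X (max 0 (enn2real (imp i \<omega>))) (\<omega> i)"

lemma measurable_start_pos [measurable]: "start_pos i \<in> Q \<rightarrow>\<^sub>M borel"
  and measurable_imp_pos [measurable]: "imp_pos i \<in> Q \<rightarrow>\<^sub>M borel"
  unfolding start_pos_def[abs_def] imp_pos_def[abs_def] by measurable

lemma pos_0: "pos i e 0 = start_pos i"
  by (auto simp: pos_def start_pos_def)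

lemma measurable_slot [measurable]:
  "(\<lambda>z. if 0 \<le> snd z \<and> start i (fst z) \<le> ennreal (snd z) \<and> ennreal (snd z) < imp i (fst z) then b (snd z) else 0)
    \<in> borel_measurable (Q \<Otimes>\<^sub>M lborel)"
proof -
  have [measurable]: "(\<lambda>z. start i (fst z)) \<in> borel_measurable (Q \<Otimes>\<^sub>M lborel)"
    "(\<lambda>z. imp i (fst z)) \<in> borel_measurable (Q \<Otimes>\<^sub>M lborel)"
    by (rule measurable_compose[OF measurable_fst measurable_start],
        rule measurable_compose[OF measurable_fst measurable_imp])
  show ?thesis by measurable
qed

lemma integrable_slot:
  assumes g: "g \<in> bcontfun"
  shows "integrable (Q \<Otimes>\<^sub>M lborel) (\<lambda>z. (if 0 \<le> snd z \<and> start i (fst z) \<le> ennreal (snd z)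
      \<and> ennreal (snd z) < imp i (fst z) then b (snd z) else 0) * g (X (max 0 (snd z)) (fst z i)))"
proof -
  obtain B where B: "0 \<le> B" "\<And>x. \<bar>g x\<bar> \<le> B" using bcontfun_bound[OF g] by blast
  obtain T where T: "\<And>s. T < s \<Longrightarrow> b s = 0" using b_support by blast
  note [measurable] = bcontfun_borel[OF g]
  show ?thesis
  proof (rule integrable_pair_bounded[where B = B and a = 0 and c = T])
    fix \<omega> r
    let ?s = "if 0 \<le> r \<and> start i \<omega> \<le> ennreal r \<and> ennreal r < imp i \<omega> then b r else 0"
    have "\<bar>?s\<bar> \<le> indicator {0..T} r"
      using T[of r] b_nonneg[of r] b_le_1[of r] by (auto simp: indicator_def)
    then have "\<bar>?s\<bar> * \<bar>g (X (max 0 r) (\<omega> i))\<bar> \<le> indicator {0..T} r * B"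
      using B by (intro mult_mono) auto
    also have "\<dots> = B * indicator {0..T} r" by (rule mult.commute)
    finally show "\<bar>(if 0 \<le> snd (\<omega>, r) \<and> start i (fst (\<omega>, r)) \<le> ennreal (snd (\<omega>, r))
      \<and> ennreal (snd (\<omega>, r)) < imp i (fst (\<omega>, r)) then b (snd (\<omega>, r)) else 0)
      * g (X (max 0 (snd (\<omega>, r))) (fst (\<omega>, r) i))\<bar> \<le> B * indicator {0..T} r"
      unfolding fst_conv snd_conv abs_mult .
  qed measurable
qed

lemma integrable_run: "g \<in> bcontfun \<Longrightarrow> integrable Q (run i g)"
proof -
  assume g: "g \<in> bcontfun"
  interpret pair_sigma_finite Q lborel ..
  from integrable_fst'[OF integrable_slot[OF g]] show ?thesis
    unfolding run_def[abs_def] fst_conv snd_conv .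
qed

lemma expectation_run:
  assumes g: "g \<in> bcontfun"
  shows "expectation (run i g) = (\<integral>z. (if 0 \<le> snd z \<and> start i (fst z) \<le> ennreal (snd z)
      \<and> ennreal (snd z) < imp i (fst z) then b (snd z) else 0) * g (X (max 0 (snd z)) (fst z i)) \<partial>(Q \<Otimes>\<^sub>M lborel))"
proof -
  interpret pair_sigma_finite Q lborel ..
  from integral_fst'[OF integrable_slot[OF g]] show ?thesis
    unfolding run_def[abs_def] fst_conv snd_conv .
qed

lemma segment_upper:
  assumes \<phi>: "\<phi> \<in> bcontfun" "\<And>x. 0 \<le> \<phi> x" "\<And>x. \<phi> x \<le> C" and f: "f \<in> bcontfun"
    and G: "\<And>x. \<bar>f x + \<delta>\<bar> \<le> G" and e: "0 < e"
    and step: "\<And>x. \<phi> x - trans_op e \<phi> x \<le> e * f x"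
    and \<delta>: "\<And>r x. 0 \<le> r \<Longrightarrow> r \<le> e \<Longrightarrow> f x \<le> trans_op r f x + \<delta>"
  shows "expectation (\<lambda>\<omega>. wt (start i \<omega>) * \<phi> (start_pos i \<omega>))
    \<le> expectation (run i (\<lambda>x. f x + \<delta>)) + G * e
      + C * (expectation (\<lambda>\<omega>. wt (start i \<omega>)) - expectation (\<lambda>\<omega>. wt (imp i \<omega>)))
      + expectation (\<lambda>\<omega>. wt (imp i \<omega>) * \<phi> (stopped_pos i e \<omega>))"
proof -
  obtain L where L: "\<And>i \<omega>. Z i e L \<omega> = 0" "\<And>s. 0 \<le> s \<Longrightarrow> b (s + real L * e) = 0"
    using Z_eventually_zero[OF e] by blast
  have g: "(\<lambda>x. f x + \<delta>) \<in> bcontfun" and T\<phi>: "(\<lambda>x. \<phi> x - trans_op e \<phi> x) \<in> bcontfun"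
    using f \<phi>(1) trans_op_bcontfun[OF \<phi>(1), of e] e by (auto simp: continuous_iff intro!: continuous_intros)
  have fe: "(\<lambda>x. e * f x) \<in> bcontfun" using f by (auto simp: continuous_iff intro!: continuous_intros)
  have "expectation (\<lambda>\<omega>. Z i e k \<omega> * (\<phi> (pos i e k \<omega>) - trans_op e \<phi> (pos i e k \<omega>)))
      \<le> expectation (cell i e k (\<lambda>x. f x + \<delta>))" for k
  proof -
    have "expectation (\<lambda>\<omega>. Z i e k \<omega> * (\<phi> (pos i e k \<omega>) - trans_op e \<phi> (pos i e k \<omega>)))
        \<le> expectation (\<lambda>\<omega>. Z i e k \<omega> * (e * f (pos i e k \<omega>)))"
      using integrable_Z[OF T\<phi> measurable_pos] integrable_Z[OF fe measurable_pos] step Z_nonneg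
      by (intro integral_mono mult_left_mono)
    also have "\<dots> = e * expectation (\<lambda>\<omega>. Z i e k \<omega> * f (pos i e k \<omega>))"
      by (simp add: mult.left_commute[of _ e])
    also have "\<dots> \<le> expectation (cell i e k (\<lambda>x. f x + \<delta>))"
    proof (rule cell_lower[OF g f e])
      fix r x assume r: "0 \<le> r" "r \<le> e"
      have "trans_op r (\<lambda>x. f x + \<delta>) x = trans_op r f x + \<delta>"
        using trans_op_add[OF f const_in_bcontfun r(1)] by (simp add: trans_op_const)
      then show "f x \<le> trans_op r (\<lambda>x. f x + \<delta>) x" using \<delta>[OF r] by simp
    qed
    finally show ?thesis .
  qed
  then have "(\<Sum>k<L. expectation (\<lambda>\<omega>. Z i e k \<omega> * (\<phi> (pos i e k \<omega>) - trans_op e \<phi> (pos i e k \<omega>))))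
      \<le> (\<Sum>k<L. expectation (cell i e k (\<lambda>x. f x + \<delta>)))" by (intro sum_mono)
  also have "\<dots> = expectation (\<lambda>\<omega>. \<Sum>k<L. cell i e k (\<lambda>x. f x + \<delta>) \<omega>)"
    by (intro Bochner_Integration.integral_sum[symmetric] expectation_cell(2)[OF g e])
  also have "\<dots> \<le> expectation (\<lambda>\<omega>. run i (\<lambda>x. f x + \<delta>) \<omega> + G * e)"
  proof (rule integral_mono)
    show "integrable Q (\<lambda>\<omega>. \<Sum>k<L. cell i e k (\<lambda>x. f x + \<delta>) \<omega>)"
      by (intro Bochner_Integration.integrable_sum expectation_cell(2)[OF g e])
    show "integrable Q (\<lambda>\<omega>. run i (\<lambda>x. f x + \<delta>) \<omega> + G * e)"
      using integrable_run[OF g] by simp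
    show "(\<Sum>k<L. cell i e k (\<lambda>x. f x + \<delta>) \<omega>) \<le> run i (\<lambda>x. f x + \<delta>) \<omega> + G * e" if "\<omega> \<in> space Q" for \<omega>
      using run_cells[OF bcontfun_borel[OF g] G that e L(2), of i] by linarith
  qed
  also have "\<dots> = expectation (run i (\<lambda>x. f x + \<delta>)) + G * e"
    using integrable_run[OF g] by (simp add: prob_space)
  finally have 1: "(\<Sum>k<L. expectation (\<lambda>\<omega>. Z i e k \<omega> * (\<phi> (pos i e k \<omega>) - trans_op e \<phi> (pos i e k \<omega>))))
      \<le> expectation (run i (\<lambda>x. f x + \<delta>)) + G * e" .
  have i1: "integrable Q (\<lambda>\<omega>. wt (start i \<omega>))" "integrable Q (\<lambda>\<omega>. wt (imp i \<omega>))"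
    "integrable Q (\<lambda>\<omega>. wt (imp i \<omega>) * \<phi> (stopped_pos i e \<omega>))"
    by (rule integrable_wt1, measurable)+ (rule integrable_wt[OF \<phi>(1)], measurable)
  have "expectation (jump i e L \<phi>)
      \<le> expectation (\<lambda>\<omega>. C * (wt (start i \<omega>) - wt (imp i \<omega>)) + wt (imp i \<omega>) * \<phi> (stopped_pos i e \<omega>))"
    using i1 integrable_jump[OF \<phi>(1)] jump_upper[OF _ e L(2) \<phi>(2,3)]
    by (intro integral_mono) auto
  also have "\<dots> = C * (expectation (\<lambda>\<omega>. wt (start i \<omega>)) - expectation (\<lambda>\<omega>. wt (imp i \<omega>)))
      + expectation (\<lambda>\<omega>. wt (imp i \<omega>) * \<phi> (stopped_pos i e \<omega>))"
    using i1 by simp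
  finally show ?thesis
    using dynkin[OF \<phi>(1) e L(1), of i] 1 by (simp add: pos_0)
qed

lemma segment_lower:
  assumes \<phi>: "\<phi> \<in> bcontfun" "\<And>x. 0 \<le> \<phi> x" and f: "f \<in> bcontfun" and h: "0 < h"
    and grid: "\<And>\<omega>. \<omega> \<in> space Q \<Longrightarrow> start i \<omega> = \<infinity> \<or> (\<exists>n::nat. start i \<omega> = ennreal (real n * h))"
      "\<And>\<omega>. \<omega> \<in> space Q \<Longrightarrow> imp i \<omega> = \<infinity> \<or> (\<exists>n::nat. imp i \<omega> = ennreal (real n * h))"
    and b_step: "\<And>(n::nat) r. 0 \<le> r \<Longrightarrow> r < h \<Longrightarrow> b (real n * h + r) = b (real n * h)"
    and step: "\<And>\<omega> n. \<omega> \<in> space Q \<Longrightarrow> start i \<omega> \<le> ennreal (real n * h) \<Longrightarrow> ennreal (real n * h) < imp i \<omega> \<Longrightarrow>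
      \<phi> (X (real n * h) (\<omega> i)) - trans_op h \<phi> (X (real n * h) (\<omega> i)) = h * f (X (real n * h) (\<omega> i))"
    and \<delta>: "\<And>r x. 0 \<le> r \<Longrightarrow> r \<le> h \<Longrightarrow> trans_op r f x \<le> f x + \<delta>"
  shows "expectation (run i (\<lambda>x. f x - \<delta>)) + expectation (\<lambda>\<omega>. wt (imp i \<omega>) * \<phi> (imp_pos i \<omega>))
    \<le> expectation (\<lambda>\<omega>. wt (start i \<omega>) * \<phi> (start_pos i \<omega>))"
proof -
  obtain L where L: "\<And>i \<omega>. Z i h L \<omega> = 0" "\<And>s. 0 \<le> s \<Longrightarrow> b (s + real L * h) = 0"
    using Z_eventually_zero[OF h] by blast
  have g: "(\<lambda>x. f x - \<delta>) \<in> bcontfun" and T\<phi>: "(\<lambda>x. \<phi> x - trans_op h \<phi> x) \<in> bcontfun"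
    using f \<phi>(1) trans_op_bcontfun[OF \<phi>(1), of h] h by (auto simp: continuous_iff intro!: continuous_intros)
  have shift: "Z i h k \<omega> * (\<phi> (pos i h k \<omega>) - trans_op h \<phi> (pos i h k \<omega>)) = Z i h k \<omega> * (h * f (pos i h k \<omega>))"
    if \<omega>: "\<omega> \<in> space Q" for k \<omega>
  proof (cases "Z i h k \<omega> = 0")
    case False
    then have lt: "start i \<omega> + ennreal (real k * h) < imp i \<omega>" by (auto simp: Z_def split: if_splits)
    then have "start i \<omega> \<noteq> \<infinity>" by auto
    then obtain n where n: "start i \<omega> = ennreal (real n * h)" using grid(1)[OF \<omega>] by blast
    have sum: "ennreal (real (n + k) * h) = start i \<omega> + ennreal (real k * h)"
      unfolding n using h by (subst ennreal_plus[symmetric]) (auto simp: algebra_simps)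
    have "pos i h k \<omega> = X (real (n + k) * h) (\<omega> i)"
      using h by (simp add: pos_def n max_def algebra_simps)
    moreover have "start i \<omega> \<le> ennreal (real (n + k) * h)" unfolding sum by simp
    ultimately show ?thesis using step[OF \<omega>, of "n + k"] lt[folded sum] by simp
  qed simp
  have "expectation (cell i h k (\<lambda>x. f x - \<delta>))
      \<le> expectation (\<lambda>\<omega>. Z i h k \<omega> * (\<phi> (pos i h k \<omega>) - trans_op h \<phi> (pos i h k \<omega>)))" for k
  proof -
    have "expectation (cell i h k (\<lambda>x. f x - \<delta>)) \<le> h * expectation (\<lambda>\<omega>. Z i h k \<omega> * f (pos i h k \<omega>))"
    proof (rule cell_upper[OF g f h])
      fix r x assume r: "0 \<le> r" "r \<le> h"
      have "trans_op r (\<lambda>x. f x - \<delta>) x = trans_op r f x - \<delta>"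
        using trans_op_diff[OF f const_in_bcontfun r(1)] by (simp add: trans_op_const)
      then show "trans_op r (\<lambda>x. f x - \<delta>) x \<le> f x" using \<delta>[OF r, of x] by simp
    qed
    also have "\<dots> = expectation (\<lambda>\<omega>. Z i h k \<omega> * (h * f (pos i h k \<omega>)))"
      by (simp add: mult.left_commute[of _ h])
    also have "\<dots> = expectation (\<lambda>\<omega>. Z i h k \<omega> * (\<phi> (pos i h k \<omega>) - trans_op h \<phi> (pos i h k \<omega>)))"
      by (intro Bochner_Integration.integral_cong refl) (rule shift[symmetric])
    finally show ?thesis .
  qed
  then have 1: "(\<Sum>k<L. expectation (cell i h k (\<lambda>x. f x - \<delta>)))
      \<le> (\<Sum>k<L. expectation (\<lambda>\<omega>. Z i h k \<omega> * (\<phi> (pos i h k \<omega>) - trans_op h \<phi> (pos i h k \<omega>))))" by (intro sum_mono)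
  have run: "run i (\<lambda>x. f x - \<delta>) \<omega> = (\<Sum>k<L. cell i h k (\<lambda>x. f x - \<delta>) \<omega>)" if \<omega>: "\<omega> \<in> space Q" for \<omega>
  proof (cases "start i \<omega> < \<infinity>")
    case True
    then obtain n where n: "start i \<omega> = ennreal (real n * h)" using grid(1)[OF \<omega>] by auto
    obtain G where G: "\<And>x. \<bar>f x - \<delta>\<bar> \<le> G" using bcontfun_bound[OF g] by blast
    let ?s = "real n * h"
    define bt where "bt u = (if ?s \<le> u \<and> ennreal u < imp i \<omega> then b u else 0)" for u
    have s: "enn2real (start i \<omega>) = ?s" "0 \<le> ?s" using h by (auto simp: n)
    \<comment> \<open>Since the impulse time lies on the grid, each cell is in use either entirely
      or not at all.\<close>
    have exact: "bt (?s + real k * h + r) = skel ?s h (imp i \<omega>) k" if r: "0 \<le> r" "r < h" for k r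
    proof -
      have eq: "?s + real k * h + r = real (n + k) * h + r" "?s + real k * h = real (n + k) * h"
        by (auto simp: algebra_simps)
      have "ennreal (real (n + k) * h + r) < imp i \<omega> \<longleftrightarrow> ennreal (real (n + k) * h) < imp i \<omega>"
      proof (cases "imp i \<omega> = \<infinity>")
        case False
        then obtain m :: nat where m: "imp i \<omega> = ennreal (real m * h)" using grid(2)[OF \<omega>] by blast
        have "real (n + k) * h + r < real m * h \<longleftrightarrow> n + k < m"
        proof
          assume "n + k < m"
          then have "real (n + k) * h + h \<le> real m * h"
            using h mult_right_mono[of "real (n + k) + 1" "real m" h] by (simp add: algebra_simps)
          then show "real (n + k) * h + r < real m * h" using r by simp
        next
          assume "real (n + k) * h + r < real m * h"
          then have "real (n + k) * h < real m * h" using r by linarith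
          then show "n + k < m" using h by simp
        qed
        moreover have "real (n + k) * h < real m * h \<longleftrightarrow> n + k < m"
          using h by (simp only: mult_less_cancel_right_pos of_nat_less_iff)
        moreover have "0 \<le> real (n + k) * h" "0 \<le> real (n + k) * h + r" using h r by simp_all
        ultimately show ?thesis unfolding m by (simp only: ennreal_less_iff)
      qed (simp add: less_top[symmetric])
      moreover have "?s \<le> ?s + real k * h + r" using h r by simp
      ultimately show ?thesis
        unfolding skel_def bt_def eq using b_step[OF r, of "n + k"] by (simp del: of_nat_add)
    qed
    have "run i (\<lambda>x. f x - \<delta>) \<omega> = (\<integral>u. bt u * (f (X (max 0 u) (\<omega> i)) - \<delta>) \<partial>lborel)"
      by (simp add: run_real[OF True] s bt_def)
    also have "\<dots> = (\<Sum>k<L. \<integral>r. indicator {0..<h} r * (bt (?s + real k * h + r)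
        * (f (X (max 0 (?s + real k * h + r)) (\<omega> i)) - \<delta>)) \<partial>lborel)"
      unfolding bt_def by (rule skel_integral(1)[OF s(2) h L(2)[OF s(2)] measurable_path[OF bcontfun_borel[OF g] \<omega>] G])
    also have "\<dots> = (\<Sum>k<L. cell i h k (\<lambda>x. f x - \<delta>) \<omega>)"
    proof (intro sum.cong refl)
      fix k
      have "(\<integral>r. indicator {0..<h} r * (bt (?s + real k * h + r) * (f (X (max 0 (?s + real k * h + r)) (\<omega> i)) - \<delta>)) \<partial>lborel)
        = (\<integral>r. skel ?s h (imp i \<omega>) k * (indicator {0..<h} r * (f (X (max 0 (?s + real k * h + r)) (\<omega> i)) - \<delta>)) \<partial>lborel)"
        by (intro Bochner_Integration.integral_cong refl) (simp add: exact split: split_indicator)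
      then show "(\<integral>r. indicator {0..<h} r * (bt (?s + real k * h + r) * (f (X (max 0 (?s + real k * h + r)) (\<omega> i)) - \<delta>)) \<partial>lborel)
        = cell i h k (\<lambda>x. f x - \<delta>) \<omega>"
        using h by (simp add: cell_def Z_skel[OF True] s)
    qed
    finally show ?thesis .
  next
    case False
    then have "start i \<omega> = \<infinity>" by (metis infinity_ennreal_def top.not_eq_extremum)
    then show ?thesis by (simp add: cell_def Z_infinite run_infinite)
  qed
  have "expectation (run i (\<lambda>x. f x - \<delta>)) = expectation (\<lambda>\<omega>. \<Sum>k<L. cell i h k (\<lambda>x. f x - \<delta>) \<omega>)"
    using run by (intro Bochner_Integration.integral_cong) auto
  also have "\<dots> = (\<Sum>k<L. expectation (cell i h k (\<lambda>x. f x - \<delta>)))"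
    by (intro Bochner_Integration.integral_sum expectation_cell(2)[OF g h])
  finally have 2: "expectation (run i (\<lambda>x. f x - \<delta>)) = (\<Sum>k<L. expectation (cell i h k (\<lambda>x. f x - \<delta>)))" .
  \<comment> \<open>The impulse time is itself a point of the skeleton, so stopping involves no
    delay.\<close>
  have stopped: "wt (imp i \<omega>) * \<phi> (stopped_pos i h \<omega>) = wt (imp i \<omega>) * \<phi> (imp_pos i \<omega>)" if \<omega>: "\<omega> \<in> space Q" for \<omega>
  proof (cases "imp i \<omega> = \<infinity>")
    case False
    then obtain m :: nat where m: "imp i \<omega> = ennreal (real m * h)" using grid(2)[OF \<omega>] by blast
    then have "start i \<omega> \<noteq> \<infinity>" using start_le_imp[OF \<omega>, of i] by (auto simp: top_unique)
    then obtain n where n: "start i \<omega> = ennreal (real n * h)" using grid(1)[OF \<omega>] by blast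
    have "real n * h \<le> real m * h" using start_le_imp[OF \<omega>, of i] h by (simp add: m n)
    then have nm: "n \<le> m" using h by simp
    have "(real m * h - real n * h) / h = real_of_int (int (m - n))" using h nm by (simp add: field_simps of_nat_diff)
    then have "nat \<lceil>(real m * h - real n * h) / h\<rceil> = m - n" by (simp only: ceiling_of_int nat_int)
    moreover have "real n * h + real (m - n) * h = real m * h" using nm by (simp add: of_nat_diff algebra_simps)
    ultimately show ?thesis using h by (simp add: stopped_pos_def pos_def imp_pos_def m n)
  qed (simp add: wt_def)
  have "expectation (\<lambda>\<omega>. wt (imp i \<omega>) * \<phi> (imp_pos i \<omega>)) = expectation (\<lambda>\<omega>. wt (imp i \<omega>) * \<phi> (stopped_pos i h \<omega>))"
    by (intro Bochner_Integration.integral_cong refl) (rule stopped[symmetric])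
  also have "\<dots> \<le> expectation (jump i h L \<phi>)"
  proof (rule integral_mono[OF _ integrable_jump[OF \<phi>(1)]])
    show "integrable Q (\<lambda>\<omega>. wt (imp i \<omega>) * \<phi> (stopped_pos i h \<omega>))" by (rule integrable_wt[OF \<phi>(1)]) measurable
  qed (rule jump_lower[OF _ h L(2) \<phi>(2)])
  finally show ?thesis
    using dynkin[OF \<phi>(1) h L(1), of i] 1 2 by (simp add: pos_0)
qed

lemma integrable_cost:
  fixes k :: "'e \<Rightarrow> 'e \<Rightarrow> real"
  assumes k: "(\<lambda>(x, \<xi>). k x \<xi>) \<in> bcontfun" and [measurable]: "p \<in> Q \<rightarrow>\<^sub>M borel" "q \<in> Q \<rightarrow>\<^sub>M borel"
  shows "integrable Q (\<lambda>\<omega>. wt (imp i \<omega>) * k (p \<omega>) (q \<omega>))"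
proof -
  have k2: "continuous_on UNIV (\<lambda>x. k (fst x) (snd x))"
    using k by (auto simp: bcontfun_def case_prod_beta')
  obtain B where B: "0 \<le> B" "\<And>x. \<bar>case x of (x, \<xi>) \<Rightarrow> k x \<xi>\<bar> \<le> B" using bcontfun_bound[OF k] by blast
  have [measurable]: "(\<lambda>\<omega>. k (p \<omega>) (q \<omega>)) \<in> borel_measurable Q"
    by (rule borel_measurable_continuous_Pair[OF _ _ k2]) measurable
  show ?thesis
  proof (rule integrable_bounded[where B = B])
    have "\<bar>wt (imp i \<omega>)\<bar> * \<bar>k (p \<omega>) (q \<omega>)\<bar> \<le> 1 * B" for \<omega>
      using B(2)[of "(p \<omega>, q \<omega>)"] wt_nonneg wt_le_1 by (intro mult_mono) auto
    then show "\<bar>wt (imp i \<omega>) * k (p \<omega>) (q \<omega>)\<bar> \<le> B" for \<omega> by (simp add: abs_mult)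
  qed measurable
qed

text \<open>The stopped skeleton time exceeds the impulse time by at most the mesh and never
  precedes it, so right continuity of the path suffices.\<close>

lemma stopped_pos_tendsto:
  assumes \<omega>: "\<omega> \<in> space Q" and h: "0 < h" and fin: "imp i \<omega> < \<infinity>"
  shows "(\<lambda>M. stopped_pos i (h / real (Suc M)) \<omega>) \<longlonglongrightarrow> imp_pos i \<omega>"
proof -
  define s t where "s = enn2real (start i \<omega>)" and "t = enn2real (imp i \<omega>)"
  have st: "0 \<le> s" "s \<le> t"
    using start_le_imp[OF \<omega>, of i] fin by (auto simp: s_def t_def intro!: enn2real_mono)
  define T where "T M = s + real (nat \<lceil>(t - s) / (h / real (Suc M))\<rceil>) * (h / real (Suc M))" for M
  have T: "t \<le> T M" "T M \<le> t + h / real (Suc M)" for M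
  proof -
    define e where "e = h / real (Suc M)"
    have e: "0 < e" using h by (simp add: e_def)
    have "0 \<le> (t - s) / e" using st e by simp
    then have n: "real (nat \<lceil>(t - s) / e\<rceil>) = real_of_int \<lceil>(t - s) / e\<rceil>" by simp
    have "(t - s) / e \<le> real_of_int \<lceil>(t - s) / e\<rceil>" "real_of_int \<lceil>(t - s) / e\<rceil> \<le> (t - s) / e + 1" by linarith+
    from this[THEN mult_right_mono, of e]
    have "t - s \<le> real_of_int \<lceil>(t - s) / e\<rceil> * e" "real_of_int \<lceil>(t - s) / e\<rceil> * e \<le> t - s + e"
      using e by (simp_all add: distrib_right)
    then show "t \<le> T M" "T M \<le> t + h / real (Suc M)"
      unfolding T_def e_def[symmetric] n by linarith+
  qed
  have "T \<longlonglongrightarrow> t"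
  proof (rule tendsto_sandwich[of "\<lambda>_. t" _ _ "\<lambda>M. t + h / real (Suc M)"])
    have "(\<lambda>M. t + h * inverse (real (Suc M))) \<longlonglongrightarrow> t + h * 0"
      by (intro tendsto_intros LIMSEQ_inverse_real_of_nat)
    then show "(\<lambda>M. t + h / real (Suc M)) \<longlonglongrightarrow> t" by (simp add: divide_inverse del: of_nat_Suc)
  qed (use T in auto)
  moreover have "0 \<le> t" using st by simp
  ultimately have "(\<lambda>M. X (T M) (\<omega> i)) \<longlonglongrightarrow> X t (\<omega> i)"
    using T(1) by (intro X_right_seq coordinate_in_space \<omega>)
  moreover have "stopped_pos i (h / real (Suc M)) \<omega> = X (T M) (\<omega> i)" for M
  proof -
    have "0 \<le> T M" using T(1)[of M] st by linarith
    then show ?thesis unfolding stopped_pos_def pos_def T_def s_def t_def by (simp add: max_def)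
  qed
  ultimately show ?thesis using st by (simp add: imp_pos_def t_def max_def)
qed

text \<open>The potential is the average \<open>v\<close> of u with step e = h / (M + 1). It
  inherits \<open>step\<close> for the step e and \<eta> for the impulses, and M then tends to
  infinity with n fixed. In the term 2 C, one C bounds the telescoped loss of weight and the other
  the value of \<open>v\<close> left after n coordinates.\<close>

theorem lower_finite:
  assumes u: "u \<in> bcontfun" "\<And>x. 0 \<le> u x" "\<And>x. u x \<le> C" and f: "f \<in> bcontfun"
    and k: "(\<lambda>(x, \<xi>). k x \<xi>) \<in> bcontfun" and h: "0 < h"
    and step: "\<And>x. u x - trans_op h u x \<le> h * f x"
    and \<delta>: "\<And>r x. 0 \<le> r \<Longrightarrow> r \<le> h \<Longrightarrow> f x \<le> trans_op r f x + \<delta>"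
    and \<eta>: "\<And>r x \<xi>. 0 \<le> r \<Longrightarrow> r \<le> h \<Longrightarrow> trans_op r u x \<le> k x \<xi> + \<eta> + trans_op r u \<xi>"
  shows "0 \<le> (\<Sum>i<n. expectation (run i (\<lambda>x. f x + \<delta>))
      + expectation (\<lambda>\<omega>. wt (imp i \<omega>) * k (imp_pos i \<omega>) (start_pos (Suc i) \<omega>))
      + \<eta> * expectation (\<lambda>\<omega>. wt (imp i \<omega>))) + 2 * C"
proof -
  have g: "(\<lambda>x. f x + \<delta>) \<in> bcontfun" using f by (auto simp: continuous_iff intro!: continuous_intros)
  obtain G where G: "0 \<le> G" "\<And>x. \<bar>f x + \<delta>\<bar> \<le> G" using bcontfun_bound[OF g] by blast
  have C: "0 \<le> C" using u(2,3) order_trans by blast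
  define A where "A M i = expectation (\<lambda>\<omega>. wt (imp i \<omega>) * k (stopped_pos i (h / real (Suc M)) \<omega>) (start_pos (Suc i) \<omega>))" for M i
  define R where "R i = expectation (run i (\<lambda>x. f x + \<delta>))" for i
  define w where "w i = expectation (\<lambda>\<omega>. wt (start i \<omega>))" for i
  have w: "0 \<le> w i" "w i \<le> 1" for i
  proof -
    show "0 \<le> w i" unfolding w_def by (intro integral_nonneg_AE AE_I2 wt_nonneg)
    have "w i \<le> expectation (\<lambda>\<omega>. 1)"
      unfolding w_def by (intro integral_mono integrable_wt1) (auto simp: wt_le_1)
    then show "w i \<le> 1" by (simp add: prob_space)
  qed
  have wS: "expectation (\<lambda>\<omega>. wt (imp i \<omega>)) = w (Suc i)" for i by (simp add: w_def start_Suc)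
  have fin: "0 \<le> (\<Sum>i<n. R i + A M i + \<eta> * w (Suc i)) + real n * (G * (h / real (Suc M))) + 2 * C" for M
  proof -
    define e where "e = h / real (Suc M)"
    have e: "0 < e" "real (Suc M) * e = h" using h by (auto simp: e_def)
    define v where "v = avg (Suc M) e u"
    have v: "v \<in> bcontfun" "\<And>x. 0 \<le> v x" "\<And>x. v x \<le> C"
      unfolding v_def using u e by (auto intro!: avg_bcontfun avg_bounds)
    have vstep: "v x - trans_op e v x \<le> e * f x" for x
    proof -
      have "v x - trans_op e v x = (u x - trans_op h u x) / real (Suc M)"
        unfolding v_def using avg_step[OF u(1) less_imp_le[OF e(1)], of "Suc M"] by (simp only: e(2))
      also have "\<dots> \<le> h * f x / real (Suc M)" by (rule divide_right_mono[OF step]) simp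
      finally show ?thesis by (simp add: e_def)
    qed
    have vimp: "v x \<le> k x \<xi> + \<eta> + v \<xi>" for x \<xi>
      unfolding v_def
    proof (rule avg_impulse[OF u(1) less_imp_le[OF e(1)]])
      show "trans_op r u x \<le> k x \<xi> + \<eta> + trans_op r u \<xi>" if "0 \<le> r" "r \<le> real (Suc M) * e" for r
        using \<eta> that unfolding e(2) by blast
    qed simp
    define a where "a i = expectation (\<lambda>\<omega>. wt (start i \<omega>) * v (start_pos i \<omega>))" for i
    have aS: "a (Suc i) = expectation (\<lambda>\<omega>. wt (imp i \<omega>) * v (start_pos (Suc i) \<omega>))" for i
      by (simp add: a_def start_Suc)
    have a0: "0 \<le> a i" "a i \<le> C" for i
    proof -
      show "0 \<le> a i" unfolding a_def using v by (intro integral_nonneg_AE AE_I2 mult_nonneg_nonneg wt_nonneg)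
      have "wt (start i \<omega>) * v (start_pos i \<omega>) \<le> 1 * C" for \<omega>
        using v C wt_nonneg wt_le_1 by (intro mult_mono) auto
      then have "a i \<le> expectation (\<lambda>\<omega>. C)"
        unfolding a_def by (intro integral_mono integrable_wt v) auto
      then show "a i \<le> C" by (simp add: prob_space)
    qed
    have seg: "a i \<le> R i + G * e + C * (w i - w (Suc i)) + (A M i + a (Suc i) + \<eta> * w (Suc i))" for i
    proof -
      have i1: "integrable Q (\<lambda>\<omega>. wt (imp i \<omega>) * k (stopped_pos i e \<omega>) (start_pos (Suc i) \<omega>))"
        using k by (rule integrable_cost) measurable
      have i2: "integrable Q (\<lambda>\<omega>. wt (imp i \<omega>) * v (start_pos (Suc i) \<omega>))"
        using v(1) by (rule integrable_wt) measurable
      have i3: "integrable Q (\<lambda>\<omega>. wt (imp i \<omega>))" by (rule integrable_wt1) measurable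
      \<comment> \<open>The impulse is charged as if it led from the delayed position to the true
        new state; \<open>Alim\<close> below removes the delay from the cost.\<close>
      have "expectation (\<lambda>\<omega>. wt (imp i \<omega>) * v (stopped_pos i e \<omega>))
        \<le> expectation (\<lambda>\<omega>. wt (imp i \<omega>) * k (stopped_pos i e \<omega>) (start_pos (Suc i) \<omega>)
            + wt (imp i \<omega>) * v (start_pos (Suc i) \<omega>) + \<eta> * wt (imp i \<omega>))"
      proof (rule integral_mono)
        show "integrable Q (\<lambda>\<omega>. wt (imp i \<omega>) * v (stopped_pos i e \<omega>))"
          using v(1) by (rule integrable_wt) measurable
        fix \<omega>
        have "wt (imp i \<omega>) * v (stopped_pos i e \<omega>)
            \<le> wt (imp i \<omega>) * (k (stopped_pos i e \<omega>) (start_pos (Suc i) \<omega>) + \<eta> + v (start_pos (Suc i) \<omega>))"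
          by (intro mult_left_mono vimp wt_nonneg)
        then show "wt (imp i \<omega>) * v (stopped_pos i e \<omega>)
            \<le> wt (imp i \<omega>) * k (stopped_pos i e \<omega>) (start_pos (Suc i) \<omega>)
              + wt (imp i \<omega>) * v (start_pos (Suc i) \<omega>) + \<eta> * wt (imp i \<omega>)"
          by (simp add: algebra_simps)
      qed (use i1 i2 i3 in simp)
      also have "\<dots> = A M i + a (Suc i) + \<eta> * w (Suc i)"
        using i1 i2 i3 by (simp add: A_def aS wS e_def)
      finally have "expectation (\<lambda>\<omega>. wt (imp i \<omega>) * v (stopped_pos i e \<omega>)) \<le> A M i + a (Suc i) + \<eta> * w (Suc i)" .
      moreover have "f x \<le> trans_op r f x + \<delta>" if "0 \<le> r" "r \<le> e" for r x
      proof -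
        have "e \<le> h" using h by (simp add: e_def field_simps)
        then show ?thesis using that by (intro \<delta>) auto
      qed
      ultimately show ?thesis
        using segment_upper[OF v f G(2) e(1) vstep, of i] by (simp add: a_def R_def w_def wS)
    qed
    have "a 0 \<le> (\<Sum>i<n. R i + A M i + \<eta> * w (Suc i)) + real n * (G * e) + C * (w 0 - w n) + a n"
    proof (induction n)
      case (Suc n)
      then show ?case using seg[of n] by (simp add: algebra_simps)
    qed simp
    moreover have "C * (w 0 - w n) \<le> C * 1" using w[of 0] w[of n] C by (intro mult_left_mono) auto
    ultimately show ?thesis using a0[of 0] a0[of n] by (simp add: e_def)
  qed
  obtain B where B: "0 \<le> B" "\<And>x. \<bar>case x of (x, \<xi>) \<Rightarrow> k x \<xi>\<bar> \<le> B" using bcontfun_bound[OF k] by blast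
  \<comment> \<open>Only the cost still depends on the delayed position, and it is jointly
    continuous; u and \<open>v\<close> have disappeared by telescoping, apart from their
    bound.\<close>
  have Alim: "(\<lambda>M. A M i) \<longlonglongrightarrow> expectation (\<lambda>\<omega>. wt (imp i \<omega>) * k (imp_pos i \<omega>) (start_pos (Suc i) \<omega>))" for i
    unfolding A_def
  proof (rule integral_dominated_convergence)
    show "(\<lambda>\<omega>. wt (imp i \<omega>) * k (imp_pos i \<omega>) (start_pos (Suc i) \<omega>)) \<in> borel_measurable Q"
      by (rule borel_measurable_integrable[OF integrable_cost[OF k]]) measurable
    show "(\<lambda>\<omega>. wt (imp i \<omega>) * k (stopped_pos i (h / real (Suc M)) \<omega>) (start_pos (Suc i) \<omega>)) \<in> borel_measurable Q" for M
      by (rule borel_measurable_integrable[OF integrable_cost[OF k]]) measurable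
    show "integrable Q (\<lambda>\<omega>. B)" by simp
    show "AE \<omega> in Q. (\<lambda>M. wt (imp i \<omega>) * k (stopped_pos i (h / real (Suc M)) \<omega>) (start_pos (Suc i) \<omega>))
        \<longlonglongrightarrow> wt (imp i \<omega>) * k (imp_pos i \<omega>) (start_pos (Suc i) \<omega>)"
    proof (rule AE_I2)
      fix \<omega> assume \<omega>: "\<omega> \<in> space Q"
      show "(\<lambda>M. wt (imp i \<omega>) * k (stopped_pos i (h / real (Suc M)) \<omega>) (start_pos (Suc i) \<omega>))
        \<longlonglongrightarrow> wt (imp i \<omega>) * k (imp_pos i \<omega>) (start_pos (Suc i) \<omega>)"
      proof (cases "imp i \<omega> < \<infinity>")
        case True
        have kc: "continuous_on UNIV (\<lambda>(x, \<xi>). k x \<xi>)" using k by (auto simp: bcontfun_def)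
        have "(\<lambda>M. (stopped_pos i (h / real (Suc M)) \<omega>, start_pos (Suc i) \<omega>))
            \<longlonglongrightarrow> (imp_pos i \<omega>, start_pos (Suc i) \<omega>)"
          by (intro tendsto_Pair stopped_pos_tendsto[OF \<omega> h True] tendsto_const)
        from continuous_on_tendsto_compose[OF kc this]
        show ?thesis by (intro tendsto_mult tendsto_const) simp
      qed (simp add: wt_def)
    qed
    show "AE \<omega> in Q. norm (wt (imp i \<omega>) * k (stopped_pos i (h / real (Suc M)) \<omega>) (start_pos (Suc i) \<omega>)) \<le> B" for M
    proof (rule AE_I2)
      fix \<omega>
      let ?k = "k (stopped_pos i (h / real (Suc M)) \<omega>) (start_pos (Suc i) \<omega>)"
      have "\<bar>wt (imp i \<omega>)\<bar> * \<bar>?k\<bar> \<le> 1 * B"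
        using B(2)[of "(stopped_pos i (h / real (Suc M)) \<omega>, start_pos (Suc i) \<omega>)"] wt_nonneg wt_le_1
        by (intro mult_mono) auto
      then show "norm (wt (imp i \<omega>) * ?k) \<le> B" by (simp add: abs_mult)
    qed
  qed
  have "(\<lambda>M. (\<Sum>i<n. R i + A M i + \<eta> * w (Suc i)) + real n * (G * (h * inverse (real (Suc M)))) + 2 * C)
    \<longlonglongrightarrow> (\<Sum>i<n. R i + expectation (\<lambda>\<omega>. wt (imp i \<omega>) * k (imp_pos i \<omega>) (start_pos (Suc i) \<omega>)) + \<eta> * w (Suc i))
      + real n * (G * (h * 0)) + 2 * C"
    by (intro tendsto_intros Alim LIMSEQ_inverse_real_of_nat)
  from LIMSEQ_le_const[OF this, of 0] fin show ?thesis
    by (simp add: R_def wS divide_inverse del: of_nat_Suc)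
qed

text \<open>The potential before an impulse equals the impulse cost plus the potential after it, so
  the segments telescope. What remains is the initial potential, at most C, and the final one, which
  is dropped because it is nonnegative.\<close>

theorem upper_finite:
  assumes u: "u \<in> bcontfun" "\<And>x. 0 \<le> u x" "\<And>x. u x \<le> C" and f: "f \<in> bcontfun"
    and k: "(\<lambda>(x, \<xi>). k x \<xi>) \<in> bcontfun" and h: "0 < h"
    and grid: "\<And>i \<omega>. \<omega> \<in> space Q \<Longrightarrow> imp i \<omega> = \<infinity> \<or> (\<exists>n::nat. imp i \<omega> = ennreal (real n * h))"
    and b_step: "\<And>(n::nat) r. 0 \<le> r \<Longrightarrow> r < h \<Longrightarrow> b (real n * h + r) = b (real n * h)"
    and step: "\<And>i \<omega> n. \<omega> \<in> space Q \<Longrightarrow> start i \<omega> \<le> ennreal (real n * h) \<Longrightarrow> ennreal (real n * h) < imp i \<omega> \<Longrightarrow>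
      u (X (real n * h) (\<omega> i)) - trans_op h u (X (real n * h) (\<omega> i)) = h * f (X (real n * h) (\<omega> i))"
    and \<delta>: "\<And>r x. 0 \<le> r \<Longrightarrow> r \<le> h \<Longrightarrow> trans_op r f x \<le> f x + \<delta>"
    and jump: "\<And>i. AE \<omega> in Q. imp i \<omega> < \<infinity> \<longrightarrow>
      u (imp_pos i \<omega>) = k (imp_pos i \<omega>) (start_pos (Suc i) \<omega>) + u (start_pos (Suc i) \<omega>)"
  shows "(\<Sum>i<n. expectation (run i (\<lambda>x. f x - \<delta>))
      + expectation (\<lambda>\<omega>. wt (imp i \<omega>) * k (imp_pos i \<omega>) (start_pos (Suc i) \<omega>))) \<le> C"
proof -
  have C: "0 \<le> C" using u(2,3) order_trans by blast
  define a where "a i = expectation (\<lambda>\<omega>. wt (start i \<omega>) * u (start_pos i \<omega>))" for i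
  have a0: "0 \<le> a i" "a i \<le> C" for i
  proof -
    show "0 \<le> a i" unfolding a_def using u by (intro integral_nonneg_AE AE_I2 mult_nonneg_nonneg wt_nonneg)
    have "wt (start i \<omega>) * u (start_pos i \<omega>) \<le> 1 * C" for \<omega>
      using u C wt_nonneg wt_le_1 by (intro mult_mono) auto
    then have "a i \<le> expectation (\<lambda>\<omega>. C)"
      unfolding a_def by (intro integral_mono integrable_wt u) auto
    then show "a i \<le> C" by (simp add: prob_space)
  qed
  have seg: "expectation (run i (\<lambda>x. f x - \<delta>))
      + expectation (\<lambda>\<omega>. wt (imp i \<omega>) * k (imp_pos i \<omega>) (start_pos (Suc i) \<omega>)) + a (Suc i) \<le> a i" for i
  proof -
    have i1: "integrable Q (\<lambda>\<omega>. wt (imp i \<omega>) * k (imp_pos i \<omega>) (start_pos (Suc i) \<omega>))"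
      using k by (rule integrable_cost) measurable
    have i2: "integrable Q (\<lambda>\<omega>. wt (imp i \<omega>) * u (start_pos (Suc i) \<omega>))"
      using u(1) by (rule integrable_wt) measurable
    have i3: "integrable Q (\<lambda>\<omega>. wt (imp i \<omega>) * u (imp_pos i \<omega>))"
      using u(1) by (rule integrable_wt) measurable
    have "expectation (\<lambda>\<omega>. wt (imp i \<omega>) * u (imp_pos i \<omega>))
      = expectation (\<lambda>\<omega>. wt (imp i \<omega>) * k (imp_pos i \<omega>) (start_pos (Suc i) \<omega>) + wt (imp i \<omega>) * u (start_pos (Suc i) \<omega>))"
    proof (rule integral_cong_AE)
      show "AE \<omega> in Q. wt (imp i \<omega>) * u (imp_pos i \<omega>)
          = wt (imp i \<omega>) * k (imp_pos i \<omega>) (start_pos (Suc i) \<omega>) + wt (imp i \<omega>) * u (start_pos (Suc i) \<omega>)"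
        using jump[of i] by eventually_elim (auto simp: wt_def algebra_simps)
    qed (use i1 i2 i3 in auto)
    also have "\<dots> = expectation (\<lambda>\<omega>. wt (imp i \<omega>) * k (imp_pos i \<omega>) (start_pos (Suc i) \<omega>)) + a (Suc i)"
      using i1 i2 by (simp add: a_def start_Suc)
    finally have 1: "expectation (\<lambda>\<omega>. wt (imp i \<omega>) * u (imp_pos i \<omega>))
      = expectation (\<lambda>\<omega>. wt (imp i \<omega>) * k (imp_pos i \<omega>) (start_pos (Suc i) \<omega>)) + a (Suc i)" .
    have "start i \<omega> = \<infinity> \<or> (\<exists>n::nat. start i \<omega> = ennreal (real n * h))" if "\<omega> \<in> space Q" for \<omega>
      using grid[OF that] by (cases i) (auto simp: start_0 start_Suc intro: exI[of _ 0])
    then have "expectation (run i (\<lambda>x. f x - \<delta>)) + expectation (\<lambda>\<omega>. wt (imp i \<omega>) * u (imp_pos i \<omega>))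
      \<le> expectation (\<lambda>\<omega>. wt (start i \<omega>) * u (start_pos i \<omega>))"
    proof (rule segment_lower[OF u(1,2) f h])
      show "imp i \<omega> = \<infinity> \<or> (\<exists>n::nat. imp i \<omega> = ennreal (real n * h))" if "\<omega> \<in> space Q" for \<omega>
        using that by (rule grid)
    qed (assumption | rule b_step step \<delta>)+
    then show ?thesis using 1 by (simp add: a_def)
  qed
  have "(\<Sum>i<n. expectation (run i (\<lambda>x. f x - \<delta>))
      + expectation (\<lambda>\<omega>. wt (imp i \<omega>) * k (imp_pos i \<omega>) (start_pos (Suc i) \<omega>))) + a n \<le> a 0"
  proof (induction n)
    case (Suc n)
    then show ?case using seg[of n] by simp
  qed simp
  then show ?thesis using a0[of n] a0[of 0] by simp
qed

section \<open>Unbounded number of impulses\<close>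

definition slot :: "nat \<Rightarrow> (nat \<Rightarrow> 'w) \<Rightarrow> real \<Rightarrow> bool"
  where "slot i \<omega> s \<longleftrightarrow> start i \<omega> \<le> ennreal s \<and> ennreal s < imp i \<omega>"

lemma imp_le_start:
  assumes "\<omega> \<in> space Q" "i < j" shows "imp i \<omega> \<le> start j \<omega>"
  using assms(2)
proof (induction j)
  case (Suc j)
  then show ?case
    using start_le_imp[OF assms(1), of j] by (cases "i = j") (auto simp: start_Suc)
qed simp

lemma slot_unique:
  assumes \<omega>: "\<omega> \<in> space Q" and "slot i \<omega> s" "slot j \<omega> s" shows "i = j"
proof (rule ccontr)
  assume "i \<noteq> j"
  then consider "i < j" | "j < i" by linarith
  then show False
    using assms(2,3) imp_le_start[OF \<omega>, of i j] imp_le_start[OF \<omega>, of j i]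
    by cases (auto simp: slot_def dest!: order_trans leD)
qed

lemma controlled_process_slot:
  assumes "\<omega> \<in> space Q" "slot i \<omega> s" shows "controlled_process X V \<omega> s = X s (\<omega> i)"
proof -
  have "(THE i. start i \<omega> \<le> ennreal s \<and> ennreal s < imp i \<omega>) = i"
    using assms slot_unique[OF assms(1)] by (intro the_equality) (auto simp: slot_def)
  then show ?thesis using assms(2) unfolding controlled_process_def slot_def by auto
qed

lemma measurable_slot_pred [measurable]: "Measurable.pred (Q \<Otimes>\<^sub>M lborel) (\<lambda>z. slot i (fst z) (snd z))"
proof -
  have [measurable]: "(\<lambda>z. start i (fst z)) \<in> borel_measurable (Q \<Otimes>\<^sub>M lborel)"
    "(\<lambda>z. imp i (fst z)) \<in> borel_measurable (Q \<Otimes>\<^sub>M lborel)"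
    by (rule measurable_compose[OF measurable_fst measurable_start],
        rule measurable_compose[OF measurable_fst measurable_imp])
  show ?thesis unfolding slot_def by measurable
qed

text \<open>A jointly measurable version of the controlled process. The least index replaces the
  unique one, which makes the choice measurable without assuming that the slots are disjoint;
  coordinate 0 is the dummy, as in \<open>controlled_process\<close>.\<close>

definition Y :: "(nat \<Rightarrow> 'w) \<times> real \<Rightarrow> 'e"
  where "Y z = X (max 0 (snd z)) (fst z (if \<exists>i. slot i (fst z) (snd z) then LEAST i. slot i (fst z) (snd z) else 0))"

lemma measurable_Y [measurable]: "Y \<in> Q \<Otimes>\<^sub>M lborel \<rightarrow>\<^sub>M borel"
  unfolding Y_def[abs_def]
  by (rule measurable_compose_countable[where f = "\<lambda>i z. X (max 0 (snd z)) (fst z i)"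
        and g = "\<lambda>z. if \<exists>i. slot i (fst z) (snd z) then LEAST i. slot i (fst z) (snd z) else 0"]) measurable

lemma Y_slot: "\<omega> \<in> space Q \<Longrightarrow> slot i \<omega> s \<Longrightarrow> Y (\<omega>, s) = X (max 0 s) (\<omega> i)"
  unfolding Y_def by (auto intro!: arg_cong[where f = \<omega>] arg_cong[where f = "X _"] Least_equality dest: slot_unique)

lemma Y_controlled_process: "\<omega> \<in> space Q \<Longrightarrow> 0 \<le> s \<Longrightarrow> controlled_process X V \<omega> s = Y (\<omega>, s)"
proof (cases "\<exists>i. slot i \<omega> s")
  case False
  then show "0 \<le> s \<Longrightarrow> controlled_process X V \<omega> s = Y (\<omega>, s)"
    unfolding controlled_process_def Y_def slot_def by (auto simp: max_def)
qed (auto simp: controlled_process_slot Y_slot max_def)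

definition bpos :: "real \<Rightarrow> real" where "bpos s = (if 0 \<le> s then b s else 0)"

lemma measurable_bpos [measurable]: "bpos \<in> borel_measurable borel"
  unfolding bpos_def[abs_def] by measurable

lemma bpos_nonneg: "0 \<le> bpos s" by (simp add: bpos_def b_nonneg)

lemma bpos_support: obtains T where "\<And>s. bpos s \<le> indicator {0..T} s"
proof -
  obtain T where T: "\<And>s. T < s \<Longrightarrow> b s = 0" using b_support by blast
  have "bpos s \<le> indicator {0..T} s" for s
    using T[of s] b_le_1[of s] by (auto simp: bpos_def indicator_def)
  then show ?thesis using that by blast
qed

lemma integrable_bpos: "integrable lborel bpos"
proof -
  obtain T where T: "\<And>s. bpos s \<le> indicator {0..T} s" using bpos_support by blast
  show ?thesis using T bpos_nonneg by (intro integrable_bounded_support[of _ 1 0 T]) auto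
qed

definition total :: "('e \<Rightarrow> real) \<Rightarrow> real"
  where "total g = (\<integral>z. bpos (snd z) * g (Y z) \<partial>(Q \<Otimes>\<^sub>M lborel))"

lemma integrable_total:
  assumes g: "g \<in> bcontfun"
  shows "integrable (Q \<Otimes>\<^sub>M lborel) (\<lambda>z. bpos (snd z) * g (Y z))"
proof -
  obtain B where B: "0 \<le> B" "\<And>x. \<bar>g x\<bar> \<le> B" using bcontfun_bound[OF g] by blast
  obtain T where T: "\<And>s. bpos s \<le> indicator {0..T} s" using bpos_support by blast
  note [measurable] = bcontfun_borel[OF g]
  show ?thesis
  proof (rule integrable_pair_bounded[where B = B and a = 0 and c = T])
    fix \<omega> r
    have "\<bar>bpos r\<bar> * \<bar>g (Y (\<omega>, r))\<bar> \<le> indicator {0..T} r * B"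
      using B T bpos_nonneg by (intro mult_mono) auto
    then show "\<bar>bpos (snd (\<omega>, r)) * g (Y (\<omega>, r))\<bar> \<le> B * indicator {0..T} r"
      by (simp add: abs_mult mult.commute)
  qed measurable
qed

definition mass :: real where "mass = integral\<^sup>L lborel bpos"

lemma total_const: "total (\<lambda>_. a) = a * mass"
proof -
  interpret pair_sigma_finite Q lborel ..
  have "(\<lambda>_ :: 'e. a) \<in> bcontfun" by (rule const_in_bcontfun)
  from integral_fst'[OF integrable_total[OF this]] show ?thesis
    by (auto simp: total_def mass_def prob_space mult.commute)
qed

lemma total_add: "g \<in> bcontfun \<Longrightarrow> g' \<in> bcontfun \<Longrightarrow> total (\<lambda>x. g x + g' x) = total g + total g'"
  unfolding total_def distrib_left by (intro Bochner_Integration.integral_add integrable_total)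

lemma total_add_const: "g \<in> bcontfun \<Longrightarrow> total (\<lambda>x. g x + a) = total g + a * mass"
  using total_add[OF _ const_in_bcontfun, of g a] by (simp add: total_const)

lemma total_mono: "g \<in> bcontfun \<Longrightarrow> g' \<in> bcontfun \<Longrightarrow> (\<And>x. g x \<le> g' x) \<Longrightarrow> total g \<le> total g'"
  unfolding total_def by (intro integral_mono integrable_total mult_left_mono bpos_nonneg)

definition partial :: "nat \<Rightarrow> ('e \<Rightarrow> real) \<Rightarrow> (nat \<Rightarrow> 'w) \<times> real \<Rightarrow> real"
  where "partial n g z = (if \<exists>i<n. slot i (fst z) (snd z) then bpos (snd z) * g (Y z) else 0)"

text \<open>The time slots of different coordinates are disjoint, so at each time at most one of the
  running terms is nonzero.\<close>

lemma sum_run: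
  assumes g: "g \<in> bcontfun"
  shows "(\<Sum>i<n. expectation (run i g)) = (\<integral>z. partial n g z \<partial>(Q \<Otimes>\<^sub>M lborel))"
proof -
  let ?r = "\<lambda>i z. (if 0 \<le> snd z \<and> start i (fst z) \<le> ennreal (snd z)
      \<and> ennreal (snd z) < imp i (fst z) then b (snd z) else 0) * g (X (max 0 (snd z)) (fst z i))"
  have "(\<Sum>i<n. expectation (run i g)) = (\<integral>z. (\<Sum>i<n. ?r i z) \<partial>(Q \<Otimes>\<^sub>M lborel))"
    unfolding expectation_run[OF g] by (rule Bochner_Integration.integral_sum[symmetric, OF integrable_slot[OF g]])
  also have "\<dots> = (\<integral>z. partial n g z \<partial>(Q \<Otimes>\<^sub>M lborel))"
  proof (rule Bochner_Integration.integral_cong[OF refl])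
    fix z :: "(nat \<Rightarrow> 'w) \<times> real" assume "z \<in> space (Q \<Otimes>\<^sub>M lborel)"
    then obtain \<omega> s where z: "z = (\<omega>, s)" "\<omega> \<in> space Q" by (auto simp: space_pair_measure)
    have r: "?r i z = (if slot i \<omega> s then bpos s * g (Y z) else 0)" for i
      using Y_slot[OF z(2), of i s] by (auto simp: z slot_def bpos_def)
    show "(\<Sum>i<n. ?r i z) = partial n g z"
    proof (cases "\<exists>i<n. slot i \<omega> s")
      case True
      then obtain i where i: "i < n" "slot i \<omega> s" by blast
      have "(\<Sum>i<n. ?r i z) = (\<Sum>j<n. if j = i then bpos s * g (Y z) else 0)"
        unfolding r using i(2) slot_unique[OF z(2)] by (intro sum.cong) auto
      then show ?thesis using i True by (simp add: partial_def z)
    next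
      case False
      then have "(\<Sum>i<n. ?r i z) = (\<Sum>i<n. 0)" unfolding r by (intro sum.cong) auto
      also have "\<dots> = partial n g z" using False unfolding partial_def z by auto
      finally show ?thesis .
    qed
  qed
  finally show ?thesis .
qed

lemma measurable_partial:
  assumes [measurable]: "g \<in> borel_measurable borel"
  shows "partial n g \<in> borel_measurable (Q \<Otimes>\<^sub>M lborel)"
  unfolding partial_def[abs_def] by measurable

lemma sum_run_bound:
  assumes g: "g \<in> bcontfun" and G: "\<And>x. \<bar>g x\<bar> \<le> G"
  shows "\<bar>\<Sum>i<n. expectation (run i g)\<bar> \<le> G * mass"
proof -
  have G0: "0 \<le> G" using G abs_ge_zero order_trans by blast
  have int: "integrable (Q \<Otimes>\<^sub>M lborel) (\<lambda>z. bpos (snd z) * G)"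
    using integrable_total[OF const_in_bcontfun] .
  have le: "\<bar>partial n g z\<bar> \<le> bpos (snd z) * G" for z
    using G[of "Y z"] G0 bpos_nonneg[of "snd z"] by (auto simp: partial_def abs_mult intro: mult_left_mono)
  have "\<bar>\<integral>z. partial n g z \<partial>(Q \<Otimes>\<^sub>M lborel)\<bar> \<le> (\<integral>z. \<bar>partial n g z\<bar> \<partial>(Q \<Otimes>\<^sub>M lborel))"
    by (rule integral_abs_bound)
  also have "\<dots> \<le> (\<integral>z. bpos (snd z) * G \<partial>(Q \<Otimes>\<^sub>M lborel))"
  proof (rule integral_mono[OF _ int le])
    show "integrable (Q \<Otimes>\<^sub>M lborel) (\<lambda>z. \<bar>partial n g z\<bar>)"
    proof (rule Bochner_Integration.integrable_bound[OF int])
      show "AE z in Q \<Otimes>\<^sub>M lborel. norm \<bar>partial n g z\<bar> \<le> norm (bpos (snd z) * G)"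
      proof (rule AE_I2)
        show "norm \<bar>partial n g z\<bar> \<le> norm (bpos (snd z) * G)" for z
          using le[of z] abs_ge_self[of "bpos (snd z) * G"] unfolding real_norm_def abs_abs by linarith
      qed
    qed (use measurable_partial[OF bcontfun_borel[OF g]] in measurable)
  qed
  also have "\<dots> = G * mass" using total_const[of G] by (simp add: total_def)
  finally show ?thesis by (simp add: sum_run[OF g])
qed

text \<open>
  If the expected weights of the impulses vanish in the limit, the impulse times leave the support
  of the weight almost surely, and the coordinates in use exhaust it.
\<close>

lemma sum_run_tendsto:
  assumes g: "g \<in> bcontfun" and m: "0 < m" "\<And>s. b s = 0 \<or> m \<le> b s"
    and w: "(\<lambda>n. expectation (\<lambda>\<omega>. wt (imp n \<omega>))) \<longlonglongrightarrow> 0"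
  shows "(\<lambda>n. \<Sum>i<n. expectation (run i g)) \<longlonglongrightarrow> total g"
proof -
  interpret pair_sigma_finite Q lborel ..
  note gm[measurable] = bcontfun_borel[OF g]
  \<comment> \<open>The event that no impulse time leaves the support: there a nonzero weight is at
    least m. By Markov's inequality m times its probability is below every expected weight, hence
    0.\<close>
  define A where "A = {\<omega> \<in> space Q. \<forall>n. m \<le> wt (imp n \<omega>)}"
  have A[measurable]: "A \<in> sets Q" unfolding A_def by measurable
  have "m * prob A \<le> expectation (\<lambda>\<omega>. wt (imp n \<omega>))" for n
  proof -
    have "m * prob A = expectation (\<lambda>\<omega>. m * indicator A \<omega>)" by simp
    also have "\<dots> \<le> expectation (\<lambda>\<omega>. wt (imp n \<omega>))"
    proof (rule integral_mono)
      show "integrable Q (\<lambda>\<omega>. wt (imp n \<omega>))" by (rule integrable_wt1) measurable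
      show "integrable Q (\<lambda>\<omega>. m * indicator A \<omega> :: real)"
        by (intro integrable_mult_right integrable_real_indicator) (auto simp: emeasure_eq_measure)
      show "m * indicator A \<omega> \<le> wt (imp n \<omega>)" for \<omega> using wt_nonneg by (auto simp: A_def indicator_def)
    qed
    finally show ?thesis .
  qed
  then have "m * prob A \<le> 0" by (rule LIMSEQ_le_const[OF w, OF exI, OF allI, OF impI])
  then have "prob A = 0" using m(1) by (simp add: mult_le_0_iff antisym)
  then have "emeasure Q A = 0" by (simp add: emeasure_eq_measure)
  then have AEQ: "AE \<omega> in Q. \<exists>n. wt (imp n \<omega>) < m"
    by (intro AE_I[of _ _ A]) (auto simp: A_def not_less)
  \<comment> \<open>If no slot contains s, then by induction every starting time is at most s. So is
    every impulse time, and their weights are at least b s \<ge> m, against the assumption on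
    n.\<close>
  have ex: "\<exists>i. slot i \<omega> s" if \<omega>: "\<omega> \<in> space Q" "wt (imp n \<omega>) < m" and s: "0 \<le> s" "bpos s \<noteq> 0" for \<omega> n s
  proof (rule ccontr)
    assume no: "\<not> ?thesis"
    have st: "start j \<omega> \<le> ennreal s" for j
    proof (induction j)
      case (Suc j)
      then show ?case using no by (auto simp: slot_def start_Suc not_less)
    qed (simp add: start_0)
    have "imp n \<omega> \<le> ennreal s" using st[of "Suc n"] by (simp add: start_Suc)
    from wt_mono[OF this] have "b s < m" using \<omega>(2) s(1) by (simp add: wt_ennreal)
    then show False using m(2)[of s] s by (auto simp: bpos_def)
  qed
  have "(\<lambda>n. \<integral>z. partial n g z \<partial>(Q \<Otimes>\<^sub>M lborel)) \<longlonglongrightarrow> (\<integral>z. bpos (snd z) * g (Y z) \<partial>(Q \<Otimes>\<^sub>M lborel))"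
  proof (rule integral_dominated_convergence)
    show "integrable (Q \<Otimes>\<^sub>M lborel) (\<lambda>z. \<bar>bpos (snd z) * g (Y z)\<bar>)"
      by (rule integrable_abs[OF integrable_total[OF g]])
    show "partial n g \<in> borel_measurable (Q \<Otimes>\<^sub>M lborel)" for n by (rule measurable_partial) measurable
    show "AE z in Q \<Otimes>\<^sub>M lborel. norm (partial n g z) \<le> \<bar>bpos (snd z) * g (Y z)\<bar>" for n
      by (intro AE_I2) (auto simp: partial_def)
    show "AE z in Q \<Otimes>\<^sub>M lborel. (\<lambda>n. partial n g z) \<longlonglongrightarrow> bpos (snd z) * g (Y z)"
    proof -
      have "AE z in Q \<Otimes>\<^sub>M lborel. \<exists>n. wt (imp n (fst z)) < m"
      proof (rule AE_pair_measure)
        have [measurable]: "(\<lambda>z. imp n (fst z)) \<in> borel_measurable (Q \<Otimes>\<^sub>M lborel)" for n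
          by (rule measurable_compose[OF measurable_fst measurable_imp])
        show "{z \<in> space (Q \<Otimes>\<^sub>M lborel). \<exists>n. wt (imp n (fst z)) < m} \<in> sets (Q \<Otimes>\<^sub>M lborel)" by measurable
        show "AE \<omega> in Q. AE s in lborel. \<exists>n. wt (imp n (fst (\<omega>, s))) < m"
          using AEQ by eventually_elim (auto intro: AE_I2)
      qed
      then show ?thesis
      proof (rule AE_mp, intro AE_I2 impI)
        fix z :: "(nat \<Rightarrow> 'w) \<times> real"
        assume z: "z \<in> space (Q \<Otimes>\<^sub>M lborel)" and "\<exists>n. wt (imp n (fst z)) < m"
        then obtain n where n: "wt (imp n (fst z)) < m" by blast
        have \<omega>: "fst z \<in> space Q" using z by (auto simp: space_pair_measure)
        show "(\<lambda>n. partial n g z) \<longlonglongrightarrow> bpos (snd z) * g (Y z)"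
        proof (cases "\<exists>i. slot i (fst z) (snd z)")
          case True
          then obtain i where "slot i (fst z) (snd z)" by blast
          then have "partial n g z = bpos (snd z) * g (Y z)" if "Suc i \<le> n" for n
            using that by (auto simp: partial_def intro!: exI[of _ i])
          then show ?thesis by (intro tendsto_eventually eventually_sequentiallyI[of "Suc i"])
        next
          case False
          then have "bpos (snd z) = 0" using ex[OF \<omega> n, of "snd z"] by (auto simp: bpos_def)
          then show ?thesis using False by (simp add: partial_def)
        qed
      qed
    qed
  qed (use gm in measurable)
  then show ?thesis by (simp add: sum_run[OF g] total_def)
qed

definition imp_cost :: "('e \<Rightarrow> 'e \<Rightarrow> real) \<Rightarrow> nat \<Rightarrow> real"
  where "imp_cost k i = expectation (\<lambda>\<omega>. wt (imp i \<omega>) * k (imp_pos i \<omega>) (start_pos (Suc i) \<omega>))"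

lemma weight_le_imp_cost:
  assumes k: "(\<lambda>(x, \<xi>). k x \<xi>) \<in> bcontfun" and c0: "0 < c0" "\<And>x \<xi>. c0 \<le> k x \<xi>"
  shows "expectation (\<lambda>\<omega>. wt (imp i \<omega>)) \<le> imp_cost k i / c0" "0 \<le> imp_cost k i"
proof -
  have "c0 * expectation (\<lambda>\<omega>. wt (imp i \<omega>)) = expectation (\<lambda>\<omega>. wt (imp i \<omega>) * c0)" by simp
  also have "\<dots> \<le> imp_cost k i"
    unfolding imp_cost_def
  proof (rule integral_mono)
    have "integrable Q (\<lambda>\<omega>. wt (imp i \<omega>))" by (rule integrable_wt1) measurable
    then show "integrable Q (\<lambda>\<omega>. wt (imp i \<omega>) * c0)" by simp
    show "integrable Q (\<lambda>\<omega>. wt (imp i \<omega>) * k (imp_pos i \<omega>) (start_pos (Suc i) \<omega>))"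
      using k by (rule integrable_cost) measurable
  qed (intro mult_left_mono c0 wt_nonneg)
  finally have *: "c0 * expectation (\<lambda>\<omega>. wt (imp i \<omega>)) \<le> imp_cost k i" .
  then show "expectation (\<lambda>\<omega>. wt (imp i \<omega>)) \<le> imp_cost k i / c0"
    using c0(1) by (simp add: field_simps)
  have "0 \<le> expectation (\<lambda>\<omega>. wt (imp i \<omega>))" by (intro integral_nonneg_AE AE_I2 wt_nonneg)
  then show "0 \<le> imp_cost k i" using * c0(1) by (meson mult_nonneg_nonneg less_imp_le order_trans)
qed

lemma summable_weights:
  assumes "(\<lambda>(x, \<xi>). k x \<xi>) \<in> bcontfun" "0 < c0" "\<And>x \<xi>. c0 \<le> k x \<xi>" and "summable (imp_cost k)"
  shows "summable (\<lambda>i. expectation (\<lambda>\<omega>. wt (imp i \<omega>)))"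
    and "(\<Sum>i. expectation (\<lambda>\<omega>. wt (imp i \<omega>))) \<le> (\<Sum>i. imp_cost k i) / c0"
proof -
  have s: "summable (\<lambda>i. imp_cost k i / c0)" using assms(4) by (rule summable_divide)
  have nn: "0 \<le> expectation (\<lambda>\<omega>. wt (imp i \<omega>))" for i by (intro integral_nonneg_AE AE_I2 wt_nonneg)
  show 1: "summable (\<lambda>i. expectation (\<lambda>\<omega>. wt (imp i \<omega>)))"
    using weight_le_imp_cost(1)[OF assms(1-3)] nn by (intro summable_comparison_test[OF _ s]) auto
  have "(\<Sum>i. expectation (\<lambda>\<omega>. wt (imp i \<omega>))) \<le> (\<Sum>i. imp_cost k i / c0)"
    using weight_le_imp_cost(1)[OF assms(1-3)] by (rule suminf_le[OF _ 1 s])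
  then show "(\<Sum>i. expectation (\<lambda>\<omega>. wt (imp i \<omega>))) \<le> (\<Sum>i. imp_cost k i) / c0"
    using suminf_divide[OF assms(4), of c0] by simp
qed

text \<open>The expected number of weighted impulses is at most the impulse cost divided by c0, so
  \<eta> per impulse is \<eta> / c0 times the impulse cost. To have the factor 1 + \<eta> / c0
  before the entire cost, \<eta> / c0 times \<open>total g\<close> is added; that term is at least
  -\<eta> / c0 * G * \<open>mass\<close>.\<close>

theorem lower_total:
  assumes u: "u \<in> bcontfun" "\<And>x. 0 \<le> u x" "\<And>x. u x \<le> C" and g: "g \<in> bcontfun" "\<And>x. \<bar>g x\<bar> \<le> G"
    and k: "(\<lambda>(x, \<xi>). k x \<xi>) \<in> bcontfun" and c0: "0 < c0" "\<And>x \<xi>. c0 \<le> k x \<xi>" and h: "0 < h"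
    and step: "\<And>x. u x - trans_op h u x \<le> h * (g x - l)"
    and \<delta>: "\<And>r x. 0 \<le> r \<Longrightarrow> r \<le> h \<Longrightarrow> g x \<le> trans_op r g x + \<delta>"
    and \<eta>: "0 \<le> \<eta>" "\<And>r x \<xi>. 0 \<le> r \<Longrightarrow> r \<le> h \<Longrightarrow> trans_op r u x \<le> k x \<xi> + \<eta> + trans_op r u \<xi>"
    and m: "0 < m" "\<And>s. b s = 0 \<or> m \<le> b s" and sm: "summable (imp_cost k)"
  shows "(l - \<delta> - \<eta> / c0 * G) * mass - 2 * C \<le> (1 + \<eta> / c0) * (total g + (\<Sum>i. imp_cost k i))"
proof -
  define f where "f x = g x + (- l)" for x
  have f: "f \<in> bcontfun" using g by (auto simp: f_def[abs_def] continuous_iff intro!: continuous_intros)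
  have f\<delta>: "(\<lambda>x. f x + \<delta>) = (\<lambda>x. g x + (\<delta> - l))" by (auto simp: f_def)
  have fb: "(\<lambda>x. f x + \<delta>) \<in> bcontfun" using f by (auto simp: continuous_iff intro!: continuous_intros)
  have Tf: "f x \<le> trans_op r f x + \<delta>" if "0 \<le> r" "r \<le> h" for r x
    using \<delta>[OF that, of x] trans_op_add[OF g(1) const_in_bcontfun that(1), of "- l" x]
    by (simp add: f_def[abs_def] trans_op_const)
  have stepf: "u x - trans_op h u x \<le> h * f x" for x using step[of x] by (simp add: f_def)
  let ?w = "\<lambda>i. expectation (\<lambda>\<omega>. wt (imp i \<omega>))"
  note sw = summable_weights[OF k c0 sm]
  have "(\<lambda>n. (\<Sum>i<n. expectation (run i (\<lambda>x. f x + \<delta>))) + (\<Sum>i<n. imp_cost k i) + \<eta> * (\<Sum>i<n. ?w i) + 2 * C)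
    \<longlonglongrightarrow> total (\<lambda>x. f x + \<delta>) + (\<Sum>i. imp_cost k i) + \<eta> * (\<Sum>i. ?w i) + 2 * C"
    by (intro tendsto_intros sum_run_tendsto[OF fb m summable_LIMSEQ_zero] summable_LIMSEQ sw sm)
  moreover have "0 \<le> (\<Sum>i<n. expectation (run i (\<lambda>x. f x + \<delta>))) + (\<Sum>i<n. imp_cost k i) + \<eta> * (\<Sum>i<n. ?w i) + 2 * C" for n
    using lower_finite[OF u f k h stepf Tf \<eta>(2), of n]
    by (simp add: imp_cost_def sum.distrib sum_distrib_left)
  ultimately have "0 \<le> total (\<lambda>x. f x + \<delta>) + (\<Sum>i. imp_cost k i) + \<eta> * (\<Sum>i. ?w i) + 2 * C"
    by (rule LIMSEQ_le_const[OF _ exI, OF _ allI, OF _ impI])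
  moreover have "total (\<lambda>x. f x + \<delta>) = total g + (\<delta> - l) * mass"
    unfolding f\<delta> by (rule total_add_const[OF g(1)])
  moreover have "\<eta> * (\<Sum>i. ?w i) \<le> \<eta> / c0 * (\<Sum>i. imp_cost k i)"
    using mult_left_mono[OF sw(2) \<eta>(1)] by simp
  moreover have "\<eta> / c0 * (- (G * mass)) \<le> \<eta> / c0 * total g"
  proof (rule mult_left_mono)
    have "total (\<lambda>_. - G) \<le> total g"
      using g(2) by (intro total_mono const_in_bcontfun g) (auto simp: abs_le_iff minus_le_iff)
    then show "- (G * mass) \<le> total g" by (simp add: total_const)
  qed (use \<eta> c0 in simp)
  ultimately show ?thesis by (simp add: algebra_simps)
qed

text \<open>Summability is a conclusion here. The finite inequality bounds the partial sums of the
  impulse costs, because the running terms are bounded by a multiple of \<open>mass\<close>; the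
  expected weights then tend to 0, which allows the passage to all coordinates.\<close>

theorem upper_total:
  assumes u: "u \<in> bcontfun" "\<And>x. 0 \<le> u x" "\<And>x. u x \<le> C" and g: "g \<in> bcontfun"
    and k: "(\<lambda>(x, \<xi>). k x \<xi>) \<in> bcontfun" and c0: "0 < c0" "\<And>x \<xi>. c0 \<le> k x \<xi>" and h: "0 < h"
    and grid: "\<And>i \<omega>. \<omega> \<in> space Q \<Longrightarrow> imp i \<omega> = \<infinity> \<or> (\<exists>n::nat. imp i \<omega> = ennreal (real n * h))"
    and b_step: "\<And>(n::nat) r. 0 \<le> r \<Longrightarrow> r < h \<Longrightarrow> b (real n * h + r) = b (real n * h)"
    and step: "\<And>i \<omega> n. \<omega> \<in> space Q \<Longrightarrow> start i \<omega> \<le> ennreal (real n * h) \<Longrightarrow> ennreal (real n * h) < imp i \<omega> \<Longrightarrow>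
      u (X (real n * h) (\<omega> i)) - trans_op h u (X (real n * h) (\<omega> i)) = h * (g (X (real n * h) (\<omega> i)) - l)"
    and \<delta>: "\<And>r x. 0 \<le> r \<Longrightarrow> r \<le> h \<Longrightarrow> trans_op r g x \<le> g x + \<delta>"
    and jump: "\<And>i. AE \<omega> in Q. imp i \<omega> < \<infinity> \<longrightarrow>
      u (imp_pos i \<omega>) = k (imp_pos i \<omega>) (start_pos (Suc i) \<omega>) + u (start_pos (Suc i) \<omega>)"
    and m: "0 < m" "\<And>s. b s = 0 \<or> m \<le> b s"
  shows "summable (imp_cost k)" "total g + (\<Sum>i. imp_cost k i) \<le> C + (l + \<delta>) * mass"
proof -
  define f where "f x = g x + (- l)" for x
  have f: "f \<in> bcontfun" using g by (auto simp: f_def[abs_def] continuous_iff intro!: continuous_intros)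
  have f\<delta>: "(\<lambda>x. f x - \<delta>) = (\<lambda>x. g x + (- (l + \<delta>)))" by (auto simp: f_def)
  have fb: "(\<lambda>x. f x - \<delta>) \<in> bcontfun" using f by (auto simp: continuous_iff intro!: continuous_intros)
  obtain G where G: "\<And>x. \<bar>f x - \<delta>\<bar> \<le> G" using bcontfun_bound[OF fb] by blast
  have Tf: "trans_op r f x \<le> f x + \<delta>" if "0 \<le> r" "r \<le> h" for r x
    using \<delta>[OF that, of x] trans_op_add[OF g(1) const_in_bcontfun that(1), of "- l" x]
    by (simp add: f_def[abs_def] trans_op_const)
  have stepf: "u (X (real n * h) (\<omega> i)) - trans_op h u (X (real n * h) (\<omega> i)) = h * f (X (real n * h) (\<omega> i))"
    if "\<omega> \<in> space Q" "start i \<omega> \<le> ennreal (real n * h)" "ennreal (real n * h) < imp i \<omega>" for i \<omega> n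
    using step[OF that] by (simp add: f_def)
  have fin: "(\<Sum>i<n. expectation (run i (\<lambda>x. f x - \<delta>))) + (\<Sum>i<n. imp_cost k i) \<le> C" for n
  proof -
    have "(\<Sum>i<n. expectation (run i (\<lambda>x. f x - \<delta>))
        + expectation (\<lambda>\<omega>. wt (imp i \<omega>) * k (imp_pos i \<omega>) (start_pos (Suc i) \<omega>))) \<le> C"
      by (rule upper_finite[OF u f k h]) (assumption | rule grid b_step stepf Tf jump)+
    then show ?thesis by (simp add: imp_cost_def sum.distrib)
  qed
  show sm: "summable (imp_cost k)"
  proof (rule summableI_nonneg_bounded[where x = "C + G * mass"])
    show "0 \<le> imp_cost k i" for i by (rule weight_le_imp_cost(2)[OF k c0])
    show "(\<Sum>i<n. imp_cost k i) \<le> C + G * mass" for n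
      using fin[of n] sum_run_bound[OF fb G, of n] by linarith
  qed
  note sw = summable_weights[OF k c0 sm]
  have "(\<lambda>n. (\<Sum>i<n. expectation (run i (\<lambda>x. f x - \<delta>))) + (\<Sum>i<n. imp_cost k i))
    \<longlonglongrightarrow> total (\<lambda>x. f x - \<delta>) + (\<Sum>i. imp_cost k i)"
    by (intro tendsto_intros sum_run_tendsto[OF fb m summable_LIMSEQ_zero] summable_LIMSEQ sw sm)
  then have "total (\<lambda>x. f x - \<delta>) + (\<Sum>i. imp_cost k i) \<le> C"
    using fin by (rule LIMSEQ_le_const2[OF _ exI, OF _ allI, OF _ impI])
  moreover have "total (\<lambda>x. f x - \<delta>) = total g + (- (l + \<delta>)) * mass"
    unfolding f\<delta> by (rule total_add_const[OF g(1)])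
  ultimately show "total g + (\<Sum>i. imp_cost k i) \<le> C + (l + \<delta>) * mass" by (simp add: algebra_simps)
qed

end

text \<open>A is bounded and the series has nonnegative terms, so the negative part has expectation
  at most K and \<open>ext_expectation\<close> never becomes a difference of infinities. The rest is
  monotone convergence.\<close>

lemma ext_expectation_sum:
  fixes A :: "'a \<Rightarrow> real" and s :: "nat \<Rightarrow> 'a \<Rightarrow> real"
  assumes M: "prob_space M" and A[measurable]: "A \<in> borel_measurable M" and K: "\<And>\<omega>. \<omega> \<in> space M \<Longrightarrow> \<bar>A \<omega>\<bar> \<le> K"
    and s: "\<And>i. integrable M (s i)" "\<And>i \<omega>. 0 \<le> s i \<omega>"
  shows "ext_expectation M (\<lambda>\<omega>. ereal (A \<omega>) + (\<Sum>i. ereal (s i \<omega>)))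
    = (if summable (\<lambda>i. integral\<^sup>L M (s i)) then ereal (integral\<^sup>L M A + (\<Sum>i. integral\<^sup>L M (s i))) else \<infinity>)"
proof -
  interpret prob_space M by fact
  have [measurable]: "s i \<in> borel_measurable M" for i using s(1) by auto
  define S where "S \<omega> = (\<Sum>i. ennreal (s i \<omega>))" for \<omega>
  have [measurable]: "S \<in> borel_measurable M" unfolding S_def[abs_def] by measurable
  define f where "f \<omega> = ereal (A \<omega>) + (\<Sum>i. ereal (s i \<omega>))" for \<omega>
  have f: "f \<omega> = ereal (A \<omega>) + enn2ereal (S \<omega>)" for \<omega>
  proof -
    have "(\<Sum>i. ereal (s i \<omega>)) = (\<Sum>i. enn2ereal (ennreal (s i \<omega>)))" using s(2) by simp
    then show ?thesis unfolding f_def S_def suminf_enn2ereal by simp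
  qed
  have [measurable]: "f \<in> borel_measurable M" unfolding f_def[abs_def] by measurable
  have E0: "0 \<le> integral\<^sup>L M (s i)" for i using s(2) by simp
  have intA: "integrable M A" using K by (intro integrable_const_bound[of _ K]) auto
  have nnS: "(\<integral>\<^sup>+\<omega>. S \<omega> \<partial>M) = (\<Sum>i. ennreal (integral\<^sup>L M (s i)))"
    unfolding S_def using s by (simp add: nn_integral_suminf nn_integral_eq_integral)
  have K0: "0 \<le> K" using K not_empty by (meson abs_ge_zero all_not_in_conv order_trans)
  have neg: "(\<integral>\<^sup>+\<omega>. e2ennreal (- f \<omega>) \<partial>M) \<le> ennreal K"
  proof -
    have "e2ennreal (- f \<omega>) \<le> ennreal K" if "\<omega> \<in> space M" for \<omega>
    proof (cases "S \<omega>")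
      case (real r)
      then show ?thesis
        using K[OF that] by (simp add: f)
    qed (simp add: f e2ennreal_neg)
    then have "(\<integral>\<^sup>+\<omega>. e2ennreal (- f \<omega>) \<partial>M) \<le> (\<integral>\<^sup>+\<omega>. ennreal K \<partial>M)" by (intro nn_integral_mono)
    then show ?thesis by (simp add: emeasure_space_1)
  qed
  show ?thesis
  proof (cases "summable (\<lambda>i. integral\<^sup>L M (s i))")
    case False
    then have "(\<integral>\<^sup>+\<omega>. S \<omega> \<partial>M) = \<infinity>"
      unfolding nnS infinity_ennreal_def using summable_suminf_not_top[where f = "\<lambda>i. integral\<^sup>L M (s i)", OF E0] by blast
    \<comment> \<open>The series exceeds the positive part of f by at most K, so the infinite
      expectation of the series passes to that positive part.\<close>
    moreover have "S \<omega> \<le> e2ennreal (f \<omega>) + ennreal K" if "\<omega> \<in> space M" for \<omega>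
    proof (cases "S \<omega>")
      case (real r)
      have "ennreal r \<le> ennreal (max 0 (A \<omega> + r) + K)"
        using K[OF that] by (intro ennreal_leI) auto
      also have "\<dots> = ennreal (max 0 (A \<omega> + r)) + ennreal K" using K0 by (intro ennreal_plus) auto
      also have "ennreal (max 0 (A \<omega> + r)) = e2ennreal (f \<omega>)"
        using real by (simp add: f max_def ennreal_neg)
      finally show ?thesis using real by simp
    qed (simp add: f)
    then have "(\<integral>\<^sup>+\<omega>. S \<omega> \<partial>M) \<le> (\<integral>\<^sup>+\<omega>. e2ennreal (f \<omega>) + ennreal K \<partial>M)" by (intro nn_integral_mono)
    moreover have "\<dots> = (\<integral>\<^sup>+\<omega>. e2ennreal (f \<omega>) \<partial>M) + ennreal K"
      by (subst nn_integral_add) (auto simp: emeasure_space_1)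
    ultimately have "(\<integral>\<^sup>+\<omega>. e2ennreal (f \<omega>) \<partial>M) = \<infinity>"
      by (simp add: top_unique ennreal_add_eq_top)
    moreover obtain x where "(\<integral>\<^sup>+\<omega>. e2ennreal (- f \<omega>) \<partial>M) = ennreal x" "0 \<le> x"
      using neg by (cases "\<integral>\<^sup>+\<omega>. e2ennreal (- f \<omega>) \<partial>M") (auto simp: top_unique)
    ultimately have "ext_expectation M f = \<infinity>" by (simp add: ext_expectation_def)
    then show ?thesis using False by (simp add: f_def[abs_def])
  next
    case True
    have nnS': "(\<integral>\<^sup>+\<omega>. S \<omega> \<partial>M) = ennreal (\<Sum>i. integral\<^sup>L M (s i))"
      unfolding nnS using E0 True by (intro suminf_ennreal2)
    have fin: "AE \<omega> in M. S \<omega> \<noteq> \<infinity>"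
      using nnS' by (intro nn_integral_PInf_AE) auto
    define R where "R \<omega> = enn2real (S \<omega>)" for \<omega>
    have [measurable]: "R \<in> borel_measurable M" unfolding R_def[abs_def] by measurable
    have nnR: "(\<integral>\<^sup>+\<omega>. ennreal (R \<omega>) \<partial>M) = ennreal (\<Sum>i. integral\<^sup>L M (s i))"
      unfolding nnS'[symmetric] using fin by (intro nn_integral_cong_AE) (auto simp: R_def less_top)
    have intR: "integrable M R"
      using nnR by (intro integrableI_nonneg) (auto simp: R_def)
    have ER: "integral\<^sup>L M R = (\<Sum>i. integral\<^sup>L M (s i))"
      using nnR E0 True by (subst integral_eq_nn_integral) (auto simp: R_def suminf_nonneg)
    define H where "H \<omega> = A \<omega> + R \<omega>" for \<omega>
    have intH: "integrable M H" unfolding H_def[abs_def] using intA intR by simp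
    have fH: "AE \<omega> in M. f \<omega> = ereal (H \<omega>)"
      using fin
    proof eventually_elim
      case (elim \<omega>)
      then show ?case by (cases "S \<omega>") (auto simp: f H_def R_def)
    qed
    have "(\<integral>\<^sup>+\<omega>. e2ennreal (f \<omega>) \<partial>M) = (\<integral>\<^sup>+\<omega>. ennreal (H \<omega>) \<partial>M)"
      "(\<integral>\<^sup>+\<omega>. e2ennreal (- f \<omega>) \<partial>M) = (\<integral>\<^sup>+\<omega>. ennreal (- H \<omega>) \<partial>M)"
      using fH by (auto intro!: nn_integral_cong_AE elim!: eventually_mono)
    moreover have "(\<integral>\<^sup>+\<omega>. ennreal (H \<omega>) \<partial>M) < \<infinity>" "(\<integral>\<^sup>+\<omega>. ennreal (- H \<omega>) \<partial>M) < \<infinity>"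
      using intH by (auto simp: real_integrable_def less_top[symmetric])
    then obtain p q where pq: "(\<integral>\<^sup>+\<omega>. ennreal (H \<omega>) \<partial>M) = ennreal p" "0 \<le> p"
        "(\<integral>\<^sup>+\<omega>. ennreal (- H \<omega>) \<partial>M) = ennreal q" "0 \<le> q"
      by (auto simp: less_top_ennreal)
    ultimately have "ext_expectation M f = ereal (p - q)" by (simp add: ext_expectation_def)
    moreover have "integral\<^sup>L M H = p - q" using real_lebesgue_integral_def[OF intH] pq by simp
    moreover have "integral\<^sup>L M H = integral\<^sup>L M A + (\<Sum>i. integral\<^sup>L M (s i))"
      unfolding H_def using intA intR ER by simp
    ultimately show ?thesis using True by (simp add: f_def[abs_def])
  qed
qed

section \<open>The grid strategy\<close>

lemma first_grid_hit_cases: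
  assumes h: "0 < h"
  obtains (none) "\<And>n::nat. s \<le> ennreal (real n * h) \<Longrightarrow>
      w (X (real n * h) \<omega>) \<noteq> impulse_operator c h w (X (real n * h) \<omega>)" "first_grid_hit X c h w s \<omega> = \<infinity>"
  | (hit) n :: nat where "s \<le> ennreal (real n * h)"
      "w (X (real n * h) \<omega>) = impulse_operator c h w (X (real n * h) \<omega>)"
      "first_grid_hit X c h w s \<omega> = ennreal (real n * h)"
proof -
  let ?S = "{n::nat. s \<le> ennreal (real n * h) \<and> w (X (real n * h) \<omega>) = impulse_operator c h w (X (real n * h) \<omega>)}"
  show thesis
  proof (cases "?S = {}")
    case True
    show thesis
    proof (rule none)
      show "first_grid_hit X c h w s \<omega> = \<infinity>" unfolding first_grid_hit_def True by simp
      show "w (X (real n * h) \<omega>) \<noteq> impulse_operator c h w (X (real n * h) \<omega>)"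
        if "s \<le> ennreal (real n * h)" for n using True that by blast
    qed
  next
    case False
    define m where "m = (LEAST n. n \<in> ?S)"
    have ex: "\<exists>n. n \<in> ?S" using False by blast
    have m: "m \<in> ?S" "\<And>n. n \<in> ?S \<Longrightarrow> m \<le> n"
      unfolding m_def by (rule LeastI_ex[OF ex], rule Least_le)
    have "first_grid_hit X c h w s \<omega> = ennreal (real m * h)"
      unfolding first_grid_hit_def
    proof (rule antisym)
      show "(INF n\<in>?S. ennreal (real n * h)) \<le> ennreal (real m * h)" using m(1) by (rule INF_lower)
      show "ennreal (real m * h) \<le> (INF n\<in>?S. ennreal (real n * h))"
        using m(2) h by (intro INF_greatest ennreal_leI mult_right_mono) auto
    qed
    then show thesis using hit[of m] m(1) by blast
  qed
qed

lemma first_grid_hit_ge: "s \<le> first_grid_hit X c h w s \<omega>"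
  unfolding first_grid_hit_def by (rule INF_greatest) simp

lemma first_grid_hit_le:
  "s \<le> ennreal (real n * h) \<Longrightarrow> w (X (real n * h) \<omega>) = impulse_operator c h w (X (real n * h) \<omega>) \<Longrightarrow>
    first_grid_hit X c h w s \<omega> \<le> ennreal (real n * h)"
  unfolding first_grid_hit_def by (rule INF_lower) simp

context feller_process
begin

lemma filtration_copies: "filtration (space (copies N)) (copies_filtration N F i)"
proof
  fix s t :: ennreal assume "s \<le> t"
  then show "sets (copies_filtration N F i s) \<subseteq> sets (copies_filtration N F i t)"
    unfolding copies_filtration_def
    by (intro sets_PiM_mono) (auto simp: space_F dest: sets_F_mono[THEN subsetD])
qed (rule space_copies_filtration)

lemma sets_copies_filtration_mono:
  assumes "i \<le> j" "s \<le> t" shows "sets (copies_filtration N F i s) \<subseteq> sets (copies_filtration N F j t)"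
  unfolding copies_filtration_def
proof (rule sets_PiM_mono)
  have "sets (sigma (space N) {}) \<subseteq> sets (F t)" by (rule sets_trivial_subset) (rule space_F)
  then show "sets (if k \<le> i then F s else sigma (space N) {}) \<subseteq> sets (if k \<le> j then F t else sigma (space N) {})" for k
    using assms sets_F_mono[of s t] by auto
qed (auto simp: space_F space_measure_of_conv)

lemma measurable_copies_coordinate:
  assumes "ennreal r \<le> t" "0 \<le> r"
  shows "(\<lambda>\<omega>. X r (\<omega> i)) \<in> copies_filtration N F i t \<rightarrow>\<^sub>M borel"
proof -
  have "(\<lambda>\<omega>. \<omega> i) \<in> copies_filtration N F i t \<rightarrow>\<^sub>M (if i \<le> i then F t else sigma (space N) {})"
    unfolding copies_filtration_def by (rule measurable_component_singleton) simp
  moreover have "X r \<in> F t \<rightarrow>\<^sub>M borel"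
    using adapted[OF assms(2)] sets_F_mono[OF assms(1)] space_F by (auto simp: measurable_def)
  ultimately show ?thesis by (auto intro: measurable_compose)
qed

context
  fixes c :: "'e \<Rightarrow> 'e \<Rightarrow> real" and h :: real and w :: "'e \<Rightarrow> real" and sel :: "'e \<Rightarrow> 'e" and \<xi>\<^sub>0 :: 'e and l :: real
  assumes c: "(\<lambda>(x, \<xi>). c x \<xi>) \<in> bcontfun" and c_nonneg: "\<And>x \<xi>. 0 \<le> c x \<xi>" and h: "0 < h"
    and w: "w \<in> bcontfun" and sel: "measurable_minimiser c h w sel"
begin

lemma impulse_operator_le: "impulse_operator c h w x \<le> c x \<xi> / h + w \<xi>"
proof -
  obtain B where B: "\<And>x. \<bar>w x\<bar> \<le> B" using bcontfun_bound[OF w] by blast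
  have "bdd_below (range (\<lambda>\<xi>. c x \<xi> / h + w \<xi>))"
  proof (rule bdd_belowI2)
    show "- B \<le> c x \<xi> / h + w \<xi>" for \<xi>
      using B[of \<xi>] divide_nonneg_pos[OF c_nonneg h, of x \<xi>] by linarith
  qed
  then show ?thesis unfolding impulse_operator_def by (rule cINF_lower) simp
qed

lemma impulse_operator_sel: "impulse_operator c h w x = c x (sel x) / h + w (sel x)"
proof (rule antisym[OF impulse_operator_le])
  show "c x (sel x) / h + w (sel x) \<le> impulse_operator c h w x"
    unfolding impulse_operator_def
    using sel by (intro cINF_greatest) (auto simp: measurable_minimiser_def is_arg_min_def not_less)
qed

lemma measurable_sel: "sel \<in> borel \<rightarrow>\<^sub>M borel"
  using sel by (simp add: measurable_minimiser_def)

lemma hit_set: "{x. w x = impulse_operator c h w x} \<in> sets borel"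
proof -
  note [measurable] = measurable_sel bcontfun_borel[OF w]
  have c2: "continuous_on UNIV (\<lambda>x. c (fst x) (snd x))"
    using c by (auto simp: bcontfun_def case_prod_beta')
  have "(\<lambda>x. c x (sel x)) \<in> borel_measurable borel"
    by (rule borel_measurable_continuous_Pair[OF _ measurable_sel c2]) simp
  then have [measurable]: "impulse_operator c h w \<in> borel_measurable borel"
    unfolding impulse_operator_sel[abs_def] by measurable
  show ?thesis by measurable
qed

lemma hat_time_grid: "hat_time X c h w i \<omega> = \<infinity> \<or> (\<exists>n::nat. hat_time X c h w i \<omega> = ennreal (real n * h))"
  by (cases i) (auto intro: first_grid_hit_cases[OF h])

text \<open>The infimum over grid times is attained unless it is infinite, so the event is a
  countable union over grid times up to t. At t = \<infinity> the left side holds even without any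
  hit.\<close>

lemma first_grid_hit_le_iff:
  assumes "t \<noteq> \<infinity>"
  shows "first_grid_hit X c h w s \<omega> \<le> t \<longleftrightarrow>
    (\<exists>n::nat. s \<le> ennreal (real n * h) \<and> ennreal (real n * h) \<le> t \<and> X (real n * h) \<omega> \<in> {x. w x = impulse_operator c h w x})"
    (is "?L \<longleftrightarrow> ?R")
proof
  assume ?L
  then show ?R
    using assms by (cases rule: first_grid_hit_cases[OF h, where X = X and c = c and w = w and s = s and \<omega> = \<omega>])
      (auto simp: top_unique)
next
  assume ?R
  then show ?L by (auto intro: first_grid_hit_le order_trans)
qed

text \<open>Hits are sought at grid times only, so all that must be known about the random time s
  is, at each grid time, whether it has passed.\<close>

lemma stopping_time_hit:
  assumes S: "\<And>n::nat. Measurable.pred (copies_filtration N F i (ennreal (real n * h))) (\<lambda>\<omega>. s \<omega> \<le> ennreal (real n * h))"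
  shows "stopping_time (copies_filtration N F i) (\<lambda>\<omega>. first_grid_hit X c h w (s \<omega>) (\<omega> i))"
proof
  fix t :: ennreal
  show "Measurable.pred (copies_filtration N F i t) (\<lambda>\<omega>. first_grid_hit X c h w (s \<omega>) (\<omega> i) \<le> t)"
  proof (cases "t = \<infinity>")
    case False
    have "Measurable.pred (copies_filtration N F i t) (\<lambda>\<omega>. \<exists>n::nat. s \<omega> \<le> ennreal (real n * h) \<and>
        ennreal (real n * h) \<le> t \<and> X (real n * h) (\<omega> i) \<in> {x. w x = impulse_operator c h w x})"
    proof (rule pred_intros_countable(2))
      fix n :: nat
      show "Measurable.pred (copies_filtration N F i t) (\<lambda>\<omega>. s \<omega> \<le> ennreal (real n * h) \<and>
        ennreal (real n * h) \<le> t \<and> X (real n * h) (\<omega> i) \<in> {x. w x = impulse_operator c h w x})"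
      proof (cases "ennreal (real n * h) \<le> t")
        case True
        have "Measurable.pred (copies_filtration N F i t) (\<lambda>\<omega>. s \<omega> \<le> ennreal (real n * h))"
          by (rule pred_mono_sets[OF S sets_copies_filtration_mono[OF order_refl True]])
             (simp add: space_copies_filtration)
        moreover have "Measurable.pred (copies_filtration N F i t)
            (\<lambda>\<omega>. X (real n * h) (\<omega> i) \<in> {x. w x = impulse_operator c h w x})"
          using h by (intro pred_sets2[OF hit_set] measurable_copies_coordinate True) auto
        ultimately show ?thesis using True by simp
      qed simp
    qed
    then show ?thesis unfolding first_grid_hit_le_iff[OF False] .
  qed simp
qed

lemma stopping_time_hat: "stopping_time (copies_filtration N F i) (hat_time X c h w i)"
proof (induction i)
  case 0
  then show ?case using stopping_time_hit[where i = 0 and s = "\<lambda>_. 0"] by (simp add: hat_time.simps(1)[abs_def])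
next
  case (Suc i)
  have "Measurable.pred (copies_filtration N F (Suc i) (ennreal (real n * h))) (\<lambda>\<omega>. hat_time X c h w i \<omega> \<le> ennreal (real n * h))" for n
    by (rule pred_mono_sets[OF stopping_timeD[OF Suc.IH] sets_copies_filtration_mono])
       (auto simp: space_copies_filtration)
  from stopping_time_hit[OF this] show ?case by (simp add: hat_time.simps(2)[abs_def])
qed

lemma measurable_hat_state:
  "snd (hat_strategy X c h w sel \<xi>\<^sub>0 i)
    \<in> filtration.pre_sigma (space (copies N)) (copies_filtration N F i) (hat_time X c h w i) \<rightarrow>\<^sub>M borel"
proof -
  interpret cf: filtration "space (copies N)" "copies_filtration N F i" by (rule filtration_copies)
  let ?\<tau> = "hat_time X c h w i" and ?s = "snd (hat_strategy X c h w sel \<xi>\<^sub>0 i)"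
  show ?thesis
  proof (rule measurableI)
    fix B :: "'e set" assume B: "B \<in> sets borel"
    have "Measurable.pred (cf.pre_sigma ?\<tau>) (\<lambda>\<omega>. ?s \<omega> \<in> B)"
    proof (rule cf.pred_pre_sigmaI[OF stopping_time_hat])
      fix t
      \<comment> \<open>The impulse time has countably many values. The value \<infinity>, where the
        state is the constant \<open>\<xi>\<^sub>0\<close>, matters only for t =
        \<infinity>.\<close>
      have eq: "(?s \<omega> \<in> B \<and> ?\<tau> \<omega> \<le> t) \<longleftrightarrow>
          (\<exists>n::nat. ?\<tau> \<omega> = ennreal (real n * h) \<and> ennreal (real n * h) \<le> t \<and> sel (X (real n * h) (\<omega> i)) \<in> B)
          \<or> (t = \<infinity> \<and> ?\<tau> \<omega> = \<infinity> \<and> \<xi>\<^sub>0 \<in> B)" for \<omega>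
      proof (cases "?\<tau> \<omega> = \<infinity>")
        case True
        then show ?thesis by (auto simp: hat_strategy_def top_unique)
      next
        case False
        then obtain n :: nat where n: "?\<tau> \<omega> = ennreal (real n * h)" using hat_time_grid by blast
        have e: "enn2real (?\<tau> \<omega>) = real n * h" using h by (simp add: n)
        have "n = m" if "ennreal (real n * h) = ennreal (real m * h)" for m :: nat
          using that h by (auto simp: ennreal_inj)
        then show ?thesis
          unfolding hat_strategy_def snd_conv e using False by (auto simp: n)
      qed
      have "Measurable.pred (copies_filtration N F i t) (\<lambda>\<omega>. \<exists>n::nat. ?\<tau> \<omega> = ennreal (real n * h) \<and>
          ennreal (real n * h) \<le> t \<and> sel (X (real n * h) (\<omega> i)) \<in> B)"
      proof (rule pred_intros_countable(2))
        fix n :: nat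
        show "Measurable.pred (copies_filtration N F i t) (\<lambda>\<omega>. ?\<tau> \<omega> = ennreal (real n * h) \<and>
          ennreal (real n * h) \<le> t \<and> sel (X (real n * h) (\<omega> i)) \<in> B)"
        proof (cases "ennreal (real n * h) \<le> t")
          case True
          have "Measurable.pred (copies_filtration N F i t) (\<lambda>\<omega>. ?\<tau> \<omega> = ennreal (real n * h))"
            by (rule pred_mono_sets[OF cf.stopping_time_eq_const[OF stopping_time_hat]
                  sets_copies_filtration_mono[OF order_refl True]]) (simp add: space_copies_filtration)
          moreover have "Measurable.pred (copies_filtration N F i t) (\<lambda>\<omega>. sel (X (real n * h) (\<omega> i)) \<in> B)"
            using h by (intro pred_sets2[OF B] measurable_compose[OF _ measurable_sel]
                measurable_copies_coordinate True) auto
          ultimately show ?thesis using True by simp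
        qed simp
      qed
      moreover have "Measurable.pred (copies_filtration N F i t) (\<lambda>\<omega>. t = \<infinity> \<and> ?\<tau> \<omega> = \<infinity> \<and> \<xi>\<^sub>0 \<in> B)"
        using cf.stopping_time_eq_const[OF stopping_time_hat, of \<infinity>] by (cases "t = \<infinity>") auto
      ultimately show "Measurable.pred (copies_filtration N F i t) (\<lambda>\<omega>. ?s \<omega> \<in> B \<and> ?\<tau> \<omega> \<le> t)"
        unfolding eq by (rule pred_intros_logic)
    qed
    then show "?s -` B \<inter> space (cf.pre_sigma ?\<tau>) \<in> sets (cf.pre_sigma ?\<tau>)"
      by (simp add: pred_def vimage_def Int_def conj_commute)
  qed simp
qed

lemma hat_strategy_grid: "hat_strategy X c h w sel \<xi>\<^sub>0 \<in> grid_strategies N F h"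
proof -
  have "hat_time X c h w i \<omega> \<le> hat_time X c h w (Suc i) \<omega>" for i \<omega>
    by (simp add: first_grid_hit_ge)
  then show ?thesis
    using stopping_time_hat measurable_hat_state hat_time_grid
    unfolding grid_strategies_def strategies_def by (simp add: hat_strategy_def)
qed

lemma hat_time_start:
  "imp_time (hat_strategy X c h w sel \<xi>\<^sub>0) i \<omega>
    = first_grid_hit X c h w (start_time (hat_strategy X c h w sel \<xi>\<^sub>0) i \<omega>) (\<omega> i)"
  by (cases i) (auto simp: hat_strategy_def start_time_def)

end

end

section \<open>Bounds for the functionals\<close>

text \<open>Negative times get the value of \<beta> at 0, which makes the weight decreasing on the
  whole line. The end T is included because impulses at time T are charged.\<close>

definition cutoff :: "(real \<Rightarrow> real) \<Rightarrow> real \<Rightarrow> real \<Rightarrow> real"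
  where "cutoff \<beta> T s = (if s \<le> T then \<beta> (max 0 s) else 0)"

text \<open>
  Rounding times down to the grid makes the weight constant on the cells of a grid strategy, so that its
  sums over grid points are exact integrals; this changes the total mass by at most \<open>h\<close>.
\<close>

definition grid_weight :: "real \<Rightarrow> (real \<Rightarrow> real) \<Rightarrow> real \<Rightarrow> real"
  where "grid_weight h b s = b (real_of_int \<lfloor>s / h\<rfloor> * h)"

lemma weight_cutoff:
  assumes "\<And>t. 0 \<le> t \<Longrightarrow> 0 < \<beta> t \<and> \<beta> t \<le> 1" "\<And>s t. 0 \<le> s \<Longrightarrow> s \<le> t \<Longrightarrow> \<beta> t \<le> \<beta> s"
  shows "weight (cutoff \<beta> T)"
proof
  have \<beta>: "0 \<le> \<beta> (max 0 s)" "\<beta> (max 0 s) \<le> 1" for s using assms(1)[of "max 0 s"] by auto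
  then show "0 \<le> cutoff \<beta> T s" "cutoff \<beta> T s \<le> 1" for s by (auto simp: cutoff_def)
  show "antimono (cutoff \<beta> T)"
    by (intro antimonoI) (auto simp: cutoff_def \<beta> intro!: assms(2))
  show "\<exists>T'. \<forall>s>T'. cutoff \<beta> T s = 0" by (auto simp: cutoff_def intro!: exI[of _ T])
qed

text \<open>Supplies the gap m between 0 and the nonzero weights that the limit over infinitely many
  coordinates needs.\<close>

lemma cutoff_gap:
  assumes "\<And>s t. 0 \<le> s \<Longrightarrow> s \<le> t \<Longrightarrow> \<beta> t \<le> \<beta> s" "0 \<le> T"
  shows "cutoff \<beta> T s = 0 \<or> \<beta> T \<le> cutoff \<beta> T s"
  using assms by (auto simp: cutoff_def)

lemma weight_grid_weight:
  assumes "weight b" and h: "0 < h" shows "weight (grid_weight h b)"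
proof -
  interpret weight b by fact
  show ?thesis
  proof
    show "antimono (grid_weight h b)"
    proof (rule antimonoI)
      fix s t :: real assume "s \<le> t"
      then have "s / h \<le> t / h" using h by (intro divide_right_mono) auto
      then have "real_of_int \<lfloor>s / h\<rfloor> * h \<le> real_of_int \<lfloor>t / h\<rfloor> * h"
        using h by (intro mult_right_mono) (auto intro: floor_mono)
      then show "grid_weight h b t \<le> grid_weight h b s" unfolding grid_weight_def by (rule b_mono)
    qed
    show "0 \<le> grid_weight h b s" "grid_weight h b s \<le> 1" for s
      by (auto simp: grid_weight_def b_nonneg b_le_1)
    obtain T where T: "\<And>s. T < s \<Longrightarrow> b s = 0" using b_support by blast
    have "grid_weight h b s = 0" if "T + h < s" for s
    proof -
      have "s / h < real_of_int \<lfloor>s / h\<rfloor> + 1" by linarith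
      then have "s < (real_of_int \<lfloor>s / h\<rfloor> + 1) * h" using pos_divide_less_eq[OF h] by blast
      then have "T < real_of_int \<lfloor>s / h\<rfloor> * h" using that by (simp add: algebra_simps)
      then show ?thesis by (simp add: grid_weight_def T)
    qed
    then show "\<exists>T. \<forall>s>T. grid_weight h b s = 0" by blast
  qed
qed

lemma grid_weight_grid:
  assumes "0 < h" "0 \<le> r" "r < h" shows "grid_weight h b (real n * h + r) = b (real n * h)"
proof -
  have "\<lfloor>(real n * h + r) / h\<rfloor> = int n"
    using assms by (intro floor_unique) (auto simp: field_simps)
  then show ?thesis by (simp add: grid_weight_def)
qed

lemma (in weight) grid_weight_bounds:
  assumes h: "0 < h"
  shows "b s \<le> grid_weight h b s" "h \<le> s \<Longrightarrow> grid_weight h b s \<le> b (s - h)"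
proof -
  have "real_of_int \<lfloor>s / h\<rfloor> \<le> s / h" "s / h < real_of_int \<lfloor>s / h\<rfloor> + 1" by linarith+
  then have "real_of_int \<lfloor>s / h\<rfloor> * h \<le> s" "s < (real_of_int \<lfloor>s / h\<rfloor> + 1) * h"
    using pos_le_divide_eq[OF h] pos_divide_less_eq[OF h] by blast+
  then show "b s \<le> grid_weight h b s" "h \<le> s \<Longrightarrow> grid_weight h b s \<le> b (s - h)"
    unfolding grid_weight_def by (auto intro!: b_mono simp: algebra_simps)
qed

context weighted_process
begin

lemma bpos_cutoff: "b = cutoff \<beta> T \<Longrightarrow> bpos s = (if 0 \<le> s \<and> s \<le> T then \<beta> s else 0)"
  unfolding bpos_def cutoff_def by (auto simp: fun_eq_iff max_def)

lemma wt_cutoff: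
  assumes b: "b = cutoff \<beta> T" and T: "0 \<le> T"
  shows "wt t = (if t \<le> ennreal T then \<beta> (enn2real t) else 0)"
proof (cases t)
  case (real r)
  then show ?thesis using T unfolding wt_def unfolding b cutoff_def by (simp add: ennreal_le_iff max_def)
next
  case top
  then show ?thesis by (simp add: wt_def top_unique)
qed

text \<open>Links the abstract totals to the cost of the problem. The case distinction replaces any
  discussion of accumulating impulse times: if the expected costs are summable, the formula is one
  of real numbers.\<close>

lemma ext_expectation_cost:
  assumes b: "b = cutoff \<beta> T" and T: "0 \<le> T" and g: "g \<in> bcontfun"
    and k: "(\<lambda>(x, \<xi>). k x \<xi>) \<in> bcontfun" "\<And>x \<xi>. 0 \<le> k x \<xi>"
  shows "ext_expectation Q (cost_upto X g k \<beta> V T)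
    = (if summable (imp_cost k) then ereal (total g + (\<Sum>i. imp_cost k i)) else \<infinity>)"
proof -
  interpret pair_sigma_finite Q lborel ..
  define A where "A \<omega> = (\<integral>s. bpos s * g (Y (\<omega>, s)) \<partial>lborel)" for \<omega>
  define s where "s i \<omega> = wt (imp i \<omega>) * k (imp_pos i \<omega>) (start_pos (Suc i) \<omega>)" for i \<omega>
  obtain G where G: "0 \<le> G" "\<And>x. \<bar>g x\<bar> \<le> G" using bcontfun_bound[OF g] by blast
  have intA: "integrable Q A" and EA: "integral\<^sup>L Q A = total g"
    using integrable_fst'[OF integrable_total[OF g]] integral_fst'[OF integrable_total[OF g]]
    by (simp_all add: A_def[abs_def] total_def)
  have s: "integrable Q (s i)" "0 \<le> s i \<omega>" for i \<omega>
  proof -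
    show "integrable Q (s i)" unfolding s_def[abs_def] by (rule integrable_cost[OF k(1)]) measurable
    show "0 \<le> s i \<omega>" unfolding s_def using k(2) wt_nonneg by simp
  qed
  have bdA: "\<bar>A \<omega>\<bar> \<le> G * mass" if "\<omega> \<in> space Q" for \<omega>
  proof -
    have "\<bar>A \<omega>\<bar> \<le> (\<integral>s. \<bar>bpos s * g (Y (\<omega>, s))\<bar> \<partial>lborel)" unfolding A_def by (rule integral_abs_bound)
    also have "\<dots> \<le> (\<integral>s. bpos s * G \<partial>lborel)"
    proof (rule integral_mono')
      show "integrable lborel (\<lambda>s. bpos s * G)" using integrable_bpos by simp
      show "\<bar>bpos s * g (Y (\<omega>, s))\<bar> \<le> bpos s * G" for s
        using G bpos_nonneg by (auto simp: abs_mult intro: mult_left_mono)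
      show "0 \<le> bpos s * G" for s using G bpos_nonneg by simp
    qed
    finally show ?thesis by (simp add: mass_def mult.commute)
  qed
  have cost: "cost_upto X g k \<beta> V T \<omega> = ereal (A \<omega>) + (\<Sum>i. ereal (s i \<omega>))" if \<omega>: "\<omega> \<in> space Q" for \<omega>
  proof -
    have "(LINT r:{0..T}|lborel. \<beta> r * g (controlled_process X V \<omega> r)) = A \<omega>"
      unfolding set_lebesgue_integral_def A_def
      by (intro Bochner_Integration.integral_cong refl)
         (auto simp: indicator_def bpos_cutoff[OF b] Y_controlled_process[OF \<omega>])
    moreover have "(if imp i \<omega> \<le> ennreal T then ereal (\<beta> (enn2real (imp i \<omega>)) *
        k (X (enn2real (imp i \<omega>)) (\<omega> i)) (X (enn2real (imp i \<omega>)) (\<omega> (Suc i)))) else 0) = ereal (s i \<omega>)" for i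
      unfolding s_def wt_cutoff[OF b T] imp_pos_def start_pos_def start_Suc by (simp add: max_def)
    ultimately show ?thesis unfolding cost_upto_def by simp
  qed
  have "ext_expectation Q (cost_upto X g k \<beta> V T) = ext_expectation Q (\<lambda>\<omega>. ereal (A \<omega>) + (\<Sum>i. ereal (s i \<omega>)))"
    unfolding ext_expectation_def using cost by (simp cong: nn_integral_cong)
  also have "\<dots> = (if summable (\<lambda>i. integral\<^sup>L Q (s i)) then ereal (integral\<^sup>L Q A + (\<Sum>i. integral\<^sup>L Q (s i))) else \<infinity>)"
    using intA bdA s by (intro ext_expectation_sum[where K = "G * mass"] prob_space_Q) auto
  finally show ?thesis by (simp add: EA s_def[abs_def] imp_cost_def[abs_def])
qed

lemma mass_cutoff:
  assumes "b = cutoff \<beta> T" shows "mass = (LINT s:{0..T}|lborel. \<beta> s)"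
  unfolding mass_def set_lebesgue_integral_def
  by (intro Bochner_Integration.integral_cong refl) (auto simp: bpos_cutoff[OF assms] indicator_def)

end

context feller_process
begin

text \<open>A maximum principle: with S the supremum of w, the inequality gives S \<le> G - l + S.
  The bound is uniform in h.\<close>

lemma bellman_constant_le:
  assumes w: "w \<in> bcontfun" and le: "\<And>x. w x \<le> g x - l + trans_op h w x" and h: "0 \<le> h" and G: "\<And>x. g x \<le> G"
  shows "l \<le> G"
proof -
  obtain B where B: "\<And>x. \<bar>w x\<bar> \<le> B" using bcontfun_bound[OF w] by blast
  then have bdd: "bdd_above (range w)" by (intro bdd_aboveI2[of _ _ B]) (auto simp: abs_le_iff)
  define S where "S = (SUP x. w x)"
  have S: "w x \<le> S" for x unfolding S_def by (rule cSUP_upper[OF _ bdd]) simp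
  have "w x \<le> G - l + S" for x
    using le[of x] G[of x] trans_op_bounds(2)[OF w h S, of x] by linarith
  then have "S \<le> G - l + S" unfolding S_def by (intro cSUP_least) auto
  then show ?thesis by simp
qed

text \<open>
  Replacing one state after the other by its position a short time \<open>r\<close> later costs little, because
  the cost function is continuous; no continuity of \<open>u\<close> uniform in the grid is needed.
\<close>

lemma impulse_shift:
  assumes u: "u \<in> bcontfun" "\<And>x \<xi>. u x \<le> c x \<xi> + u \<xi>" and c: "(\<lambda>(x, \<xi>). c x \<xi>) \<in> bcontfun" and r: "0 \<le> r"
    and 1: "\<And>x z. \<bar>trans_op r (\<lambda>y. c y z) x - c x z\<bar> \<le> \<eta> / 2"
    and 2: "\<And>x z. \<bar>trans_op r (\<lambda>y. c x y) z - c x z\<bar> \<le> \<eta> / 2"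
  shows "trans_op r u x \<le> c x \<xi> + \<eta> + trans_op r u \<xi>"
proof -
  have cc: "continuous_on UNIV (\<lambda>(x, \<xi>). c x \<xi>)" using c by (auto simp: bcontfun_def)
  have c1: "(\<lambda>y. c y z) \<in> bcontfun" and c2: "(\<lambda>y. c z y) \<in> bcontfun" for z
  proof -
    have "continuous_on UNIV (\<lambda>y. (y, z))" "continuous_on UNIV (\<lambda>y. (z, y))" by (intro continuous_intros)+
    from continuous_on_compose2[OF cc this(1)] continuous_on_compose2[OF cc this(2)]
    show "(\<lambda>y. c y z) \<in> bcontfun" "(\<lambda>y. c z y) \<in> bcontfun" by (simp_all add: continuous_iff)
  qed
  \<comment> \<open>First the initial state x is moved, for each fixed target z; integrating over
    the position z reached from \<xi> then moves the target. Each move costs half of \<eta>.\<close>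
  have "trans_op r u x - \<eta> / 2 \<le> c x z + u z" for z
  proof -
    have "(\<lambda>y. c y z + u z) \<in> bcontfun" using c1[of z] by (auto simp: continuous_iff intro!: continuous_intros)
    from trans_op_mono[OF u(1) this r u(2), of x]
    have "trans_op r u x \<le> trans_op r (\<lambda>y. c y z) x + u z"
      using trans_op_add[OF c1 const_in_bcontfun r, of z "u z" x] by (simp add: trans_op_const)
    then show ?thesis using 1[of z x] by linarith
  qed
  moreover have "(\<lambda>z. c x z + u z) \<in> bcontfun"
    using c2[of x] u(1) by (auto simp: continuous_iff intro!: continuous_intros)
  ultimately have "trans_op r u x - \<eta> / 2 \<le> trans_op r (\<lambda>z. c x z + u z) \<xi>"
    using r by (intro trans_op_bounds(1))
  then show ?thesis
    using trans_op_add[OF c2 u(1) r, of x \<xi>] 2[of x \<xi>] by linarith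
qed

text \<open>With impulse costs that are not summable the expected cost is infinite and nothing is
  left to prove.\<close>

lemma cost_lower_bound:
  assumes V: "V \<in> strategies N F" "controlled_measure N F X P x0 V Q"
    and \<beta>: "\<And>t. 0 \<le> t \<Longrightarrow> 0 < \<beta> t \<and> \<beta> t \<le> 1" "\<And>s t. 0 \<le> s \<Longrightarrow> s \<le> t \<Longrightarrow> \<beta> t \<le> \<beta> s" and T: "0 \<le> T"
    and u: "u \<in> bcontfun" "\<And>x. 0 \<le> u x" "\<And>x. u x \<le> C" and g: "g \<in> bcontfun" "\<And>x. \<bar>g x\<bar> \<le> G"
    and k: "(\<lambda>(x, \<xi>). k x \<xi>) \<in> bcontfun" and c0: "0 < c0" "\<And>x \<xi>. c0 \<le> k x \<xi>" and h: "0 < h"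
    and step: "\<And>x. u x - trans_op h u x \<le> h * (g x - l)"
    and \<delta>: "\<And>r x. 0 \<le> r \<Longrightarrow> r \<le> h \<Longrightarrow> g x \<le> trans_op r g x + \<delta>"
    and \<eta>: "0 \<le> \<eta>" "\<And>r x \<xi>. 0 \<le> r \<Longrightarrow> r \<le> h \<Longrightarrow> trans_op r u x \<le> k x \<xi> + \<eta> + trans_op r u \<xi>"
  shows "ereal (((l - \<delta> - \<eta> / c0 * G) * (LINT s:{0..T}|lborel. \<beta> s) - 2 * C) / (1 + \<eta> / c0))
    \<le> ext_expectation Q (cost_upto X g k \<beta> V T)"
proof -
  interpret weighted_process N F X P V x0 Q "cutoff \<beta> T"
    by (intro weighted_process.intro controlled_system.intro controlled_system_axioms.intro weight_cutoff
        feller_process_axioms V \<beta>)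
  have k0: "0 \<le> k x \<xi>" for x \<xi> using c0 less_imp_le order_trans by blast
  have \<theta>: "0 < 1 + \<eta> / c0" using \<eta>(1) c0(1) by (simp add: add_pos_nonneg)
  show ?thesis
  proof (cases "summable (imp_cost k)")
    case True
    have "(l - \<delta> - \<eta> / c0 * G) * mass - 2 * C \<le> (1 + \<eta> / c0) * (total g + (\<Sum>i. imp_cost k i))"
    proof (rule lower_total[OF u g k c0 h step \<delta> \<eta> _ _ True])
      show "0 < \<beta> T" using \<beta>(1)[OF T] by simp
      show "cutoff \<beta> T s = 0 \<or> \<beta> T \<le> cutoff \<beta> T s" for s by (rule cutoff_gap[OF \<beta>(2) T])
    qed
    then show ?thesis
      using \<theta> True by (simp add: ext_expectation_cost[OF refl T g(1) k k0] mass_cutoff[OF refl]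
          pos_divide_le_eq[OF \<theta>] mult.commute)
  qed (simp add: ext_expectation_cost[OF refl T g(1) k k0])
qed

text \<open>The same controlled measure is viewed under two weights: the rounded one, for which grid
  sums are exact, and the original one, which defines the cost. Impulses lie on the grid, where the
  two weights agree; only the running cost has to be compared.\<close>

lemma cost_upper_bound:
  assumes V: "V \<in> grid_strategies N F h" "controlled_measure N F X P x0 V Q"
    and \<beta>: "\<And>t. 0 \<le> t \<Longrightarrow> 0 < \<beta> t \<and> \<beta> t \<le> 1" "\<And>s t. 0 \<le> s \<Longrightarrow> s \<le> t \<Longrightarrow> \<beta> t \<le> \<beta> s" and T: "0 \<le> T"
    and u: "u \<in> bcontfun" "\<And>x. 0 \<le> u x" "\<And>x. u x \<le> C" and g: "g \<in> bcontfun" "\<And>x. \<bar>g x\<bar> \<le> G"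
    and k: "(\<lambda>(x, \<xi>). k x \<xi>) \<in> bcontfun" and c0: "0 < c0" "\<And>x \<xi>. c0 \<le> k x \<xi>" and h: "0 < h"
    and step: "\<And>i \<omega> n. \<omega> \<in> space (copies N) \<Longrightarrow> start_time V i \<omega> \<le> ennreal (real n * h) \<Longrightarrow>
      ennreal (real n * h) < imp_time V i \<omega> \<Longrightarrow>
      u (X (real n * h) (\<omega> i)) - trans_op h u (X (real n * h) (\<omega> i)) = h * (g (X (real n * h) (\<omega> i)) - l)"
    and \<delta>: "\<And>r x. 0 \<le> r \<Longrightarrow> r \<le> h \<Longrightarrow> trans_op r g x \<le> g x + \<delta>"
    and jump: "\<And>i. AE \<omega> in Q. imp_time V i \<omega> < \<infinity> \<longrightarrow> u (X (enn2real (imp_time V i \<omega>)) (\<omega> i))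
      = k (X (enn2real (imp_time V i \<omega>)) (\<omega> i)) (X (enn2real (imp_time V i \<omega>)) (\<omega> (Suc i)))
        + u (X (enn2real (imp_time V i \<omega>)) (\<omega> (Suc i)))"
  shows "ext_expectation Q (cost_upto X g k \<beta> V T)
    \<le> ereal (C + (\<bar>l + \<delta>\<bar> + G) * h + (l + \<delta>) * (LINT s:{0..T}|lborel. \<beta> s))"
proof -
  have VS: "V \<in> strategies N F" using V(1) by (simp add: grid_strategies_def)
  have wb: "weight (cutoff \<beta> T)" using \<beta> by (rule weight_cutoff)
  interpret W: weighted_process N F X P V x0 Q "cutoff \<beta> T"
    by (intro weighted_process.intro controlled_system.intro controlled_system_axioms.intro wb
        feller_process_axioms VS V)
  interpret W': weighted_process N F X P V x0 Q "grid_weight h (cutoff \<beta> T)"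
    by (intro weighted_process.intro controlled_system.intro controlled_system_axioms.intro
        weight_grid_weight[OF wb h] feller_process_axioms VS V)
  have k0: "0 \<le> k x \<xi>" for x \<xi> using c0 less_imp_le order_trans by blast
  have G0: "0 \<le> G" using g(2) abs_ge_zero order_trans by blast
  have grid: "imp_time V i \<omega> = \<infinity> \<or> (\<exists>n::nat. imp_time V i \<omega> = ennreal (real n * h))" if "\<omega> \<in> space Q" for i \<omega>
    using V(1) that by (auto simp: grid_strategies_def W.space_Q)
  have gap: "grid_weight h (cutoff \<beta> T) s = 0 \<or> \<beta> T \<le> grid_weight h (cutoff \<beta> T) s" "0 < \<beta> T" for s
    unfolding grid_weight_def by (rule cutoff_gap[OF \<beta>(2) T]) (use \<beta>(1)[OF T] in auto)
  have bstep: "grid_weight h (cutoff \<beta> T) (real n * h + r) = grid_weight h (cutoff \<beta> T) (real n * h)"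
    if "0 \<le> r" "r < h" for n r
    using grid_weight_grid[OF h that, of "cutoff \<beta> T" n] grid_weight_grid[OF h order_refl h, of "cutoff \<beta> T" n] by simp
  have jump': "AE \<omega> in Q. imp_time V i \<omega> < \<infinity> \<longrightarrow>
      u (W'.imp_pos i \<omega>) = k (W'.imp_pos i \<omega>) (W'.start_pos (Suc i) \<omega>) + u (W'.start_pos (Suc i) \<omega>)" for i
    using jump[of i] by (simp add: W'.imp_pos_def W'.start_pos_def W.start_Suc max_def)
  have step': "u (X (real n * h) (\<omega> i)) - trans_op h u (X (real n * h) (\<omega> i)) = h * (g (X (real n * h) (\<omega> i)) - l)"
    if "\<omega> \<in> space Q" "start_time V i \<omega> \<le> ennreal (real n * h)" "ennreal (real n * h) < imp_time V i \<omega>" for i \<omega> n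
    using step[of \<omega> i n] that by (simp add: W.space_Q)
  have up1: "summable (W'.imp_cost k)"
    by (rule W'.upper_total(1)[OF u g(1) k c0 h]) (assumption | rule grid bstep step' \<delta> jump' gap)+
  have up2: "W'.total g + (\<Sum>i. W'.imp_cost k i) \<le> C + (l + \<delta>) * W'.mass"
    by (rule W'.upper_total(2)[OF u g(1) k c0 h]) (assumption | rule grid bstep step' \<delta> jump' gap)+
  have imp_cost: "W'.imp_cost k i = W.imp_cost k i" for i
    unfolding W'.imp_cost_def W.imp_cost_def
  proof (rule Bochner_Integration.integral_cong[OF refl])
    fix \<omega> assume \<omega>: "\<omega> \<in> space Q"
    have "W'.wt (imp_time V i \<omega>) = W.wt (imp_time V i \<omega>)"
    proof (cases "imp_time V i \<omega> = \<infinity>")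
      case False
      then obtain n where "imp_time V i \<omega> = ennreal (real n * h)" using grid[OF \<omega>] by blast
      then show ?thesis
        using h grid_weight_grid[OF h order_refl h, of "cutoff \<beta> T" n]
        by (simp add: W'.wt_ennreal W.wt_ennreal)
    qed (simp add: W'.wt_def W.wt_def)
    then show "W'.wt (imp_time V i \<omega>) * k (W'.imp_pos i \<omega>) (W'.start_pos (Suc i) \<omega>)
      = W.wt (imp_time V i \<omega>) * k (W.imp_pos i \<omega>) (W.start_pos (Suc i) \<omega>)"
      by (simp add: W'.imp_pos_def W.imp_pos_def W'.start_pos_def W.start_pos_def)
  qed
  have bpos_le: "W.bpos s \<le> W'.bpos s" for s
    using W.grid_weight_bounds(1)[OF h, of s] by (simp add: W.bpos_def W'.bpos_def)
  \<comment> \<open>The rounded weight is at most 1 on [0, h) and at most the original weight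
    shifted by h afterwards.\<close>
  have mass: "W'.mass \<le> W.mass + h"
  proof -
    have i1: "integrable lborel (\<lambda>s. indicator {0..<h} s :: real)" using h by (intro integrable_real_indicator) auto
    have i2: "integrable lborel (\<lambda>s. W.bpos (- h + 1 * s))"
      by (rule lborel_integrable_real_affine[OF W.integrable_bpos]) simp
    have "W'.mass \<le> (\<integral>s. indicator {0..<h} s + W.bpos (- h + 1 * s) \<partial>lborel)"
      unfolding W'.mass_def
    proof (rule integral_mono[OF W'.integrable_bpos Bochner_Integration.integrable_add[OF i1 i2]])
      show "W'.bpos s \<le> indicator {0..<h} s + W.bpos (- h + 1 * s)" for s
        using W.grid_weight_bounds(2)[OF h, of s] W'.b_le_1[of s] W.bpos_nonneg[of "s - h"]
        by (auto simp: W'.bpos_def W.bpos_def indicator_def add.commute[of "- h"])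
    qed
    also have "\<dots> = (\<integral>s. indicator {0..<h} s \<partial>lborel) + (\<integral>s. W.bpos (- h + 1 * s) \<partial>lborel)"
      by (rule Bochner_Integration.integral_add[OF i1 i2])
    also have "(\<integral>s. W.bpos (- h + 1 * s) \<partial>lborel) = W.mass"
      unfolding W.mass_def using lborel_integral_real_affine[of 1 W.bpos "- h"] by simp
    finally show ?thesis using h by simp
  qed
  have mass_le: "W.mass \<le> W'.mass"
    unfolding W.mass_def W'.mass_def by (intro integral_mono W.integrable_bpos W'.integrable_bpos bpos_le)
  \<comment> \<open>Adding G makes the running cost nonnegative, hence monotone in the
    weight.\<close>
  have "W.total g + G * W.mass \<le> W'.total g + G * W'.mass"
  proof -
    have gG: "(\<lambda>x. g x + G) \<in> bcontfun" using g(1) by (auto simp: continuous_iff intro!: continuous_intros)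
    have "W.total (\<lambda>x. g x + G) \<le> W'.total (\<lambda>x. g x + G)"
      unfolding W.total_def W'.total_def
    proof (rule integral_mono)
      show "W.bpos (snd z) * (g (W.Y z) + G) \<le> W'.bpos (snd z) * (g (W'.Y z) + G)" for z
        using g(2)[of "W.Y z"] bpos_le[of "snd z"] by (intro mult_right_mono) (auto simp: abs_le_iff)
    qed (rule W.integrable_total[OF gG] W'.integrable_total[OF gG])+
    then show ?thesis unfolding W.total_add_const[OF g(1)] W'.total_add_const[OF g(1)] .
  qed
  moreover have "G * W'.mass \<le> G * (W.mass + h)" by (rule mult_left_mono[OF mass G0])
  \<comment> \<open>The sign of l + \<delta> is unknown, whence the absolute value in the
    bound.\<close>
  moreover have "(l + \<delta>) * (W'.mass - W.mass) \<le> \<bar>l + \<delta>\<bar> * h"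
  proof -
    have "(l + \<delta>) * (W'.mass - W.mass) \<le> \<bar>l + \<delta>\<bar> * (W'.mass - W.mass)"
      using mass_le by (intro mult_right_mono) auto
    also have "\<dots> \<le> \<bar>l + \<delta>\<bar> * h" using mass by (intro mult_left_mono) auto
    finally show ?thesis .
  qed
  ultimately have "W.total g + (\<Sum>i. W.imp_cost k i) \<le> C + (\<bar>l + \<delta>\<bar> + G) * h + (l + \<delta>) * W.mass"
    using up2 unfolding imp_cost by (simp add: algebra_simps)
  moreover have "summable (W.imp_cost k)" using up1 unfolding summable_cong[OF always_eventually[OF allI[OF imp_cost]]] .
  ultimately show ?thesis
    by (simp add: W.ext_expectation_cost[OF refl T g(1) k k0] W.mass_cutoff[OF refl])
qed

end

section \<open>Limits as the horizon grows\<close>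

lemma LINT_at_top:
  fixes \<beta> :: "real \<Rightarrow> real"
  assumes \<beta>: "\<And>t. 0 \<le> t \<Longrightarrow> 0 < \<beta> t \<and> \<beta> t \<le> 1" "\<And>s t. 0 \<le> s \<Longrightarrow> s \<le> t \<Longrightarrow> \<beta> t \<le> \<beta> s"
    and inf: "(\<integral>\<^sup>+ s\<in>{0..}. ennreal (\<beta> s) \<partial>lborel) = \<infinity>"
  shows "filterlim (\<lambda>T. LINT s:{0..T}|lborel. \<beta> s) at_top at_top"
proof -
  have "antimono (\<lambda>s. \<beta> (max 0 s))" by (intro antimonoI \<beta>(2) max.mono) auto
  then have "mono (\<lambda>s. - \<beta> (max 0 s))" by (auto simp: mono_def antimono_def)
  then have "(\<lambda>s. - (- \<beta> (max 0 s))) \<in> borel_measurable borel"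
    by (intro borel_measurable_uminus borel_measurable_mono)
  then have [measurable]: "(\<lambda>s. \<beta> (max 0 s)) \<in> borel_measurable borel" by simp
  define I where "I T s = indicator {0..T} s * \<beta> (max 0 s)" for T s :: real
  have I: "integrable lborel (I T)" "0 \<le> I T s" for T s
  proof -
    have b: "0 \<le> \<beta> (max 0 s)" "\<beta> (max 0 s) \<le> 1" for s using \<beta>(1)[of "max 0 s"] by auto
    show "0 \<le> I T s" using b by (simp add: I_def)
    show "integrable lborel (I T)"
    proof (rule Bochner_Integration.integrable_bound)
      show "integrable lborel (\<lambda>s. indicator {0..T} s :: real)"
        by (intro integrable_real_indicator) (auto simp: emeasure_lborel_Icc_eq)
      show "I T \<in> borel_measurable lborel" unfolding I_def[abs_def] by measurable
      show "AE s in lborel. norm (I T s) \<le> norm (indicator {0..T} s :: real)"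
        using \<beta>(1) by (intro AE_I2) (auto simp: I_def indicator_def abs_of_pos)
    qed
  qed
  have eq: "(LINT s:{0..T}|lborel. \<beta> s) = integral\<^sup>L lborel (I T)" for T
    unfolding set_lebesgue_integral_def I_def
    by (intro Bochner_Integration.integral_cong refl) (auto simp: indicator_def max_def)
  have mono: "integral\<^sup>L lborel (I S) \<le> integral\<^sup>L lborel (I T)" if "S \<le> T" for S T
  proof (rule integral_mono[OF I(1) I(1)])
    show "I S s \<le> I T s" for s
      using that \<beta>(1)[of "max 0 s"] by (auto simp: I_def indicator_def)
  qed
  have "\<exists>T. K < integral\<^sup>L lborel (I T)" for K
  proof (rule ccontr)
    assume "\<not> ?thesis"
    then have le: "integral\<^sup>L lborel (I T) \<le> K" for T by (auto simp: not_less)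
    have "(\<integral>\<^sup>+ s\<in>{0..}. ennreal (\<beta> s) \<partial>lborel) = (\<integral>\<^sup>+ s. (SUP n. ennreal (I (real n) s)) \<partial>lborel)"
    proof (intro nn_integral_cong)
      fix s :: real
      show "ennreal (\<beta> s) * indicator {0..} s = (SUP n. ennreal (I (real n) s))"
      proof (cases "0 \<le> s")
        case True
        obtain n where n: "s \<le> real n" using real_arch_simple by blast
        show ?thesis
        proof (rule antisym)
          show "ennreal (\<beta> s) * indicator {0..} s \<le> (SUP n. ennreal (I (real n) s))"
            using True n by (intro SUP_upper2[of n]) (auto simp: I_def max_def)
          show "(SUP n. ennreal (I (real n) s)) \<le> ennreal (\<beta> s) * indicator {0..} s"
            using True \<beta>(1)[OF True] by (intro SUP_least) (auto simp: I_def indicator_def max_def)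
        qed
      qed (simp add: I_def)
    qed
    also have "\<dots> = (SUP n. \<integral>\<^sup>+ s. ennreal (I (real n) s) \<partial>lborel)"
    proof (rule nn_integral_monotone_convergence_SUP)
      show "incseq (\<lambda>n s. ennreal (I (real n) s))"
        using \<beta>(1) by (auto simp: incseq_def le_fun_def I_def indicator_def intro!: ennreal_leI less_imp_le)
      show "(\<lambda>s. ennreal (I (real n) s)) \<in> borel_measurable lborel" for n using I(1)[of "real n"] by measurable
    qed
    also have "\<dots> \<le> ennreal K"
      using le I by (intro SUP_least) (simp add: nn_integral_eq_integral ennreal_leI)
    finally show False using inf by (simp add: top_unique)
  qed
  then show ?thesis
    unfolding eq filterlim_at_top eventually_at_top_linorder by (meson mono less_imp_le order_trans)
qed

lemma Limsup_ge_of_bound: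
  fixes F :: "real \<Rightarrow> ereal"
  assumes B: "filterlim B at_top at_top" and F: "\<And>T. 0 \<le> T \<Longrightarrow> ereal (a * B T - d) \<le> F T"
  shows "ereal a \<le> Limsup at_top (\<lambda>T. F T / ereal (B T))"
proof -
  have "((\<lambda>T. a - d * inverse (B T)) \<longlongrightarrow> a - d * 0) at_top"
    by (intro tendsto_intros tendsto_inverse_0_at_top B)
  then have "((\<lambda>T. ereal (a - d * inverse (B T))) \<longlongrightarrow> ereal a) at_top" by simp
  then have "ereal a = Limsup at_top (\<lambda>T. ereal (a - d * inverse (B T)))"
    by (intro lim_imp_Limsup[symmetric]) auto
  also have "\<dots> \<le> Limsup at_top (\<lambda>T. F T / ereal (B T))"
  proof (rule Limsup_mono)
    have "\<forall>\<^sub>F T in at_top. 0 < B T" using B by (auto simp: filterlim_at_top_dense)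
    then show "\<forall>\<^sub>F T in at_top. ereal (a - d * inverse (B T)) \<le> F T / ereal (B T)"
      using eventually_ge_at_top[of 0]
    proof eventually_elim
      case (elim T)
      have "ereal (a - d * inverse (B T)) = ereal (a * B T - d) / ereal (B T)"
        using elim by (simp add: field_simps)
      also have "\<dots> \<le> F T / ereal (B T)"
        using elim by (intro ereal_divide_right_mono F) auto
      finally show ?case .
    qed
  qed
  finally show ?thesis .
qed

lemma Limsup_le_of_bound:
  fixes F :: "real \<Rightarrow> ereal"
  assumes B: "filterlim B at_top at_top" and F: "\<And>T. 0 \<le> T \<Longrightarrow> F T \<le> ereal (d + a * B T)"
  shows "Limsup at_top (\<lambda>T. F T / ereal (B T)) \<le> ereal a"
proof -
  have "((\<lambda>T. a + d * inverse (B T)) \<longlongrightarrow> a + d * 0) at_top"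
    by (intro tendsto_intros tendsto_inverse_0_at_top B)
  then have "((\<lambda>T. ereal (a + d * inverse (B T))) \<longlongrightarrow> ereal a) at_top" by simp
  then have "Limsup at_top (\<lambda>T. ereal (a + d * inverse (B T))) = ereal a"
    by (intro lim_imp_Limsup) auto
  moreover have "Limsup at_top (\<lambda>T. F T / ereal (B T)) \<le> Limsup at_top (\<lambda>T. ereal (a + d * inverse (B T)))"
  proof (rule Limsup_mono)
    have "\<forall>\<^sub>F T in at_top. 0 < B T" using B by (auto simp: filterlim_at_top_dense)
    then show "\<forall>\<^sub>F T in at_top. F T / ereal (B T) \<le> ereal (a + d * inverse (B T))"
      using eventually_ge_at_top[of 0]
    proof eventually_elim
      case (elim T)
      have "F T / ereal (B T) \<le> ereal (d + a * B T) / ereal (B T)"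
        using elim by (intro ereal_divide_right_mono F) auto
      also have "\<dots> = ereal (a + d * inverse (B T))"
        using elim by (simp add: field_simps)
      finally show ?case .
    qed
  qed
  ultimately show ?thesis by simp
qed

lemma average_functional_eq_discounted:
  "average_functional X g c Q V = discounted_functional X g c (\<lambda>_. 1) Q V"
  unfolding average_functional_def discounted_functional_def
proof (rule Limsup_eq)
  show "\<forall>\<^sub>F T in at_top. ext_expectation Q (cost_upto X g c (\<lambda>_. 1) V T) / ereal T
      = ext_expectation Q (cost_upto X g c (\<lambda>_. 1) V T) / ereal (LINT s:{0..T}|lborel. 1)"
    using eventually_ge_at_top[of 0] by eventually_elim (simp add: set_lebesgue_integral_def)
qed

section \<open>Choice of the grid step and comparison of the two bounds\<close>

theorem corollary4p8:
  fixes N :: "'w measure" and F :: "ennreal \<Rightarrow> 'w measure"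
    and X :: "real \<Rightarrow> 'w \<Rightarrow> 'e::polish_space" and P :: "'e \<Rightarrow> 'w measure"
    and \<beta> :: "real \<Rightarrow> real" and g :: "'e \<Rightarrow> real" and c :: "'e \<Rightarrow> 'e \<Rightarrow> real"
    and PV :: "'e \<Rightarrow> ('w, 'e) strategy \<Rightarrow> (nat \<Rightarrow> 'w) measure"
    and w :: "real \<Rightarrow> 'e \<Rightarrow> real" and l :: "real \<Rightarrow> real"
    and sel :: "real \<Rightarrow> 'e \<Rightarrow> 'e" and \<xi>\<^sub>0 :: 'e and \<epsilon> :: real
  assumes process: "standard_markov_process N F X P"
    and beta_range: "\<And>t. t \<ge> 0 \<Longrightarrow> 0 < \<beta> t \<and> \<beta> t \<le> 1"
    and beta_antimono: "\<And>s t. 0 \<le> s \<Longrightarrow> s \<le> t \<Longrightarrow> \<beta> t \<le> \<beta> s"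
    and beta_continuous: "continuous_on {0..} \<beta>"
    and beta_0: "\<beta> 0 = 1"
    and beta_submult: "\<And>s t. 0 \<le> s \<Longrightarrow> 0 \<le> t \<Longrightarrow> \<beta> (t + s) \<ge> \<beta> t * \<beta> s"
    and beta_integral: "(\<integral>\<^sup>+ s\<in>{0..}. ennreal (\<beta> s) \<partial>lborel) = \<infinity>"
    and g: "g \<in> bcontfun"
    and c: "(\<lambda>(x, \<xi>). c x \<xi>) \<in> bcontfun"
    and c_bounds: "\<exists>c\<^sub>0>0. \<forall>x \<xi> \<eta>. c\<^sub>0 \<le> c x \<xi> \<and> c x \<xi> \<le> c x \<eta> + c \<eta> \<xi>"
    and feller: "\<And>f :: 'e \<Rightarrow> real. \<And>t. f \<in> bcontfun \<Longrightarrow> t > 0 \<Longrightarrow> (\<lambda>x. \<integral>\<omega>. f (X t \<omega>) \<partial>P x) \<in> bcontfun"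
    and ergodic: "\<And>t. t > 0 \<Longrightarrow> \<exists>\<Lambda>. 0 < \<Lambda> \<and> \<Lambda> < 1 \<and>
      (\<forall>x y. \<forall>A\<in>sets borel. \<bar>trans_prob P X t x A - trans_prob P X t y A\<bar> \<le> \<Lambda>)"
    and PV: "\<And>x V. V \<in> strategies N F \<Longrightarrow> controlled_measure N F X P x V (PV x V)"
    and solution: "\<And>h. h > 0 \<Longrightarrow> bellman_solution X P g c h (w h) (l h)"
    and minimiser: "\<And>h. h > 0 \<Longrightarrow> measurable_minimiser c h (w h) (sel h)"
    and eps: "\<epsilon> > 0"
  shows "\<exists>h>0. let V = hat_strategy X c h (w h) (sel h) \<xi>\<^sub>0 in
    V \<in> grid_strategies N F h \<and>
    (\<forall>x. discounted_functional X g c \<beta> (PV x V) V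
           \<le> (INF V'\<in>strategies N F. discounted_functional X g c \<beta> (PV x V') V') + ereal \<epsilon> \<and>
         average_functional X g c (PV x V) V
           \<le> (INF V'\<in>strategies N F. average_functional X g c (PV x V') V') + ereal \<epsilon>)"
proof -
  interpret feller_process N F X P
    by (intro feller_process.intro feller_process_axioms.intro process feller)
  obtain c0 where c0: "0 < c0" "\<And>x \<xi>. c0 \<le> c x \<xi>" using c_bounds by blast
  have c_nonneg: "0 \<le> c x \<xi>" for x \<xi> using c0 less_imp_le order_trans by blast
  obtain G where G: "0 \<le> G" "\<And>x. \<bar>g x\<bar> \<le> G" using bcontfun_bound[OF g] by blast
  \<comment> \<open>The upper and the lower bound lose \<delta> each, and the factor 1 + \<theta>
    costs at most 2 \<theta> G; the total must not exceed \<epsilon>. G + 1 keeps the denominator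
    positive, and \<eta> is chosen to make \<eta> / c0 equal to \<theta>.\<close>
  define \<delta> where "\<delta> = \<epsilon> / 4"
  define \<theta> where "\<theta> = \<epsilon> / (4 * (G + 1))"
  define \<eta> where "\<eta> = \<theta> * c0"
  have pos: "0 < \<delta>" "0 < \<theta>" "0 < \<eta>" using eps G(1) c0(1) by (auto simp: \<delta>_def \<theta>_def \<eta>_def)
  have \<theta>G: "2 * \<delta> + 2 * \<theta> * G \<le> \<epsilon>"
  proof -
    have "\<theta> * G \<le> \<theta> * (G + 1)" using pos by (intro mult_left_mono) auto
    also have "\<dots> = \<epsilon> / 4" using G(1) by (simp add: \<theta>_def field_simps)
    finally show ?thesis by (simp add: \<delta>_def)
  qed
  have cc: "continuous_on UNIV (\<lambda>(x, \<xi>). c x \<xi>)" using c by (auto simp: bcontfun_def)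
  have cc': "continuous_on UNIV (\<lambda>(x, z). c z x)"
  proof -
    have "continuous_on UNIV (\<lambda>p :: 'e \<times> 'e. (snd p, fst p))" by (intro continuous_intros)
    from continuous_on_compose2[OF cc this] show ?thesis by (simp add: case_prod_beta')
  qed
  obtain d1 where d1: "0 < d1" "\<And>t x. 0 \<le> t \<Longrightarrow> t \<le> d1 \<Longrightarrow> \<bar>trans_op t g x - g x\<bar> \<le> \<delta>"
    using strongly_continuous[OF g] pos(1) unfolding strongly_continuous_def by blast
  have "0 < \<eta> / 2" using pos by simp
  from strongly_continuous_uniform[OF cc this] obtain d2 where d2: "0 < d2"
    "\<And>t x z. 0 \<le> t \<Longrightarrow> t \<le> d2 \<Longrightarrow> \<bar>trans_op t (\<lambda>y. c y z) x - c x z\<bar> \<le> \<eta> / 2" by blast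
  from strongly_continuous_uniform[OF cc' \<open>0 < \<eta> / 2\<close>] obtain d3 where d3: "0 < d3"
    "\<And>t x z. 0 \<le> t \<Longrightarrow> t \<le> d3 \<Longrightarrow> \<bar>trans_op t (\<lambda>y. c z y) x - c z x\<bar> \<le> \<eta> / 2" by blast
  \<comment> \<open>This step depends neither on the initial state nor on the weight, so it serves
    all x and both functionals.\<close>
  define h where "h = min d1 (min d2 d3)"
  have h: "0 < h" using d1 d2 d3 by (simp add: h_def)
  define V where "V = hat_strategy X c h (w h) (sel h) \<xi>\<^sub>0"
  have wb: "w h \<in> bcontfun" and bell: "w h x = min (g x - l h + trans_op h (w h) x) (impulse_operator c h (w h) x)" for x
    using solution[OF h] unfolding bellman_solution_def trans_op_def by blast+
  have bell1: "w h x \<le> g x - l h + trans_op h (w h) x" and bell2: "w h x \<le> impulse_operator c h (w h) x" for x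
    using bell[of x] by linarith+
  note sel = minimiser[OF h]
  have Vgrid: "V \<in> grid_strategies N F h"
    unfolding V_def by (rule hat_strategy_grid[OF c c_nonneg h wb sel])
  then have VS: "V \<in> strategies N F" by (simp add: grid_strategies_def)
  have hit_time: "imp_time V i \<omega> = first_grid_hit X c h (w h) (start_time V i \<omega>) (\<omega> i)" for i \<omega>
    unfolding V_def by (rule hat_time_start[OF c c_nonneg h wb sel])
  obtain B where B: "0 \<le> B" "\<And>x. \<bar>w h x\<bar> \<le> B" using bcontfun_bound[OF wb] by blast
  \<comment> \<open>The factor h turns the impulse cost c / h of the equation into c. The equation
    is invariant under additive constants, and adding B makes the potential nonnegative.\<close>
  define u where "u x = h * (w h x + B)" for x
  have wB: "(\<lambda>x. w h x + B) \<in> bcontfun" using wb by (auto simp: continuous_iff intro!: continuous_intros)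
  have u: "u \<in> bcontfun" "0 \<le> u x" "u x \<le> h * (2 * B)" for x
  proof -
    show "u \<in> bcontfun" using wB by (auto simp: u_def[abs_def] continuous_iff intro!: continuous_intros)
    have "- B \<le> w h x" "w h x \<le> B" using B(2)[of x] by linarith+
    then show "0 \<le> u x" "u x \<le> h * (2 * B)" unfolding u_def using h by (auto intro!: mult_left_mono mult_nonneg_nonneg)
  qed
  have Tu: "u x - trans_op h u x = h * (w h x - trans_op h (w h) x)" for x
  proof -
    have "trans_op h u x = h * (trans_op h (w h) x + B)"
      unfolding u_def using trans_op_add[OF wb const_in_bcontfun less_imp_le[OF h], of B x]
      by (simp add: trans_op_cmult trans_op_const)
    then show ?thesis by (simp add: u_def algebra_simps)
  qed
  have step: "u x - trans_op h u x \<le> h * (g x - l h)" for x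
    unfolding Tu using bell1[of x] h by (intro mult_left_mono) linarith+
  have imp: "u x \<le> c x \<xi> + u \<xi>" for x \<xi>
  proof -
    have "w h x \<le> c x \<xi> / h + w h \<xi>"
      using bell2[of x] impulse_operator_le[OF c c_nonneg h wb sel, of x \<xi>] by (rule order_trans)
    then have "h * w h x \<le> h * (c x \<xi> / h + w h \<xi>)" using h by (intro mult_left_mono) auto
    then show ?thesis using h by (simp add: u_def algebra_simps)
  qed
  have lG: "l h \<le> G"
    by (rule bellman_constant_le[OF wb bell1 less_imp_le[OF h] abs_le_D1[OF G(2)]])
  have g\<delta>: "g x \<le> trans_op r g x + \<delta>" "trans_op r g x \<le> g x + \<delta>" if "0 \<le> r" "r \<le> h" for r x
    using d1(2)[of r x] that by (auto simp: h_def abs_le_iff)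
  have shift: "trans_op r u x \<le> c x \<xi> + \<eta> + trans_op r u \<xi>" if "0 \<le> r" "r \<le> h" for r x \<xi>
    using that by (intro impulse_shift[OF u(1) imp c that(1)] d2(2) d3(2)) (auto simp: h_def)
  have step_hat: "u (X (real n * h) (\<omega> i)) - trans_op h u (X (real n * h) (\<omega> i)) = h * (g (X (real n * h) (\<omega> i)) - l h)"
    if st: "start_time V i \<omega> \<le> ennreal (real n * h)" and lt: "ennreal (real n * h) < imp_time V i \<omega>" for i \<omega> n
  proof -
    \<comment> \<open>Strictly before the impulse a grid point is no hit, so the minimum in the
      equation is its other term.\<close>
    have "w h (X (real n * h) (\<omega> i)) \<noteq> impulse_operator c h (w h) (X (real n * h) (\<omega> i))"
      using first_grid_hit_le[OF st, of "w h" X "\<omega> i" c] lt unfolding hit_time[symmetric] by auto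
    then have "w h (X (real n * h) (\<omega> i)) = g (X (real n * h) (\<omega> i)) - l h + trans_op h (w h) (X (real n * h) (\<omega> i))"
      using bell[of "X (real n * h) (\<omega> i)"] by linarith
    then show ?thesis unfolding Tu by simp
  qed
  have jump_hat: "AE \<omega> in PV x V. imp_time V i \<omega> < \<infinity> \<longrightarrow> u (X (enn2real (imp_time V i \<omega>)) (\<omega> i))
      = c (X (enn2real (imp_time V i \<omega>)) (\<omega> i)) (X (enn2real (imp_time V i \<omega>)) (\<omega> (Suc i)))
        + u (X (enn2real (imp_time V i \<omega>)) (\<omega> (Suc i)))" for i x
  proof -
    \<comment> \<open>The controlled measure prescribes the new state only almost surely, which is
      why the identity at impulses is an almost sure one.\<close>
    have "AE \<omega> in PV x V. start_time V (Suc i) \<omega> < \<infinity> \<longrightarrow>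
        X (enn2real (start_time V (Suc i) \<omega>)) (\<omega> (Suc i)) = start_state x V (Suc i) \<omega>"
      using PV[OF VS, of x] unfolding controlled_measure_def by blast
    then show ?thesis
    proof eventually_elim
      case (elim \<omega>)
      show ?case
      proof
        assume fin: "imp_time V i \<omega> < \<infinity>"
        define y where "y = X (enn2real (imp_time V i \<omega>)) (\<omega> i)"
        have nxt: "X (enn2real (imp_time V i \<omega>)) (\<omega> (Suc i)) = sel h y"
          using elim fin by (simp add: start_time_def start_state_def y_def) (simp add: V_def hat_strategy_def)
        have hit: "w h y = impulse_operator c h (w h) y"
          using fin unfolding y_def hit_time
          by (cases rule: first_grid_hit_cases[OF h, where X = X and c = c and w = "w h" and \<omega> = "\<omega> i"
                and s = "start_time V i \<omega>"]) (use h in auto)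
        have "h * w h y = c y (sel h y) + h * w h (sel h y)"
          unfolding hit impulse_operator_sel[OF c c_nonneg h wb sel] using h by (simp add: distrib_left)
        then show "u (X (enn2real (imp_time V i \<omega>)) (\<omega> i))
            = c (X (enn2real (imp_time V i \<omega>)) (\<omega> i)) (X (enn2real (imp_time V i \<omega>)) (\<omega> (Suc i)))
              + u (X (enn2real (imp_time V i \<omega>)) (\<omega> (Suc i)))"
          unfolding nxt y_def[symmetric] by (simp add: u_def algebra_simps)
      qed
    qed
  qed
  have opt: "discounted_functional X g c b (PV x V) V
      \<le> (INF V'\<in>strategies N F. discounted_functional X g c b (PV x V') V') + ereal \<epsilon>"
    if b: "\<And>t. 0 \<le> t \<Longrightarrow> 0 < b t \<and> b t \<le> 1" "\<And>s t. 0 \<le> s \<Longrightarrow> s \<le> t \<Longrightarrow> b t \<le> b s"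
      "filterlim (\<lambda>T. LINT s:{0..T}|lborel. b s) at_top at_top" for b x
  proof -
    have "discounted_functional X g c b (PV x V) V \<le> ereal (l h + \<delta>)"
      unfolding discounted_functional_def
    proof (rule Limsup_le_of_bound[OF b(3)])
      fix T :: real assume T: "0 \<le> T"
      show "ext_expectation (PV x V) (cost_upto X g c b V T)
          \<le> ereal (h * (2 * B) + (\<bar>l h + \<delta>\<bar> + G) * h + (l h + \<delta>) * (LINT s:{0..T}|lborel. b s))"
        by (rule cost_upper_bound[OF Vgrid PV[OF VS]])
           (assumption | rule b(1,2) T u g G(2) c c0 h step_hat g\<delta>(2) jump_hat)+
    qed
    moreover have "ereal (l h - \<delta> - 2 * \<theta> * G) \<le> discounted_functional X g c b (PV x V') V'"
      if V': "V' \<in> strategies N F" for V'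
    proof -
      have \<theta>: "\<eta> / c0 = \<theta>" using c0(1) by (simp add: \<eta>_def)
      have "ereal ((l h - \<delta> - \<theta> * G) / (1 + \<theta>)) \<le> discounted_functional X g c b (PV x V') V'"
        unfolding discounted_functional_def
      proof (rule Limsup_ge_of_bound[OF b(3)])
        fix T :: real assume T: "0 \<le> T"
        have "ereal (((l h - \<delta> - \<eta> / c0 * G) * (LINT s:{0..T}|lborel. b s) - 2 * (h * (2 * B))) / (1 + \<eta> / c0))
            \<le> ext_expectation (PV x V') (cost_upto X g c b V' T)"
          using pos(3) by (intro cost_lower_bound[OF V' PV[OF V'] b(1,2) T u g G(2) c c0 h step g\<delta>(1) _ shift]) auto
        then show "ereal ((l h - \<delta> - \<theta> * G) / (1 + \<theta>) * (LINT s:{0..T}|lborel. b s) - 2 * (h * (2 * B)) / (1 + \<theta>))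
            \<le> ext_expectation (PV x V') (cost_upto X g c b V' T)"
          unfolding \<theta> times_divide_eq_left diff_divide_distrib[where c = "1 + \<theta>" and b = "2 * (h * (2 * B))"] .
      qed
      \<comment> \<open>Dividing by 1 + \<theta> diminishes a positive \<open>l h\<close>; the
        uniform bound \<open>l h\<close> \<le> G limits this loss to a second \<theta> * G.\<close>
      moreover have "l h - \<delta> - 2 * \<theta> * G \<le> (l h - \<delta> - \<theta> * G) / (1 + \<theta>)"
      proof -
        have "\<theta> * l h \<le> \<theta> * G" using lG pos by (intro mult_left_mono) auto
        moreover have "0 \<le> \<theta> * \<delta>" "0 \<le> \<theta> * (\<theta> * G)" using pos G(1) by auto
        ultimately have "(l h - \<delta> - 2 * \<theta> * G) * (1 + \<theta>) \<le> l h - \<delta> - \<theta> * G"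
          by (simp add: algebra_simps)
        then show ?thesis using pos by (simp add: pos_le_divide_eq)
      qed
      ultimately show ?thesis by (meson ereal_less_eq(3) order_trans)
    qed
    then have "ereal (l h - \<delta> - 2 * \<theta> * G) \<le> (INF V'\<in>strategies N F. discounted_functional X g c b (PV x V') V')"
      by (rule INF_greatest)
    then have "ereal (l h - \<delta> - 2 * \<theta> * G) + ereal \<epsilon>
        \<le> (INF V'\<in>strategies N F. discounted_functional X g c b (PV x V') V') + ereal \<epsilon>"
      by (rule add_right_mono)
    moreover have "ereal (l h + \<delta>) \<le> ereal (l h - \<delta> - 2 * \<theta> * G) + ereal \<epsilon>" using \<theta>G by simp
    ultimately show ?thesis by (meson order_trans)
  qed
  have "filterlim (\<lambda>T. LINT s:{0..T}|lborel. \<beta> s) at_top at_top"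
    by (rule LINT_at_top[OF beta_range beta_antimono beta_integral])
  note discounted = opt[OF beta_range beta_antimono this]
  have "filterlim (\<lambda>T :: real. LINT s:{0..T}|lborel. (1 :: real)) at_top at_top"
  proof (rule filterlim_mono_eventually[OF filterlim_ident order_refl order_refl])
    show "\<forall>\<^sub>F T :: real in at_top. T = (LINT s:{0..T}|lborel. (1 :: real))"
      using eventually_ge_at_top[of 0] by eventually_elim (simp add: set_lebesgue_integral_def)
  qed
  note average = opt[of "\<lambda>_. 1", OF _ _ this]
  show ?thesis
    using h Vgrid discounted average unfolding average_functional_eq_discounted V_def
    by (intro exI[of _ h]) (simp add: Let_def)
qed

end
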